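(* Let $\Omega\subset\mathbb R^n$ be a bounded polyhedral Lipschitz domain, let $\mathcal T$ be a regular triangulation of $\Omega$ into $n$-simplices and $\hat{\mathcal T}\in\mathbb T(\mathcal T)$ a refinement of $\mathcal T$ by successive bisections. Let $C(n)$ be the constant of the discrete Poincaré inequality (i.e. $C(n)^2=(4M-3)/(3n(n+2))$ with $M$ such that $M$-fold bisection halves diameters of all simplices) and set $\kappa_{NC}^2:=C(n)^2+\frac{1}{(n+1)(n+2)n^2}$. For $\hat v_{CR}\in CR^1_0(\hat{\mathcal T})$ let $I_{NC}\hat v_{CR}\in CR^1_0(\mathcal T)$ be defined by $(I_{NC}\hat v_{CR})(\operatorname{mid}(E))=|E|^{-1}\int_E\hat v_{CR}\,ds$ for all sides $E$ of $\mathcal T$. Then for every $K\in\mathcal T$, $$h_K^{-1}\|\hat v_{CR}-I_{NC}\hat v_{CR}\|_{L^2(K)}\le\kappa_{NC}\,\|\nabla_{NC}(\hat v_{CR}-I_{NC}\hat v_{CR})\|_{L^2(K)}.$$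
   Context: Bisection is as follows: an $n$-simplex $T=\operatorname{conv}\{P_1,\dots,P_{n+1}\}$ is identified with the ordered tuple $(P_1,\dots,P_{n+1})$ and split into $\operatorname{conv}\{P_1,(P_1+P_{n+1})/2,P_2,\dots,P_n\}$ and $\operatorname{conv}\{P_{n+1},(P_1+P_{n+1})/2,P_2,\dots,P_n\}$, with children orderings fixed by the bisection rule (newest vertex bisection for $n=2$, Stevenson's rule for $n\ge 3$); $\mathbb T(\mathcal T)$ is the set of regular triangulations obtained from $\mathcal T$ by finitely many successive bisections. $CR^1_0(\mathcal T)$ is the Crouzeix–Raviart space: piecewise affine functions on $\mathcal T$ that are continuous at the barycenter $\operatorname{mid}(E)$ of every interior side $E$ and vanish at the barycenter of every boundary side. $\nabla_{NC}$ is the piecewise gradient, $h_K=\operatorname{diam}(K)$. *)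

theory Defs
  imports "HOL-Analysis.Analysis"
begin

text \<open>An ordered n-simplex in R^n is a list of its n+1 vertices (P_1,...,P_{n+1}) together with
 Stevenson's type gamma in {0..n-1}; the ordering and the type are the data fixed by the
 bisection rule.\<close>

type_synonym 'n tsimplex = "(real^'n) list \<times> nat"

definition verts :: "('n::finite) tsimplex \<Rightarrow> (real^'n) set" where
  "verts S = set (fst S)"

definition sconv :: "('n::finite) tsimplex \<Rightarrow> (real^'n) set" where
  "sconv S = convex hull (verts S)"

definition nondeg_simplex :: "('n::finite) tsimplex \<Rightarrow> bool" where
  "nondeg_simplex S \<longleftrightarrow> length (fst S) = CARD('n) + 1 \<and> distinct (fst S)
     \<and> \<not> affine_dependent (verts S) \<and> snd S < CARD('n)"

text \<open>Stevenson's bisection rule: (x_0,...,x_n)_gamma is split along the edge x_0 x_n with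
 midpoint m into (x_0, m, x_1..x_gamma, x_{gamma+1}..x_{n-1})_{gamma+1 mod n} and
 (x_n, m, x_1..x_gamma, x_{n-1}..x_{gamma+1})_{gamma+1 mod n}.  For n = 2 both children are
 (P_1,m,P_2) and (P_3,m,P_2) irrespective of gamma, i.e. newest vertex bisection.\<close>

definition bisect :: "('n::finite) tsimplex \<Rightarrow> 'n tsimplex \<times> 'n tsimplex" where
  "bisect S = (let xs = fst S; g = snd S; n = length xs - 1;
       x0 = xs ! 0; xn = xs ! n; m = (1/2) *\<^sub>R (x0 + xn);
       inner_pts = take (n - 1) (drop 1 xs); a = take g inner_pts; b = drop g inner_pts;
       g' = (g + 1) mod n
     in ((x0 # m # a @ b, g'), (xn # m # a @ rev b, g')))"

definition children :: "('n::finite) tsimplex \<Rightarrow> 'n tsimplex set" where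
  "children S = {fst (bisect S), snd (bisect S)}"

fun descendants :: "('n::finite) tsimplex \<Rightarrow> nat \<Rightarrow> 'n tsimplex set" where
  "descendants S 0 = {S}"
| "descendants S (Suc k) = \<Union> (children ` descendants S k)"

definition bisect_step :: "('n::finite) tsimplex set \<Rightarrow> 'n tsimplex set \<Rightarrow> bool" where
  "bisect_step T T' \<longleftrightarrow> (\<exists>S\<in>T. T' = (T - {S}) \<union> children S)"

definition regular_triangulation :: "('n::finite) tsimplex set \<Rightarrow> bool" where
  "regular_triangulation T \<longleftrightarrow> finite T \<and> (\<forall>S\<in>T. nondeg_simplex S) \<and>
     (\<forall>S\<in>T. \<forall>S'\<in>T. S \<noteq> S' \<longrightarrow>
        verts S \<noteq> verts S' \<and> sconv S \<inter> sconv S' = convex hull (verts S \<inter> verts S'))"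

definition triangulates :: "('n::finite) tsimplex set \<Rightarrow> (real^'n) set \<Rightarrow> bool" where
  "triangulates T \<Omega> \<longleftrightarrow> regular_triangulation T \<and> \<Union> (sconv ` T) = closure \<Omega>"

definition refinements :: "('n::finite) tsimplex set \<Rightarrow> 'n tsimplex set set" where
  "refinements T = {T'. bisect_step\<^sup>*\<^sup>* T T' \<and> regular_triangulation T'}"

definition lipschitz_domain :: "(real^'n) set \<Rightarrow> bool" where
  "lipschitz_domain \<Omega> \<longleftrightarrow> open \<Omega> \<and> connected \<Omega> \<and> \<Omega> \<noteq> {} \<and>
     (\<forall>x\<in>frontier \<Omega>. \<exists>e r L (g :: real^'n \<Rightarrow> real). norm e = 1 \<and> r > 0 \<and>
        (\<forall>y z. \<bar>g (y - (y \<bullet> e) *\<^sub>R e) - g (z - (z \<bullet> e) *\<^sub>R e)\<bar>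
                 \<le> L * norm ((y - (y \<bullet> e) *\<^sub>R e) - (z - (z \<bullet> e) *\<^sub>R e))) \<and>
        (\<forall>y\<in>ball x r. y \<in> \<Omega> \<longleftrightarrow> y \<bullet> e < g (y - (y \<bullet> e) *\<^sub>R e)))"

definition sides :: "('n::finite) tsimplex \<Rightarrow> (real^'n) set set" where
  "sides S = {verts S - {p} | p. p \<in> verts S}"

definition mid :: "(real^'n) set \<Rightarrow> real^'n" where
  "mid E = (1 / real (card E)) *\<^sub>R (\<Sum>p\<in>E. p)"

definition affine_fun :: "(real^'n \<Rightarrow> real) \<Rightarrow> bool" where
  "affine_fun f \<longleftrightarrow> (\<exists>a b. \<forall>x. f x = a \<bullet> x + b)"

definition agrad :: "(real^'n \<Rightarrow> real) \<Rightarrow> real^'n" where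
  "agrad f = (SOME a. \<exists>b. \<forall>x. f x = a \<bullet> x + b)"

text \<open>A piecewise affine function on T is a family of affine functions indexed by the elements.
 CR^1_0(T): continuity at midpoints of shared sides, zero at midpoints of boundary sides.\<close>
definition CR0 :: "('n::finite) tsimplex set \<Rightarrow> (real^'n) set \<Rightarrow> ('n tsimplex \<Rightarrow> real^'n \<Rightarrow> real) \<Rightarrow> bool" where
  "CR0 T \<Omega> v \<longleftrightarrow> (\<forall>S\<in>T. affine_fun (v S)) \<and>
     (\<forall>S\<in>T. \<forall>S'\<in>T. \<forall>E\<in>sides S. E \<in> sides S' \<longrightarrow> v S (mid E) = v S' (mid E)) \<and>
     (\<forall>S\<in>T. \<forall>E\<in>sides S. convex hull E \<subseteq> frontier \<Omega> \<longrightarrow> v S (mid E) = 0)"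

text \<open>(n-1)-dimensional surface integrals over a flat side E are expressed through the unit-height
 cylinder over conv E in the normal direction: |E| = Lebesgue measure of the cylinder and
 \<open>\<integral>_E g ds = \<integral>_cyl g(proj x) dx\<close> (Fubini).\<close>

definition snormal :: "(real^'n) set \<Rightarrow> real^'n" where
  "snormal E = (SOME \<nu>. norm \<nu> = 1 \<and> (\<forall>p\<in>E. \<forall>q\<in>E. (p - q) \<bullet> \<nu> = 0))"

definition sproj :: "(real^'n) set \<Rightarrow> real^'n \<Rightarrow> real^'n" where
  "sproj E x = x - ((x - (SOME p. p \<in> E)) \<bullet> snormal E) *\<^sub>R snormal E"

definition cyl :: "(real^'n) set \<Rightarrow> (real^'n) set" where
  "cyl E = (\<lambda>(y, t). y + t *\<^sub>R snormal E) ` (convex hull E \<times> {0..1})"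

definition side_mean :: "(real^'n) set \<Rightarrow> (real^'n \<Rightarrow> real) \<Rightarrow> real" where
  "side_mean E g = integral (cyl E) (\<lambda>x. g (sproj E x)) / measure lebesgue (cyl E)"

definition fine_elem :: "('n::finite) tsimplex set \<Rightarrow> 'n tsimplex \<Rightarrow> real^'n \<Rightarrow> 'n tsimplex" where
  "fine_elem Th K x = (SOME S. S \<in> Th \<and> sconv S \<subseteq> sconv K \<and> x \<in> sconv S)"

text \<open>Restriction to K of the fine function (well defined a.e. on K).\<close>
definition restr :: "('n::finite) tsimplex set \<Rightarrow> ('n tsimplex \<Rightarrow> real^'n \<Rightarrow> real) \<Rightarrow> 'n tsimplex \<Rightarrow> real^'n \<Rightarrow> real" where
  "restr Th v K x = v (fine_elem Th K x) x"

definition grad_diff :: "('n::finite) tsimplex set \<Rightarrow> ('n tsimplex \<Rightarrow> real^'n \<Rightarrow> real)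
    \<Rightarrow> ('n tsimplex \<Rightarrow> real^'n \<Rightarrow> real) \<Rightarrow> 'n tsimplex \<Rightarrow> real^'n \<Rightarrow> real^'n" where
  "grad_diff Th v w K x = agrad (v (fine_elem Th K x)) - agrad (w K)"

definition L2norm_on :: "(real^'n) set \<Rightarrow> (real^'n \<Rightarrow> real) \<Rightarrow> real" where
  "L2norm_on A f = sqrt (integral A (\<lambda>x. (f x)\<^sup>2))"

definition halving_number :: "nat \<Rightarrow> ('n::finite) tsimplex set \<Rightarrow> bool" where
  "halving_number M T \<longleftrightarrow> (\<forall>K\<in>T. \<forall>k. \<forall>S\<in>descendants K k. \<forall>S'\<in>descendants S M.
      diameter (sconv S') \<le> diameter (sconv S) / 2)"

definition Cn_sq :: "nat \<Rightarrow> nat \<Rightarrow> real" where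
  "Cn_sq n M = (4 * real M - 3) / (3 * real n * (real n + 2))"

definition kappa_NC :: "nat \<Rightarrow> nat \<Rightarrow> real" where
  "kappa_NC n M = sqrt (Cn_sq n M + 1 / ((real n + 1) * (real n + 2) * (real n)\<^sup>2))"

end

theory Submission
  imports Defs
begin

text \<open>
  Let \<open>u\<close> be the fine function minus its interpolant on \<open>K\<close> and \<open>G\<close> its piecewise gradient. For every simplex
  \<open>S\<close> in the bisection tree below \<open>K\<close> and every point \<open>p\<close>, the integral of \<open>(x - p) \<bullet> G + n u\<close> over \<open>S\<close> is a
  combination of the means of \<open>u\<close> over the sides of \<open>S\<close>, because the jumps of \<open>u\<close> have mean zero on fine sides.
  If \<open>S\<close> is bisected, taking \<open>p\<close> to be the vertex of each child opposite to the common side eliminates all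
  sides but that one, so the difference of the means of \<open>u\<close> over the two children is a weighted integral of \<open>G\<close>,
  and the Cauchy-Schwarz inequality gives
  \<open>var S \<le> var S\<^sub>1 + var S\<^sub>2 + c\<^sub>0 (diam S)\<^sup>2 \<parallel>G\<parallel>\<^sup>2\<close> with
  \<open>c\<^sub>0 = (n\<^sup>2 - 1/2) / (n\<^sup>2 (n + 1) (n + 2))\<close>. Summing over the generations, whose diameters are halved
  every \<open>M\<close> steps, bounds \<open>var K\<close> by \<open>(4 M / 3) c\<^sub>0 (diam K)\<^sup>2 \<parallel>G\<parallel>\<^sup>2\<close>. On \<open>K\<close> itself all side means vanish,
  and \<open>p\<close> the barycenter bounds the mean of \<open>u\<close>. Comparing volumes of descendants shows \<open>n \<le> M\<close>, which makes
  the sum of both contributions at most \<open>\<kappa>\<^sup>2 (diam K)\<^sup>2 \<parallel>G\<parallel>\<^sup>2\<close>.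
\<close>

section \<open>Affine change of variables\<close>

text \<open>The side means that define the interpolant live on null sets, where the fine function is
  double valued and the element is picked by \<open>SOME\<close>. Hence every surface integral is a
  volume integral over a cylinder, the relative boundary of a side is discarded as a null set, and
  \<open>elem_at_boundary\<close> shows that on the boundary of \<open>K\<close> the choice of the
  element is forced almost everywhere. No divergence theorem occurs: on one element the Green
  identity is algebra in the vertex values.

  Origin of the constants: \<open>Cn_sq\<close> is (4M/3 - 1) / (n(n+2)), that is, 1 / (n(n+2)) per
  generation with one unit deducted. The constant c0 per generation obtained here is smaller than 1
  / (n(n+2)) by (n + 1/2) / (n^2 (n+1)(n+2)). Over all generations this saves 4M/3 times that
  amount, and for M at least n the saving, together with the extra term in \<open>kappa_NC\<close>,
  covers both the deducted unit and the price 1 / ((n+1)^2 (n+2)) of the mean of u on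
  \<open>K\<close>.\<close>

text \<open>Uniqueness of Haar measure, by Fubini: an affine map scales integrals by a constant, whose value is
  never needed as a determinant.\<close>

lemma translation_invariant_lborel_scale:
  fixes N :: "('a::euclidean_space) measure"
  assumes sets: "sets N = sets borel" and sf: "sigma_finite_measure N"
    and inv: "\<And>B y. B \<in> sets borel \<Longrightarrow> emeasure N ((+) y -` B) = emeasure N B"
    and B: "B \<in> sets borel"
  shows "emeasure lborel (cball 0 1 :: 'a set) * emeasure N B = emeasure lborel B * emeasure N (cball 0 1)"
proof -
  interpret N: sigma_finite_measure N by (fact sf)
  interpret P: pair_sigma_finite lborel N
    by (intro pair_sigma_finite.intro sigma_finite_lborel sf)
  let ?A = "cball (0::'a) 1"
  have [measurable]: "?A \<in> sets borel" "B \<in> sets borel" using B by auto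
  have [measurable_cong]: "sets N = sets borel" by (fact sets)
  \<comment> \<open>This double integral is evaluated twice. Integrating over y first gives the left
    side by invariance of \<open>N\<close>; substituting x - y for x by invariance of
    \<open>lborel\<close> and then integrating over y gives the right side of the claim.\<close>
  have "emeasure lborel ?A * emeasure N B = (\<integral>\<^sup>+x. \<integral>\<^sup>+y. indicator ?A x * indicator B (x + y) \<partial>N \<partial>lborel)"
  proof -
    have "(\<integral>\<^sup>+y. indicator ?A x * indicator B (x + y) \<partial>N) = indicator ?A x * emeasure N B" for x
    proof -
      have "(\<integral>\<^sup>+y. indicator ?A x * indicator B (x + y) \<partial>N) = indicator ?A x * (\<integral>\<^sup>+y. indicator B (x + y) \<partial>N)"
        by (rule nn_integral_cmult) measurable
      also have "(\<integral>\<^sup>+y. indicator B (x + y) \<partial>N) = (\<integral>\<^sup>+y. indicator ((+) x -` B) y \<partial>N)"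
        by (intro nn_integral_cong) (auto simp: indicator_def)
      also have "\<dots> = emeasure N ((+) x -` B)"
      proof (rule nn_integral_indicator)
        have "(+) x -` B \<inter> space borel \<in> sets borel"
          by (rule measurable_sets[where A = borel]) auto
        then show "(+) x -` B \<in> sets N" by (simp add: sets)
      qed
      also have "\<dots> = emeasure N B" by (rule inv) fact
      finally show ?thesis .
    qed
    then show ?thesis by (simp add: nn_integral_multc)
  qed
  also have "\<dots> = (\<integral>\<^sup>+y. \<integral>\<^sup>+x. indicator ?A x * indicator B (x + y) \<partial>lborel \<partial>N)"
    by (rule P.Fubini'[symmetric]) measurable
  also have "\<dots> = (\<integral>\<^sup>+y. \<integral>\<^sup>+x. indicator ?A (x - y) * indicator B x \<partial>lborel \<partial>N)"
  proof (rule nn_integral_cong)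
    fix y :: 'a
    have "(\<integral>\<^sup>+x. indicator ?A (x - y) * indicator B x \<partial>lborel)
        = (\<integral>\<^sup>+x. indicator ?A (x - y) * indicator B x \<partial>distr lborel borel ((+) y))"
      by (simp add: lborel_distr_plus)
    also have "\<dots> = (\<integral>\<^sup>+x. indicator ?A (y + x - y) * indicator B (y + x) \<partial>lborel)"
      by (rule nn_integral_distr) measurable
    finally show "(\<integral>\<^sup>+x. indicator ?A x * indicator B (x + y) \<partial>lborel)
      = (\<integral>\<^sup>+x. indicator ?A (x - y) * indicator B x \<partial>lborel)"
      by (simp add: add.commute)
  qed
  also have "\<dots> = (\<integral>\<^sup>+x. \<integral>\<^sup>+y. indicator ?A (x - y) * indicator B x \<partial>N \<partial>lborel)"
    by (rule P.Fubini') measurable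
  also have "\<dots> = (\<integral>\<^sup>+x. emeasure N ?A * indicator B x \<partial>lborel)"
  proof (rule nn_integral_cong)
    fix x :: 'a
    have "(\<integral>\<^sup>+y. indicator ?A (x - y) * indicator B x \<partial>N) = (\<integral>\<^sup>+y. indicator ?A (x - y) \<partial>N) * indicator B x"
      by (rule nn_integral_multc) measurable
    \<comment> \<open>The ball is symmetric, so the y with x - y in it form a translate of it; this
      is why a ball is the reference set.\<close>
    also have "(\<integral>\<^sup>+y. indicator ?A (x - y) \<partial>N) = (\<integral>\<^sup>+y. indicator ((+) (-x) -` ?A) y \<partial>N)"
      by (intro nn_integral_cong) (auto simp: indicator_def dist_norm norm_minus_commute)
    also have "\<dots> = emeasure N ((+) (-x) -` ?A)"
    proof (rule nn_integral_indicator)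
      have "(+) (-x) -` ?A \<inter> space borel \<in> sets borel"
        by (rule measurable_sets[where A = borel]) auto
      then show "(+) (-x) -` ?A \<in> sets N" by (simp add: sets)
    qed
    also have "\<dots> = emeasure N ?A" by (rule inv) simp
    finally show "(\<integral>\<^sup>+y. indicator ?A (x - y) * indicator B x \<partial>N) = emeasure N ?A * indicator B x" .
  qed
  also have "\<dots> = emeasure lborel B * emeasure N ?A"
    using nn_integral_cmult_indicator[of B lborel "emeasure N ?A"] by (simp add: mult.commute)
  finally show ?thesis .
qed

lemma integral_affine_image:
  fixes L :: "'a::euclidean_space \<Rightarrow> 'a"
  assumes "linear L" "inj L"
  shows "\<exists>c::real. \<forall>S f::'a\<Rightarrow>real. compact S \<longrightarrow> continuous_on UNIV f \<longrightarrow>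
     integral ((\<lambda>x. L x + d) ` S) f = c * integral S (\<lambda>x. f (L x + d))"
proof -
  define h where "h = (\<lambda>x. L x + d)"
  have contL: "continuous_on UNIV L" using assms(1) by (simp add: linear_continuous_on linear_linear)
  have conth: "continuous_on UNIV h" unfolding h_def by (intro continuous_intros contL)
  have [measurable]: "h \<in> borel_measurable borel" using conth by (rule borel_measurable_continuous_onI)
  have injh: "inj h" using assms(2) by (auto simp: h_def inj_def)
  obtain K where K: "linear K" "K \<circ> L = id"
    using assms linear_injective_left_inverse by blast
  have LK: "L (K y) = y" for y
    using K assms linear_inverse_left[of L K] by (metis comp_apply id_apply)
  have KL: "K (L y) = y" for y using K by (metis comp_apply id_apply)
  define N where "N = distr lborel borel h"
  have cb: "h -` B = (\<lambda>y. K (y - d)) ` B" for B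
  proof -
    have "x \<in> (\<lambda>y. K (y - d)) ` B" if "h x \<in> B" for x
      by (rule image_eqI[of _ _ "h x"]) (use that in \<open>simp_all add: h_def KL\<close>)
    then show ?thesis by (auto simp: h_def LK)
  qed
  have Nfin: "emeasure N (cbox a b) < \<infinity>" for a b
  proof -
    have "compact (h -` cbox a b)"
      unfolding cb using K
      by (intro compact_continuous_image continuous_intros linear_continuous_on_compose[OF _ K(1)]) (auto intro!: continuous_intros)
    then show ?thesis unfolding N_def by (subst emeasure_distr) (use emeasure_compact_finite in auto)
  qed
  have sfN: "sigma_finite_measure N"
  proof
    show "\<exists>A. countable A \<and> A \<subseteq> sets N \<and> \<Union> A = space N \<and> (\<forall>a\<in>A. emeasure N a \<noteq> \<infinity>)"
    proof (intro exI conjI)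
      show "countable (range (\<lambda>n::nat. cball (0::'a) (real n)))" by simp
      show "range (\<lambda>n::nat. cball (0::'a) (real n)) \<subseteq> sets N" by (auto simp: N_def)
      show "\<Union> (range (\<lambda>n::nat. cball (0::'a) (real n))) = space N"
        by (auto simp: N_def real_arch_simple)
      show "\<forall>a\<in>range (\<lambda>n::nat. cball (0::'a) (real n)). emeasure N a \<noteq> \<infinity>"
      proof safe
        fix n assume inf: "emeasure N (cball (0::'a) (real n)) = \<infinity>"
        obtain a where "cball (0::'a) (real n) \<subseteq> cbox (-a) a"
          using bounded_subset_cbox_symmetric[of "cball (0::'a) (real n)"] by auto
        then have "emeasure N (cball 0 (real n)) \<le> emeasure N (cbox (-a) a)"
          by (intro emeasure_mono) (auto simp: N_def)
        then show False using Nfin[of "-a" a] inf by (auto simp: top_unique)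
      qed
    qed
  qed
  \<comment> \<open>A translation by \<open>y\<close> in the target pulls back under
    \<open>h\<close> to a translation by \<open>K y\<close>, which preserves
    \<open>lborel\<close>.\<close>
  have inv: "emeasure N ((+) y -` B) = emeasure N B" if [measurable]: "B \<in> sets borel" for B y
  proof -
    have [measurable]: "(+) y -` B \<in> sets borel"
      using measurable_sets[of "(+) y" borel borel B] by simp
    have "emeasure N ((+) y -` B) = emeasure lborel (h -` ((+) y -` B))"
      unfolding N_def by (subst emeasure_distr) auto
    also have "h -` ((+) y -` B) = (+) (K y) -` (h -` B)"
      using assms(1) by (auto simp: h_def linear_add LK algebra_simps)
    also have "emeasure lborel \<dots> = emeasure (distr lborel borel ((+) (K y))) (h -` B)"
      by (subst emeasure_distr) (auto intro: measurable_sets[of h borel borel B, simplified])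
    also have "\<dots> = emeasure N B"
      unfolding lborel_distr_plus N_def by (subst emeasure_distr) auto
    finally show ?thesis .
  qed
  let ?U = "cball (0::'a) 1"
  have U0: "emeasure lborel ?U \<noteq> 0" "emeasure lborel ?U \<noteq> \<infinity>"
  proof -
    show "emeasure lborel ?U \<noteq> 0"
      using content_cball_pos[of 1 "0::'a"] by (auto simp: measure_def)
    show "emeasure lborel ?U \<noteq> \<infinity>"
      using emeasure_compact_finite[of ?U] by auto
  qed
  have NU: "emeasure N ?U \<noteq> \<infinity>"
  proof -
    obtain a where "?U \<subseteq> cbox (-a) a"
      using bounded_subset_cbox_symmetric[of ?U] by auto
    then have "emeasure N ?U \<le> emeasure N (cbox (-a) a)"
      by (intro emeasure_mono) (auto simp: N_def)
    then show ?thesis using Nfin[of "-a" a] by (auto simp: top_unique)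
  qed
  define c where "c = measure N ?U / measure lborel ?U"
  have c: "c \<ge> 0" by (simp add: c_def)
  have N: "N = density lborel (\<lambda>_. ennreal c)"
  proof (rule measure_eqI)
    show "sets N = sets (density lborel (\<lambda>_. ennreal c))" by (simp add: N_def)
    fix B assume "B \<in> sets N"
    then have B: "B \<in> sets borel" by (simp add: N_def)
    have *: "emeasure lborel ?U * emeasure N B = emeasure lborel B * emeasure N ?U"
      by (rule translation_invariant_lborel_scale) (use B sfN inv in \<open>auto simp: N_def\<close>)
    have "emeasure N B = emeasure N ?U / emeasure lborel ?U * emeasure lborel B"
      using * U0 by (metis ennreal_mult_divide_eq ennreal_times_divide infinity_ennreal_def mult.commute)
    also have "emeasure N ?U / emeasure lborel ?U = ennreal c"
      unfolding c_def using U0 NU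
      by (simp add: emeasure_eq_ennreal_measure divide_ennreal zero_less_measure_iff)
    finally show "emeasure N B = emeasure (density lborel (\<lambda>_. ennreal c)) B"
      using B by (simp add: emeasure_density_const)
  qed
  \<comment> \<open>Here \<open>c\<close> is the density of the push-forward; the constant claimed
    is its reciprocal.\<close>
  have c0: "c \<noteq> 0"
  proof
    assume "c = 0"
    then have "emeasure N UNIV = 0" unfolding N by (simp add: emeasure_density)
    then show False unfolding N_def by (subst (asm) emeasure_distr) auto
  qed
  show ?thesis
  proof (intro exI allI impI)
    fix S :: "'a set" and f :: "'a \<Rightarrow> real" assume S: "compact S" and f: "continuous_on UNIV f"
    have hS: "compact (h ` S)" using S conth by (meson compact_continuous_image continuous_on_subset subset_UNIV)
    have [measurable]: "f \<in> borel_measurable borel" using f by (rule borel_measurable_continuous_onI)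
    have [measurable]: "h ` S \<in> sets borel" "S \<in> sets borel" using hS S by (auto intro: borel_compact)
    have i1: "set_integrable lborel (h ` S) f"
      by (rule borel_integrable_compact[folded set_integrable_def, OF hS]) (use f continuous_on_subset in blast)
    have i2: "set_integrable lborel S (\<lambda>x. f (h x))"
      by (rule borel_integrable_compact[folded set_integrable_def, OF S]) (rule continuous_on_compose2[OF f continuous_on_subset[OF conth]], auto)
    have "(\<integral>x. indicator (h ` S) x *\<^sub>R f x \<partial>N) = c * (\<integral>x. indicator (h ` S) x *\<^sub>R f x \<partial>lborel)"
      unfolding N by (subst integral_density) (auto simp: c)
    moreover have "(\<integral>x. indicator (h ` S) x *\<^sub>R f x \<partial>N) = (\<integral>x. indicator (h ` S) (h x) *\<^sub>R f (h x) \<partial>lborel)"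
      unfolding N_def by (rule integral_distr) auto
    moreover have "indicator (h ` S) (h x) = (indicator S x :: real)" for x
      using injh by (auto simp: indicator_def inj_def)
    ultimately have "(\<integral>x. indicator S x *\<^sub>R f (h x) \<partial>lborel) = c * (\<integral>x. indicator (h ` S) x *\<^sub>R f x \<partial>lborel)"
      by simp
    then have "integral S (\<lambda>x. f (h x)) = c * integral (h ` S) f"
      using set_borel_integral_eq_integral(2)[OF i1] set_borel_integral_eq_integral(2)[OF i2]
      by (simp add: set_lebesgue_integral_def)
    then show "integral ((\<lambda>x. L x + d) ` S) f = (1/c) * integral S (\<lambda>x. f (L x + d))"
      using c0 by (simp add: h_def)
  qed
qed

section \<open>Affine functions and barycentric coordinates\<close>

lemma affine_fun_continuous: "affine_fun f \<Longrightarrow> continuous_on S f"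
proof -
  assume "affine_fun f"
  then obtain a b where "f = (\<lambda>x. a \<bullet> x + b)" by (auto simp: affine_fun_def)
  then show ?thesis by (auto intro!: continuous_intros)
qed

lemma affine_fun_sum:
  assumes "affine_fun f" "sum u V = 1"
  shows "f (\<Sum>v\<in>V. u v *\<^sub>R v) = (\<Sum>v\<in>V. u v * f v)"
proof -
  obtain a b where f: "\<And>x. f x = a \<bullet> x + b" using assms(1) by (auto simp: affine_fun_def)
  have "(\<Sum>v\<in>V. u v * f v) = (\<Sum>v\<in>V. u v * (a \<bullet> v)) + (\<Sum>v\<in>V. u v) * b"
    by (simp add: f distrib_left sum.distrib sum_distrib_right)
  then show ?thesis using assms(2) by (simp add: f inner_sum_right)
qed

lemma affine_fun_const [simp]: "affine_fun (\<lambda>x. c)"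
  unfolding affine_fun_def by (rule exI[of _ 0]) simp

lemma affine_fun_inner [simp]: "affine_fun (\<lambda>x. c \<bullet> x)" "affine_fun (\<lambda>x. x \<bullet> c)"
  unfolding affine_fun_def by (rule exI[of _ c]; simp add: inner_commute)+

lemma affine_fun_add: "affine_fun f \<Longrightarrow> affine_fun g \<Longrightarrow> affine_fun (\<lambda>x. f x + g x)"
proof -
  assume "affine_fun f" "affine_fun g"
  then obtain a b c d where "\<And>x. f x = a \<bullet> x + b" "\<And>x. g x = c \<bullet> x + d" by (auto simp: affine_fun_def)
  then have "\<forall>x. f x + g x = (a + c) \<bullet> x + (b + d)" by (simp add: inner_add_left)
  then show ?thesis unfolding affine_fun_def by blast
qed

lemma affine_fun_cmult: "affine_fun f \<Longrightarrow> affine_fun (\<lambda>x. c * f x)"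
proof -
  assume "affine_fun f"
  then obtain a b where "\<And>x. f x = a \<bullet> x + b" by (auto simp: affine_fun_def)
  then have "\<forall>x. c * f x = (c *\<^sub>R a) \<bullet> x + c * b" by (simp add: distrib_left)
  then show ?thesis unfolding affine_fun_def by blast
qed

lemma affine_fun_diff: "affine_fun f \<Longrightarrow> affine_fun g \<Longrightarrow> affine_fun (\<lambda>x. f x - g x)"
  using affine_fun_add[OF _ affine_fun_cmult, of f g "-1"] by simp

lemma affine_fun_compose_scaleR:
  assumes "affine_fun f" "affine_fun g" shows "affine_fun (\<lambda>x. f (x + g x *\<^sub>R w))"
proof -
  obtain a b where f: "\<And>x. f x = a \<bullet> x + b" using assms(1) by (auto simp: affine_fun_def)
  have "(\<lambda>x. f (x + g x *\<^sub>R w)) = (\<lambda>x. f x + (a \<bullet> w) * g x)"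
    by (auto simp: f inner_add_right)
  then show ?thesis using assms by (simp add: affine_fun_add affine_fun_cmult)
qed

lemma affine_fun_nonneg_hull:
  assumes "affine_fun f" "\<And>q. q \<in> A \<Longrightarrow> 0 \<le> f q" "x \<in> convex hull A"
  shows "0 \<le> f x"
proof -
  obtain a b where f: "\<And>x. f x = a \<bullet> x + b" using assms(1) by (auto simp: affine_fun_def)
  have "convex {x. 0 \<le> f x}"
  proof -
    have "{x. 0 \<le> f x} = {x. - b \<le> a \<bullet> x}" by (auto simp: f)
    then show ?thesis by (simp add: convex_halfspace_ge)
  qed
  then have "convex hull A \<subseteq> {x. 0 \<le> f x}" by (intro hull_minimal) (use assms in auto)
  then show ?thesis using assms by auto
qed

lemma affine_fun_zero_hull:
  assumes f: "affine_fun f" and z: "\<And>q. q \<in> A \<Longrightarrow> f q = 0" and x: "x \<in> convex hull A"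
  shows "f x = 0"
proof -
  have "0 \<le> f x" by (rule affine_fun_nonneg_hull[OF f _ x]) (simp add: z)
  moreover have "0 \<le> - 1 * f x"
    by (rule affine_fun_nonneg_hull[OF affine_fun_cmult[OF f] _ x]) (simp add: z)
  ultimately show ?thesis by simp
qed

lemma negligible_affine_fun_zero:
  assumes "affine_fun f" "f q \<noteq> 0" shows "negligible {x. f x = 0}"
proof -
  obtain a b where f: "\<And>x. f x = a \<bullet> x + b" using assms(1) by (auto simp: affine_fun_def)
  have "{x. f x = 0} = {x. a \<bullet> x = - b}" by (auto simp: f)
  moreover have "a \<noteq> 0 \<or> - b \<noteq> 0" using assms(2) by (auto simp: f)
  ultimately show ?thesis by (simp add: negligible_hyperplane)
qed

text \<open>Moving one vertex to the origin makes the remaining ones linearly independent, so a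
  linear functional with the prescribed differences exists. \<open>adjoint g 1\<close> is the vector
  representing it, as \<open>affine_fun\<close> demands.\<close>

lemma affine_interpolation:
  assumes "\<not> affine_dependent (V :: (real^'n) set)"
  shows "\<exists>f. affine_fun f \<and> (\<forall>q\<in>V. f q = c q)"
proof (cases "V = {}")
  case True
  then show ?thesis by (intro exI[of _ "\<lambda>x. 0"]) simp
next
  case False
  then obtain a where a: "a \<in> V" by auto
  have "independent ((\<lambda>x. - a + x) ` (V - {a}))"
    using assms a by (simp add: affine_dependent_iff_dependent2)
  then obtain g where g: "linear g" "\<forall>x\<in>(\<lambda>x. - a + x) ` (V - {a}). g x = c (a + x) - c a"
    using linear_independent_extend[where f = "\<lambda>x. c (a + x) - c a"] by blast
  have gr: "g x = adjoint g 1 \<bullet> x" for x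
    using adjoint_works[OF g(1), of x 1] by (simp add: inner_commute)
  show ?thesis
  proof (intro exI conjI ballI)
    show "affine_fun (\<lambda>x. adjoint g 1 \<bullet> x + (c a - g a))"
      by (auto simp: affine_fun_def)
    fix q assume q: "q \<in> V"
    show "adjoint g 1 \<bullet> q + (c a - g a) = c q"
    proof (cases "q = a")
      case True then show ?thesis by (simp add: gr)
    next
      case False
      then have "g (- a + q) = c q - c a" using g(2) q by fastforce
      then show ?thesis using linear_diff[OF g(1), of q a] by (simp add: gr[symmetric])
    qed
  qed
qed

section \<open>Full-dimensional simplices and barycentric coordinates\<close>

definition nsimplex :: "(real^'n) set \<Rightarrow> bool" where
  "nsimplex V \<longleftrightarrow> finite V \<and> card V = CARD('n) + 1 \<and> \<not> affine_dependent V"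

text \<open>Barycentric coordinates, extended to affine functions on the whole space. For a side the
  extension off its affine hull is an arbitrary choice; on the affine hull the values are
  determined.\<close>

definition bary :: "(real^'n) set \<Rightarrow> real^'n \<Rightarrow> real^'n \<Rightarrow> real" where
  "bary V q = (SOME f. affine_fun f \<and> (\<forall>r\<in>V. f r = (if r = q then 1 else 0)))"

context
  fixes V :: "(real^'n) set"
  assumes ind: "\<not> affine_dependent V"
begin

lemma bary_affine: "affine_fun (bary V q)"
  and bary_vertex: "r \<in> V \<Longrightarrow> bary V q r = (if r = q then 1 else 0)"
proof -
  have "affine_fun (bary V q) \<and> (\<forall>r\<in>V. bary V q r = (if r = q then 1 else 0))"
    unfolding bary_def using affine_interpolation[OF ind, of "\<lambda>r. if r = q then 1 else 0"] by (rule someI_ex)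
  then show "affine_fun (bary V q)" "r \<in> V \<Longrightarrow> bary V q r = (if r = q then 1 else 0)" by auto
qed

lemma bary_weights:
  assumes "q \<in> V" "sum u V = 1"
  shows "bary V q (\<Sum>v\<in>V. u v *\<^sub>R v) = u q"
proof -
  have "finite V" using assms(2) by (metis sum.infinite zero_neq_one)
  have "bary V q (\<Sum>v\<in>V. u v *\<^sub>R v) = (\<Sum>v\<in>V. u v * bary V q v)"
    by (rule affine_fun_sum[OF bary_affine assms(2)])
  also have "\<dots> = (\<Sum>v\<in>V. if v = q then u v else 0)"
    by (intro sum.cong) (auto simp: bary_vertex)
  finally show ?thesis using assms \<open>finite V\<close> by simp
qed

lemma bary_affine_hull:
  assumes "finite V" "x \<in> affine hull V"
  shows "(\<Sum>q\<in>V. bary V q x) = 1" "(\<Sum>q\<in>V. bary V q x *\<^sub>R q) = x"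
    "affine_fun f \<Longrightarrow> f x = (\<Sum>q\<in>V. bary V q x * f q)"
proof -
  obtain u where u: "sum u V = 1" "x = (\<Sum>v\<in>V. u v *\<^sub>R v)"
    using assms by (auto simp: affine_hull_finite)
  then have b: "bary V q x = u q" if "q \<in> V" for q using bary_weights that by simp
  show "(\<Sum>q\<in>V. bary V q x) = 1" using u b by simp
  show "(\<Sum>q\<in>V. bary V q x *\<^sub>R q) = x" using u b by simp
  show "f x = (\<Sum>q\<in>V. bary V q x * f q)" if "affine_fun f"
    using affine_fun_sum[OF that u(1)] u(2) b by simp
qed

lemma convex_hull_bary:
  assumes "finite V" "x \<in> affine hull V"
  shows "x \<in> convex hull V \<longleftrightarrow> (\<forall>q\<in>V. 0 \<le> bary V q x)"
proof
  assume x: "x \<in> convex hull V"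
  show "\<forall>q\<in>V. 0 \<le> bary V q x"
    by (intro ballI affine_fun_nonneg_hull[OF bary_affine _ x]) (simp add: bary_vertex)
next
  assume "\<forall>q\<in>V. 0 \<le> bary V q x"
  then show "x \<in> convex hull V"
    unfolding convex_hull_finite[OF assms(1)] using bary_affine_hull(1,2)[OF assms]
    by (intro CollectI exI[of _ "\<lambda>q. bary V q x"] conjI) (simp_all only:)
qed

lemma rel_interior_hull_bary:
  assumes "finite V"
  shows "x \<in> rel_interior (convex hull V) \<longleftrightarrow> x \<in> affine hull V \<and> (\<forall>q\<in>V. 0 < bary V q x)"
proof
  assume "x \<in> rel_interior (convex hull V)"
  then obtain u where u: "\<forall>q\<in>V. 0 < u q" "sum u V = 1" "(\<Sum>q\<in>V. u q *\<^sub>R q) = x"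
    using ind by (auto simp: rel_interior_convex_hull_explicit)
  then show "x \<in> affine hull V \<and> (\<forall>q\<in>V. 0 < bary V q x)"
    using bary_weights[of _ u] assms by (auto simp: affine_hull_finite)
next
  assume "x \<in> affine hull V \<and> (\<forall>q\<in>V. 0 < bary V q x)"
  then show "x \<in> rel_interior (convex hull V)"
    unfolding rel_interior_convex_hull_explicit[OF ind] using bary_affine_hull(1,2)[OF assms]
    by (intro CollectI exI[of _ "\<lambda>q. bary V q x"] conjI) blast+
qed

end

text \<open>A point in the relative interior of conv \<open>A\<close> has positive coordinate at
  every vertex of \<open>A\<close>, while a point of conv \<open>B\<close> has coordinate zero
  outside \<open>B\<close>. This is how common points of simplices are turned into common
  faces.\<close>

lemma rel_interior_face_subset:
  assumes ind: "\<not> affine_dependent (V :: (real^'n) set)" and fin: "finite V" and sub: "A \<subseteq> V" "B \<subseteq> V"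
    and x: "x \<in> rel_interior (convex hull A)" "x \<in> convex hull B"
  shows "A \<subseteq> B"
proof
  fix q assume q: "q \<in> A"
  have "\<not> affine_dependent A" using ind sub affine_dependent_subset by blast
  then obtain u where u: "\<forall>q\<in>A. 0 < u q" "sum u A = 1" "(\<Sum>q\<in>A. u q *\<^sub>R q) = x"
    using x(1) by (auto simp: rel_interior_convex_hull_explicit)
  have "bary V q x = (\<Sum>v\<in>A. u v * bary V q v)"
    using affine_fun_sum[OF bary_affine[OF ind] u(2)] u(3) by simp
  also have "\<dots> = (\<Sum>v\<in>A. if v = q then u v else 0)"
    using sub by (intro sum.cong) (auto simp: bary_vertex[OF ind])
  also have "\<dots> = u q" using q fin sub by (simp add: finite_subset)
  finally have pos: "0 < bary V q x" using u q by auto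
  show "q \<in> B"
  proof (rule ccontr)
    assume "q \<notin> B"
    then have "bary V q x = 0"
      using sub by (intro affine_fun_zero_hull[OF bary_affine[OF ind] _ x(2)]) (auto simp: bary_vertex[OF ind])
    then show False using pos by simp
  qed
qed

text \<open>A vanishing coordinate at \<open>v\<close> would put \<open>y\<close> into the hull of
  \<open>V - {v}\<close>, and then \<open>A\<close> would avoid \<open>v\<close>. The strict sign
  leaves room for small moves away from a face.\<close>

lemma rel_interior_weights:
  assumes V: "\<not> affine_dependent (V::(real^'n) set)" "finite V" and A: "A \<subseteq> V" and y: "y \<in> rel_interior (convex hull A)"
    and v: "v \<in> A"
  shows "0 < bary V v y"
proof (rule ccontr)
  assume "\<not> 0 < bary V v y"
  have yA: "y \<in> convex hull A" using y rel_interior_subset by blast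
  have "0 \<le> bary V v y"
    by (rule affine_fun_nonneg_hull[OF bary_affine[OF V(1)] _ yA]) (use A in \<open>auto simp: bary_vertex[OF V(1)]\<close>)
  then have 0: "bary V v y = 0" using \<open>\<not> 0 < bary V v y\<close> by simp
  have yV: "y \<in> convex hull V" using yA hull_mono[OF A, of convex] by auto
  have "y \<in> convex hull (V - {v})"
  proof -
    have aff: "y \<in> affine hull V" using yV convex_hull_subset_affine_hull by blast
    note b = bary_affine_hull(1,2)[OF V aff]
    have vV: "v \<in> V" using v A by auto
    have "(\<Sum>q\<in>V - {v}. bary V q y) = 1" "(\<Sum>q\<in>V - {v}. bary V q y *\<^sub>R q) = y"
      using b 0 vV V(2) by (simp_all add: sum.remove[of V v])
    moreover have "\<forall>q\<in>V - {v}. 0 \<le> bary V q y" using convex_hull_bary[OF V aff] yV by auto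
    ultimately show ?thesis
      by (subst convex_hull_finite) (use V(2) in \<open>auto intro!: exI[of _ "\<lambda>q. bary V q y"]\<close>)
  qed
  then have "A \<subseteq> V - {v}" using rel_interior_face_subset[OF V A Diff_subset y] by blast
  then show False using v by auto
qed

context
  fixes V :: "(real^'n) set"
  assumes V: "nsimplex V"
begin

lemma nsimplexD: "finite V" "card V = CARD('n) + 1" "\<not> affine_dependent V"
  using V by (auto simp: nsimplex_def)

lemma nsimplex_affine_hull: "affine hull V = UNIV"
  using affine_independent_span_eq[of V] nsimplexD by simp

lemmas nsimplex_bary_sum = bary_affine_hull(1)[OF nsimplexD(3,1), unfolded nsimplex_affine_hull, OF UNIV_I]
  and nsimplex_bary_expand = bary_affine_hull(3)[OF nsimplexD(3,1), unfolded nsimplex_affine_hull, OF UNIV_I]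
  and nsimplex_hull_bary = convex_hull_bary[OF nsimplexD(3,1), unfolded nsimplex_affine_hull, OF UNIV_I]
  and nsimplex_bary_affine = bary_affine[OF nsimplexD(3)]
  and nsimplex_bary_vertex = bary_vertex[OF nsimplexD(3)]

lemma nsimplex_interior: "interior (convex hull V) = rel_interior (convex hull V)"
  using rel_interior_interior[of "convex hull V"] nsimplex_affine_hull by (simp add: affine_hull_convex_hull)

lemma nsimplex_compact: "compact (convex hull V)"
  using nsimplexD by (simp add: finite_imp_compact_convex_hull)

lemma nsimplex_lmeasurable: "convex hull V \<in> lmeasurable"
  using nsimplex_compact lmeasurable_compact by blast

lemma nsimplex_measure_pos: "0 < measure lebesgue (convex hull V)"
proof -
  have "rel_interior (convex hull V) \<noteq> {}"
    using nsimplexD by (simp add: rel_interior_eq_empty) auto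
  then have "\<not> negligible (convex hull V)"
    using negligible_convex_interior[of "convex hull V"] nsimplex_interior by simp
  then show ?thesis
    using negligible_iff_measure0[OF nsimplex_lmeasurable] by (simp add: zero_less_measure_iff)
qed

lemma nsimplex_negligible_boundary: "negligible (convex hull V - interior (convex hull V))"
proof -
  have "convex hull V - interior (convex hull V) \<subseteq> frontier (convex hull V)"
    by (simp add: Diff_mono closure_subset frontier_def)
  then show ?thesis using negligible_convex_frontier[of "convex hull V"] negligible_subset by blast
qed

end

text \<open>If \<open>l a = 1\<close> and \<open>l b = -1\<close>, then \<open>shear l (b - a)\<close> is the skew reflection exchanging \<open>a\<close> and \<open>b\<close>.\<close>

definition shear :: "(real^'n \<Rightarrow> real) \<Rightarrow> real^'n \<Rightarrow> real^'n \<Rightarrow> real^'n" where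
  "shear l w x = x + l x *\<^sub>R w"

lemma shear_affine_decomp:
  assumes "affine_fun l"
  obtains L d where "linear L" "shear l w = (\<lambda>x. L x + d)"
proof -
  obtain a b where f: "\<And>x. l x = a \<bullet> x + b" using assms(1) by (auto simp: affine_fun_def)
  show ?thesis
  proof (rule that[of "\<lambda>x. x + (a \<bullet> x) *\<^sub>R w" "b *\<^sub>R w"])
    show "linear (\<lambda>x. x + (a \<bullet> x) *\<^sub>R w)"
      by (rule linearI) (auto simp: inner_add_right algebra_simps)
    show "shear l w = (\<lambda>x. x + (a \<bullet> x) *\<^sub>R w + b *\<^sub>R w)"
      by (auto simp: shear_def f algebra_simps)
  qed
qed

lemma shear_convex_hull:
  assumes "affine_fun l"
  shows "shear l w ` (convex hull A) = convex hull (shear l w ` A)"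
proof -
  obtain L d where L: "linear L" "shear l w = (\<lambda>x. L x + d)" using shear_affine_decomp[OF assms] .
  have "shear l w ` B = (\<lambda>x. d + x) ` (L ` B)" for B by (auto simp: L(2) image_image add.commute)
  then show ?thesis using convex_hull_linear_image[OF L(1), of A] convex_hull_translation[of d "L ` A"] by simp
qed

lemma shear_continuous: "affine_fun l \<Longrightarrow> continuous_on S (shear l w)"
  unfolding shear_def by (intro continuous_intros affine_fun_continuous)

lemma shear_integral_scale:
  fixes l :: "real^'n \<Rightarrow> real"
  assumes l: "affine_fun l" and inj: "inj (shear l w)"
  obtains c where "\<And>S f::real^'n \<Rightarrow> real. compact S \<Longrightarrow> continuous_on UNIV f \<Longrightarrow>
     integral (shear l w ` S) f = c * integral S (\<lambda>x. f (shear l w x))"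
proof -
  obtain L d where L: "linear L" "shear l w = (\<lambda>x. L x + d)" using shear_affine_decomp[OF l] .
  have "inj L" using inj by (auto simp: L(2) inj_def)
  then show ?thesis using integral_affine_image[OF L(1), of d] that unfolding L(2) by blast
qed

context
  fixes l :: "real^'n \<Rightarrow> real" and a b :: "real^'n"
  assumes l: "affine_fun l" and la: "l a = 1" and lb: "l b = -1"
begin

lemma shear_involution: "shear l (b - a) (shear l (b - a) x) = x"
proof -
  obtain u v where f: "\<And>x. l x = u \<bullet> x + v" using l by (auto simp: affine_fun_def)
  have "u \<bullet> b - u \<bullet> a = -2" using la lb by (simp add: f)
  then have "l (shear l (b - a) x) = - l x" by (simp add: shear_def f inner_add_right inner_diff_right)
  then show ?thesis by (simp add: shear_def)
qed

text \<open>The scaling constant of an involution satisfies \<open>c\<^sup>2 = 1\<close>, as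
  comparing the unit ball with its image in both directions shows, and it is nonnegative because
  volumes are.\<close>

lemma shear_integral:
  fixes f :: "real^'n \<Rightarrow> real"
  assumes "compact S" "continuous_on UNIV f"
  shows "integral (shear l (b - a) ` S) f = integral S (\<lambda>x. f (shear l (b - a) x))"
proof -
  let ?h = "shear l (b - a)"
  have "inj ?h" by (metis injI shear_involution)
  then obtain c where c: "\<And>S f::real^'n \<Rightarrow> real. compact S \<Longrightarrow> continuous_on UNIV f \<Longrightarrow>
     integral (?h ` S) f = c * integral S (\<lambda>x. f (?h x))"
    using shear_integral_scale[OF l] by blast
  let ?B = "cball (0::real^'n) 1"
  have hB: "compact (?h ` ?B)" using shear_continuous[OF l] by (intro compact_continuous_image) auto
  have hh: "?h ` ?h ` ?B = ?B" by (auto simp: image_image shear_involution)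
  have 1: "measure lebesgue (?h ` ?B) = c * measure lebesgue ?B"
    unfolding lmeasure_integral[OF lmeasurable_compact[OF hB]] lmeasure_integral[OF lmeasurable_compact[OF compact_cball]]
    by (rule c) auto
  have 2: "measure lebesgue ?B = c * measure lebesgue (?h ` ?B)"
    unfolding lmeasure_integral[OF lmeasurable_compact[OF hB]] lmeasure_integral[OF lmeasurable_compact[OF compact_cball]]
    using c[OF hB, of "\<lambda>_. 1"] unfolding hh by auto
  have pos: "0 < measure lebesgue ?B" using content_cball_pos[of 1 "0::real^'n"] by simp
  have "c * c * measure lebesgue ?B = 1 * measure lebesgue ?B" using 1 2 by simp
  then have "c\<^sup>2 = 1" unfolding power2_eq_square using pos by (subst (asm) mult_cancel_right) simp
  moreover have "0 \<le> c * measure lebesgue ?B" unfolding 1[symmetric] by simp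
  then have "0 \<le> c" using pos zero_le_mult_iff by (metis less_le_not_le)
  ultimately have "c = 1" by (simp add: power2_eq_1_iff)
  then show ?thesis using c[OF assms] by simp
qed

text \<open>The overlap lies in the hyperplane \<open>l x = 0\<close>, and the reflection preserves
  volume. The sets are arbitrary so that the lemma serves simplices as well as cylinders over
  sides.\<close>

lemma shear_halves:
  assumes A: "compact A1" "shear l (b - a) ` A1 = A2"
    and pos: "\<And>x. x \<in> A1 \<Longrightarrow> 0 \<le> l x" and neg: "\<And>x. x \<in> A2 \<Longrightarrow> l x \<le> 0"
  shows "negligible (A1 \<inter> A2)" "measure lebesgue A1 = measure lebesgue (A1 \<union> A2) / 2"
    "measure lebesgue A2 = measure lebesgue (A1 \<union> A2) / 2"
proof -
  have A2: "compact A2" unfolding A(2)[symmetric] by (intro compact_continuous_image shear_continuous l A)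
  have "A1 \<inter> A2 \<subseteq> {x. l x = 0}" using pos neg by force
  then show n: "negligible (A1 \<inter> A2)" 
    by (rule negligible_subset[OF negligible_affine_fun_zero[OF l, of a], rotated]) (simp add: la)
  have eq: "measure lebesgue A2 = measure lebesgue A1"
    unfolding lmeasure_integral[OF lmeasurable_compact[OF A(1)]] lmeasure_integral[OF lmeasurable_compact[OF A2]]
    using shear_integral[OF A(1), of "\<lambda>_. 1"] A(2) by auto
  have "measure lebesgue (A1 \<union> A2) = measure lebesgue A1 + measure lebesgue A2"
    using measure_Un3[OF lmeasurable_compact[OF A(1)] lmeasurable_compact[OF A2]] negligible_imp_measure0[OF n] by simp
  then show "measure lebesgue A1 = measure lebesgue (A1 \<union> A2) / 2"
    "measure lebesgue A2 = measure lebesgue (A1 \<union> A2) / 2" using eq by auto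
qed

end

section \<open>Bisection and moments of simplices\<close>

lemma compact_continuous_integrable:
  fixes f :: "'a::euclidean_space \<Rightarrow> real"
  assumes "compact S" "continuous_on UNIV f" shows "f integrable_on S"
  using borel_integrable_compact[folded set_integrable_def, OF assms(1) continuous_on_subset[OF assms(2)]]
  by (auto intro: set_borel_integral_eq_integral(1))

abbreviation midpt :: "real^'n \<Rightarrow> real^'n \<Rightarrow> real^'n" where
  "midpt a b \<equiv> (1/2) *\<^sub>R (a + b)"

lemma affine_fun_midpt: "affine_fun f \<Longrightarrow> f (midpt a b) = (f a + f b) / 2"
  unfolding affine_fun_def by (auto simp: inner_add_right field_simps)

text \<open>The smaller weight \<open>u b\<close> is taken from both \<open>a\<close> and
  \<open>b\<close> and given to their midpoint as \<open>2 * u b\<close>; then \<open>b\<close> has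
  no weight left.\<close>

lemma convex_hull_bisect_aux:
  assumes fin: "finite A" and ab: "a \<in> A" "b \<in> A" "a \<noteq> b" and m: "midpt a b \<notin> A"
    and u: "\<forall>q\<in>A. 0 \<le> u q" "sum u A = 1" "u b \<le> (u a :: real)"
  shows "(\<Sum>q\<in>A. u q *\<^sub>R q) \<in> convex hull (insert (midpt a b) (A - {b}))"
proof -
  let ?m = "midpt a b"
  define R where "R = A - {a, b}"
  define w where "w q = (if q = ?m then 2 * u b else if q = a then u a - u b else u q)" for q
  have A: "A = insert a (insert b R)" "A - {b} = insert a R" using ab by (auto simp: R_def)
  have R: "finite R" "a \<notin> R" "b \<notin> R" "?m \<notin> R" "?m \<noteq> a" using fin ab m by (auto simp: R_def)
  have wR: "w q = u q" if "q \<in> R" for q using R that by (auto simp: w_def)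
  have wm: "w ?m = 2 * u b" "w a = u a - u b" using R by (auto simp: w_def)
  have s1: "sum w (insert ?m (insert a R)) = 1"
    using u(2) R ab wR by (simp add: wm A(1) sum.insert_if)
  have "(\<Sum>q\<in>insert ?m (insert a R). w q *\<^sub>R q) = (2 * u b) *\<^sub>R ?m + (u a - u b) *\<^sub>R a + (\<Sum>q\<in>R. u q *\<^sub>R q)"
    using R wR by (simp add: wm sum.insert_if)
  also have "\<dots> = u a *\<^sub>R a + (u b *\<^sub>R b + (\<Sum>q\<in>R. u q *\<^sub>R q))"
    by (simp add: algebra_simps)
  also have "\<dots> = (\<Sum>q\<in>A. u q *\<^sub>R q)" using R ab by (simp add: A(1) sum.insert_if)
  finally have s2: "(\<Sum>q\<in>insert ?m (insert a R). w q *\<^sub>R q) = (\<Sum>q\<in>A. u q *\<^sub>R q)" .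
  have "\<forall>q\<in>insert ?m (insert a R). 0 \<le> w q"
    using u ab wR A(1) by (auto simp: wm)
  then show ?thesis unfolding A(2)
    by (subst convex_hull_finite) (use R s1 s2 in auto)
qed

lemma midpt_in_hull: "a \<in> A \<Longrightarrow> b \<in> A \<Longrightarrow> midpt a b \<in> convex hull A"
proof -
  assume "a \<in> A" "b \<in> A"
  then have "(1/2) *\<^sub>R a + (1/2) *\<^sub>R b \<in> convex hull A"
    by (intro convexD convex_convex_hull) (auto intro: hull_inc)
  then show ?thesis by (simp add: algebra_simps)
qed

lemma convex_hull_bisect:
  assumes fin: "finite A" and ab: "a \<in> A" "b \<in> A" "a \<noteq> b" and m: "midpt a b \<notin> A"
  shows "convex hull A = convex hull (insert (midpt a b) (A - {b})) \<union> convex hull (insert (midpt a b) (A - {a}))"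
proof
  show "convex hull A \<subseteq> convex hull (insert (midpt a b) (A - {b})) \<union> convex hull (insert (midpt a b) (A - {a}))"
  proof
    fix x assume "x \<in> convex hull A"
    then obtain u where u: "\<forall>q\<in>A. 0 \<le> u q" "sum u A = 1" "(\<Sum>q\<in>A. u q *\<^sub>R q) = x"
      using fin by (auto simp: convex_hull_finite)
    consider "u b \<le> u a" | "u a \<le> u b" by linarith
    then show "x \<in> convex hull (insert (midpt a b) (A - {b})) \<union> convex hull (insert (midpt a b) (A - {a}))"
    proof cases
      case 1
      then show ?thesis using convex_hull_bisect_aux[OF fin ab m u(1,2)] u(3) by simp
    next
      case 2
      then show ?thesis using convex_hull_bisect_aux[OF fin ab(2,1) _ _ u(1,2)] ab m u(3)
        by (simp add: add.commute)
    qed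
  qed
  have "insert (midpt a b) (A - {q}) \<subseteq> convex hull A" for q
    using midpt_in_hull[OF ab(1,2)] hull_subset[of A convex] by auto
  then show "convex hull (insert (midpt a b) (A - {b})) \<union> convex hull (insert (midpt a b) (A - {a})) \<subseteq> convex hull A"
    by (simp add: hull_minimal)
qed

lemma midpt_notin:
  assumes "\<not> affine_dependent A" "a \<in> A" "b \<in> A" "a \<noteq> b"
  shows "midpt a b \<notin> A"
proof
  assume m: "midpt a b \<in> A"
  have "bary A a (midpt a b) = 1/2"
    using affine_fun_midpt[OF bary_affine[OF assms(1)]] assms by (simp add: bary_vertex)
  then show False using bary_vertex[OF assms(1) m] by (auto split: if_splits)
qed

lemma bisect_affine_hull:
  assumes "a \<in> A" "b \<in> A" "a \<noteq> b"
  shows "affine hull (insert (midpt a b) (A - {b})) = affine hull A"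
proof
  have "insert (midpt a b) (A - {b}) \<subseteq> affine hull A"
    using midpt_in_hull[OF assms(1,2)] convex_hull_subset_affine_hull[of A] hull_subset[of A affine] by auto
  then show "affine hull (insert (midpt a b) (A - {b})) \<subseteq> affine hull A"
    by (simp add: hull_minimal)
  have "2 *\<^sub>R midpt a b + (-1) *\<^sub>R a \<in> affine hull (insert (midpt a b) (A - {b}))"
    by (rule mem_affine) (use assms in \<open>auto intro: hull_inc\<close>)
  then have "b \<in> affine hull (insert (midpt a b) (A - {b}))" by (simp add: algebra_simps)
  moreover have "A - {b} \<subseteq> affine hull (insert (midpt a b) (A - {b}))"
    by (auto intro: hull_inc)
  ultimately have "A \<subseteq> affine hull (insert (midpt a b) (A - {b}))" by auto
  then show "affine hull A \<subseteq> affine hull (insert (midpt a b) (A - {b}))"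
    by (simp add: hull_minimal)
qed

lemma bisect_card:
  assumes "\<not> affine_dependent A" "finite A" "a \<in> A" "b \<in> A" "a \<noteq> b"
  shows "card (insert (midpt a b) (A - {b})) = card A"
proof -
  have "card A > 0" using assms by (auto simp: card_gt_0_iff)
  then show ?thesis using midpt_notin[OF assms(1,3-5)] assms(2,4) by simp
qed

lemma bisect_independent:
  assumes "\<not> affine_dependent A" "finite A" "a \<in> A" "b \<in> A" "a \<noteq> b"
  shows "\<not> affine_dependent (insert (midpt a b) (A - {b}))"
proof -
  have "aff_dim (insert (midpt a b) (A - {b})) = aff_dim A"
    using bisect_affine_hull[OF assms(3-5)] by (metis aff_dim_affine_hull)
  then show ?thesis
    using assms bisect_card[OF assms] by (simp add: affine_independent_iff_card)
qed

lemma nsimplex_bisect: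
  assumes "nsimplex V" "a \<in> V" "b \<in> V" "a \<noteq> b"
  shows "nsimplex (insert (midpt a b) (V - {b}))" "nsimplex (insert (midpt a b) (V - {a}))"
  using assms bisect_card[of V a b] bisect_independent[of V a b] bisect_card[of V b a] bisect_independent[of V b a]
  by (auto simp: nsimplex_def add.commute)

context
  fixes l :: "real^'n \<Rightarrow> real" and a b :: "real^'n" and A
  assumes l: "affine_fun l" and lA: "\<And>q. q \<in> A \<Longrightarrow> l q = (if q = a then 1 else if q = b then -1 else 0)"
    and ab: "a \<in> A" "b \<in> A" "a \<noteq> b"
begin

lemma shear_swap: "shear l (b - a) a = b" "shear l (b - a) b = a" "q \<in> A \<Longrightarrow> q \<noteq> a \<Longrightarrow> q \<noteq> b \<Longrightarrow> shear l (b - a) q = q"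
  "shear l (b - a) (midpt a b) = midpt a b"
  using lA ab by (auto simp: shear_def affine_fun_midpt[OF l])

lemma shear_vertices: "shear l (b - a) ` A = A"
proof -
  have "A = insert a (insert b (A - {a, b}))" using ab by auto
  moreover have "shear l (b - a) ` insert a (insert b (A - {a, b})) = insert b (insert a (A - {a, b}))"
  proof -
    have "shear l (b - a) ` (A - {a, b}) = (\<lambda>x. x) ` (A - {a,b})" by (rule image_cong) (auto simp: shear_swap)
    then show ?thesis by (simp add: shear_swap)
  qed
  ultimately show ?thesis by (metis insert_commute)
qed

lemma shear_bisect_vertices: "shear l (b - a) ` insert (midpt a b) (A - {b}) = insert (midpt a b) (A - {a})"
proof -
  have *: "shear l (b - a) ` (A - {a, b}) = (\<lambda>x. x) ` (A - {a,b})" by (rule image_cong) (auto simp: shear_swap)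
  have "A - {b} = insert a (A - {a, b})" "A - {a} = insert b (A - {a, b})" using ab by auto
  then show ?thesis using * by (simp add: shear_swap)
qed

lemma bisect_sign:
  shows "x \<in> convex hull (insert (midpt a b) (A - {b})) \<Longrightarrow> 0 \<le> l x"
    "x \<in> convex hull (insert (midpt a b) (A - {a})) \<Longrightarrow> l x \<le> 0"
proof -
  show "0 \<le> l x" if "x \<in> convex hull (insert (midpt a b) (A - {b}))"
    by (rule affine_fun_nonneg_hull[OF l _ that]) (use ab lA in \<open>auto simp: affine_fun_midpt[OF l]\<close>)
  have "0 \<le> - 1 * l x" if "x \<in> convex hull (insert (midpt a b) (A - {a}))"
    by (rule affine_fun_nonneg_hull[OF affine_fun_cmult[OF l] _ that]) (use ab lA in \<open>auto simp: affine_fun_midpt[OF l]\<close>)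
  then show "l x \<le> 0" if "x \<in> convex hull (insert (midpt a b) (A - {a}))" using that by simp
qed

end

lemma bary_swap:
  assumes V: "\<not> affine_dependent V" and ab: "a \<in> V" "b \<in> V" "a \<noteq> b"
  defines "h \<equiv> shear (\<lambda>x. bary V a x - bary V b x) (b - a)"
  shows "bary V a (h x) = bary V b x" "bary V b (h x) = bary V a x"
proof -
  let ?l = "\<lambda>x. bary V a x - bary V b x"
  have *: "bary V q (h x) = bary V q x + ?l x * (bary V q b - bary V q a)" if "q \<in> V" for q
  proof -
    obtain c d where c: "\<And>x. bary V q x = c \<bullet> x + d"
      using bary_affine[OF V, of q] by (auto simp: affine_fun_def)
    show ?thesis by (simp add: c h_def shear_def inner_add_right inner_diff_right)
  qed
  show "bary V a (h x) = bary V b x" "bary V b (h x) = bary V a x"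
    using *[OF ab(1)] *[OF ab(2)] ab by (auto simp: bary_vertex[OF V])
qed

lemma bary_diff_values:
  assumes V: "\<not> affine_dependent V" and ab: "a \<in> V" "b \<in> V" "a \<noteq> b"
  shows "affine_fun (\<lambda>x. bary V a x - bary V b x)"
    "\<And>q. q \<in> V \<Longrightarrow> bary V a q - bary V b q = (if q = a then 1 else if q = b then -1 else 0)"
  using assms by (auto simp: bary_vertex[OF V] intro!: affine_fun_diff bary_affine[OF V])

section \<open>Halving of simplices, integrals of affine functions and of their squares\<close>

context
  fixes V :: "(real^'n) set"
  assumes V: "nsimplex V"
begin

text \<open>\<open>bary V a - bary V b\<close> is 1 at \<open>a\<close>, -1 at \<open>b\<close> and
  0 at the other vertices, so its skew reflection fixes the midpoint and carries one half onto the
  other.\<close>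

lemma nsimplex_halves:
  assumes ab: "a \<in> V" "b \<in> V" "a \<noteq> b"
  defines "V1 \<equiv> insert (midpt a b) (V - {b})" and "V2 \<equiv> insert (midpt a b) (V - {a})"
  shows "convex hull V = convex hull V1 \<union> convex hull V2"
    "negligible (convex hull V1 \<inter> convex hull V2)"
    "measure lebesgue (convex hull V1) = measure lebesgue (convex hull V) / 2"
    "measure lebesgue (convex hull V2) = measure lebesgue (convex hull V) / 2"
proof -
  let ?l = "\<lambda>x. bary V a x - bary V b x"
  note l = bary_diff_values[OF nsimplexD(3)[OF V] ab]
  note m = midpt_notin[OF nsimplexD(3)[OF V] ab]
  show un: "convex hull V = convex hull V1 \<union> convex hull V2"
    unfolding V1_def V2_def by (rule convex_hull_bisect[OF nsimplexD(1)[OF V] ab m])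
  have im: "shear ?l (b - a) ` (convex hull V1) = convex hull V2"
    unfolding shear_convex_hull[OF l(1)] V1_def V2_def
    using shear_bisect_vertices[of ?l V a b, OF l ab] by simp
  have c: "compact (convex hull V1)"
    unfolding V1_def by (rule nsimplex_compact[OF nsimplex_bisect(1)[OF V ab]])
  have la: "?l a = 1" "?l b = -1" using l(2)[of a] l(2)[of b] ab by auto
  have s: "\<And>x. x \<in> convex hull V1 \<Longrightarrow> 0 \<le> ?l x" "\<And>x. x \<in> convex hull V2 \<Longrightarrow> ?l x \<le> 0"
    unfolding V1_def V2_def using bisect_sign[of ?l V a b, OF l ab] by auto
  show "negligible (convex hull V1 \<inter> convex hull V2)"
    "measure lebesgue (convex hull V1) = measure lebesgue (convex hull V) / 2"
    "measure lebesgue (convex hull V2) = measure lebesgue (convex hull V) / 2"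
    unfolding un using shear_halves[OF l(1) la c im s] by auto
qed

private lemma swap_integral:
  fixes f :: "real^'n \<Rightarrow> real"
  assumes ab: "a \<in> V" "b \<in> V" "a \<noteq> b" and f: "continuous_on UNIV f"
  shows "integral (convex hull V) f =
    integral (convex hull V) (\<lambda>x. f (shear (\<lambda>x. bary V a x - bary V b x) (b - a) x))"
proof -
  let ?l = "\<lambda>x. bary V a x - bary V b x"
  note l = bary_diff_values[OF nsimplexD(3)[OF V] ab]
  have la: "?l a = 1" "?l b = -1" using l(2)[of a] l(2)[of b] ab by auto
  have "shear ?l (b - a) ` (convex hull V) = convex hull V"
    unfolding shear_convex_hull[OF l(1)] using shear_vertices[of ?l V a b, OF l ab] by simp
  then show ?thesis using shear_integral[OF l(1) la nsimplex_compact[OF V] f] by simp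
qed

private lemma bary_cont: "continuous_on S (bary V q)"
  by (rule affine_fun_continuous[OF nsimplex_bary_affine[OF V]])

private lemma int_on: "continuous_on UNIV f \<Longrightarrow> (f::_\<Rightarrow>real) integrable_on convex hull V"
  by (rule compact_continuous_integrable[OF nsimplex_compact[OF V]])

text \<open>Vertex swaps preserve the simplex, so all n+1 coordinates have the same integral, and
  they sum to 1.\<close>

lemma integral_bary:
  assumes "q \<in> V"
  shows "integral (convex hull V) (bary V q) = measure lebesgue (convex hull V) / (real CARD('n) + 1)"
proof -
  have eq: "integral (convex hull V) (bary V r) = integral (convex hull V) (bary V q)" if "r \<in> V" for r
  proof (cases "r = q")
    case False
    have "integral (convex hull V) (bary V r) = integral (convex hull V) (\<lambda>x. bary V r (shear (\<lambda>x. bary V r x - bary V q x) (q - r) x))"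
      by (rule swap_integral[OF that assms False bary_cont])
    also have "\<dots> = integral (convex hull V) (bary V q)" using bary_swap[OF nsimplexD(3)[OF V] that assms False] by simp
    finally show ?thesis .
  qed simp
  have "measure lebesgue (convex hull V) = integral (convex hull V) (\<lambda>x. 1)"
    by (rule lmeasure_integral[OF nsimplex_lmeasurable[OF V]])
  also have "\<dots> = integral (convex hull V) (\<lambda>x. \<Sum>r\<in>V. bary V r x)"
    by (simp only: nsimplex_bary_sum[OF V])
  also have "\<dots> = (\<Sum>r\<in>V. integral (convex hull V) (bary V r))"
    by (rule integral_sum) (use nsimplexD[OF V] int_on bary_cont in auto)
  also have "\<dots> = (\<Sum>r\<in>V. integral (convex hull V) (bary V q))" by (rule sum.cong) (auto simp: eq)
  also have "\<dots> = (real CARD('n) + 1) * integral (convex hull V) (bary V q)"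
    using nsimplexD[OF V] by (simp add: add.commute)
  finally show ?thesis by (simp add: field_simps)
qed

lemma has_integral_affine_fun:
  assumes f: "affine_fun f"
  shows "(f has_integral measure lebesgue (convex hull V) / (real CARD('n) + 1) * (\<Sum>q\<in>V. f q)) (convex hull V)"
proof -
  have "((\<lambda>x. \<Sum>q\<in>V. bary V q x * f q) has_integral
     (\<Sum>q\<in>V. measure lebesgue (convex hull V) / (real CARD('n) + 1) * f q)) (convex hull V)"
  proof (intro has_integral_sum nsimplexD[OF V] has_integral_mult_left)
    fix q assume "q \<in> V"
    then show "(bary V q has_integral measure lebesgue (convex hull V) / (real CARD('n) + 1)) (convex hull V)"
      using integral_bary int_on[OF bary_cont, of q] by (metis integrable_integral)
  qed
  moreover have "(\<lambda>x. \<Sum>q\<in>V. bary V q x * f q) = f"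
    by (intro ext) (rule nsimplex_bary_expand[OF V f, symmetric])
  ultimately show ?thesis by (simp add: sum_distrib_left)
qed

private definition B where "B q r = integral (convex hull V) (\<lambda>x. bary V q x * bary V r x)"

text \<open>Bisecting the edge \<open>qr\<close> maps the simplex affinely onto its two halves; comparing the integrals
  of \<open>bary q\<^sup>2\<close> yields that the diagonal moments are twice the off-diagonal ones.\<close>

private lemma B_relation:
  assumes ab: "a \<in> V" "b \<in> V" "a \<noteq> b"
  shows "B a a = 2 * B a b"
proof -
  define m where "m = midpt a b"
  define V1 where "V1 = insert m (V - {b})"
  define V2 where "V2 = insert m (V - {a})"
  let ?l = "\<lambda>x. bary V a x - bary V b x"
  let ?g = "\<lambda>x. bary V a x * bary V a x"
  note l = bary_diff_values[OF nsimplexD(3)[OF V] ab]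
  have la: "?l a = 1" "?l b = -1" using l(2)[of a] l(2)[of b] ab by auto
  note H = nsimplex_halves[OF ab, folded m_def, folded V1_def V2_def]
  have V12: "nsimplex V1" "nsimplex V2"
    using nsimplex_bisect[OF V ab] by (simp_all add: V1_def V2_def m_def)
  have cg: "continuous_on UNIV ?g" "continuous_on UNIV (\<lambda>x. bary V b x * bary V b x)"
    by (intro continuous_intros bary_cont)+
  have swap: "B b b = B a a"
    unfolding B_def using swap_integral[OF ab cg(1)] bary_swap[OF nsimplexD(3)[OF V] ab] by simp
  have im: "shear ?l (b - a) ` (convex hull V1) = convex hull V2"
    unfolding shear_convex_hull[OF l(1)] V1_def V2_def m_def
    using shear_bisect_vertices[of ?l V a b, OF l ab] by simp
  have "B a a = integral (convex hull V1) ?g + integral (convex hull V2) ?g"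
    unfolding B_def H(1) by (rule integral_Un[OF _ _ H(2)])
      (intro compact_continuous_integrable nsimplex_compact V12 cg)+
  \<comment> \<open>The reflection carries the first half to the second and turns
    \<open>bary V a\<close> into \<open>bary V b\<close>.\<close>
  also have "integral (convex hull V2) ?g = integral (convex hull V1) (\<lambda>x. bary V b x * bary V b x)"
    unfolding im[symmetric] using shear_integral[OF l(1) la nsimplex_compact[OF V12(1)] cg(1)] bary_swap[OF nsimplexD(3)[OF V] ab] by simp
  finally have 1: "B a a = integral (convex hull V1) ?g + integral (convex hull V1) (\<lambda>x. bary V b x * bary V b x)" .
  \<comment> \<open>This map moves only the vertex \<open>b\<close>, to the midpoint, and so maps
    the whole simplex onto the first half. Its scaling constant 1/2 follows from the
    volumes.\<close>
  let ?h = "shear (bary V b) (m - b)"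
  note bl = nsimplex_bary_affine[OF V, of b]
  have hq: "bary V q (?h x) = bary V q x + bary V b x * (bary V q a - bary V q b) / 2" for q x
  proof -
    obtain c d where c: "\<And>x. bary V q x = c \<bullet> x + d"
      using nsimplex_bary_affine[OF V, of q] by (auto simp: affine_fun_def)
    show ?thesis by (simp add: c m_def shear_def inner_add_right inner_diff_right field_simps)
  qed
  have ha: "bary V a (?h x) = bary V a x + bary V b x / 2" and hb: "bary V b (?h x) = bary V b x / 2" for x
    using hq[of a x] hq[of b x] ab by (auto simp: nsimplex_bary_vertex[OF V])
  have "inj ?h"
  proof (rule injI)
    fix x y assume e: "?h x = ?h y"
    then have "bary V b x = bary V b y" using hb[of x] hb[of y] by simp
    then show "x = y" using e by (simp add: shear_def)
  qed
  then obtain c where c: "\<And>S f::real^'n \<Rightarrow> real. compact S \<Longrightarrow> continuous_on UNIV f \<Longrightarrow>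
     integral (?h ` S) f = c * integral S (\<lambda>x. f (?h x))"
    using shear_integral_scale[OF bl] by blast
  have im1: "?h ` (convex hull V) = convex hull V1"
  proof -
    have "?h b = m" "\<And>q. q \<in> V - {b} \<Longrightarrow> ?h q = q"
      using ab by (auto simp: shear_def nsimplex_bary_vertex[OF V])
    moreover have "V = insert b (V - {b})" using ab by auto
    ultimately have "?h ` V = V1" unfolding V1_def by (metis (no_types, lifting) image_cong image_ident image_insert)
    then show ?thesis by (simp add: shear_convex_hull[OF bl])
  qed
  have "measure lebesgue (convex hull V1) = c * measure lebesgue (convex hull V)"
    unfolding lmeasure_integral[OF nsimplex_lmeasurable[OF V12(1)]] lmeasure_integral[OF nsimplex_lmeasurable[OF V]]
    using c[OF nsimplex_compact[OF V], of "\<lambda>_. 1"] unfolding im1 by auto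
  then have c2: "c = 1/2" using H(3) nsimplex_measure_pos[OF V] by simp
  have "integral (convex hull V1) ?g = 1/2 * integral (convex hull V) (\<lambda>x. (bary V a x + bary V b x / 2) * (bary V a x + bary V b x / 2))"
    unfolding im1[symmetric] c[OF nsimplex_compact[OF V] cg(1)] c2 ha by simp
  also have "integral (convex hull V) (\<lambda>x. (bary V a x + bary V b x / 2) * (bary V a x + bary V b x / 2))
     = integral (convex hull V) (\<lambda>x. bary V a x * bary V a x + bary V a x * bary V b x + (1/4) * (bary V b x * bary V b x))"
    by (rule arg_cong[of _ _ "integral _"]) (auto simp: algebra_simps)
  also have "\<dots> = B a a + B a b + 1/4 * B b b"
    unfolding B_def by (subst integral_add; (intro int_on continuous_intros bary_cont)?)+ simp
  finally have 2: "integral (convex hull V1) ?g = 1/2 * (B a a + B a b + 1/4 * B b b)" .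
  have "integral (convex hull V1) (\<lambda>x. bary V b x * bary V b x) = 1/2 * integral (convex hull V) (\<lambda>x. (1/4) * (bary V b x * bary V b x))"
    unfolding im1[symmetric] c[OF nsimplex_compact[OF V] cg(2)] c2 hb by simp
  then have 3: "integral (convex hull V1) (\<lambda>x. bary V b x * bary V b x) = 1/8 * B b b"
    by (simp add: B_def)
  \<comment> \<open>Here x is the diagonal moment, equal for \<open>a\<close> and \<open>b\<close>
    by the swap, and y the mixed one; the equation collects both halves.\<close>
  have "x = 2 * y" if "x = 1/2 * (x + y + 1/4 * x) + 1/8 * x" for x y :: real using that by (simp add: field_simps)
  then show ?thesis using 1 unfolding 2 3 swap .
qed

text \<open>The coordinates sum to 1, so a row of the matrix of moments sums to the integral of one
  coordinate. As the n off-diagonal entries are half the diagonal one, the row sum determines them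
  all.\<close>

lemma integral_bary_bary:
  assumes qr: "q \<in> V" "r \<in> V"
  shows "integral (convex hull V) (\<lambda>x. bary V q x * bary V r x) =
    measure lebesgue (convex hull V) / ((real CARD('n) + 1) * (real CARD('n) + 2)) * (if q = r then 2 else 1)"
proof -
  have "measure lebesgue (convex hull V) / (real CARD('n) + 1) = integral (convex hull V) (bary V q)"
    using integral_bary[OF qr(1)] by simp
  also have "\<dots> = integral (convex hull V) (\<lambda>x. \<Sum>s\<in>V. bary V q x * bary V s x)"
    by (simp add: sum_distrib_left[symmetric] nsimplex_bary_sum[OF V])
  also have "\<dots> = (\<Sum>s\<in>V. B q s)"
    unfolding B_def by (rule integral_sum) (use nsimplexD[OF V] in \<open>auto intro!: int_on continuous_intros bary_cont\<close>)
  also have "\<dots> = B q q + (\<Sum>s\<in>V-{q}. B q s)"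
    using nsimplexD[OF V] qr by (simp add: sum.remove)
  also have "(\<Sum>s\<in>V-{q}. B q s) = (\<Sum>s\<in>V-{q}. B q q / 2)"
    by (intro sum.cong) (use B_relation[OF qr(1)] in auto)
  also have "\<dots> = real CARD('n) * (B q q / 2)" using nsimplexD[OF V] qr by simp
  finally have "B q q * (1 + real CARD('n) / 2) = measure lebesgue (convex hull V) / (real CARD('n) + 1)"
    by (simp add: algebra_simps)
  moreover have "1 + real CARD('n) / 2 = (real CARD('n) + 2) / 2" by simp
  ultimately have *: "B q q * ((real CARD('n) + 2) / 2) = measure lebesgue (convex hull V) / (real CARD('n) + 1)"
    by (simp only:)
  have "B q q = 2 * (measure lebesgue (convex hull V) / (real CARD('n) + 1)) / (real CARD('n) + 2)"
    unfolding *[symmetric] by simp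
  then have "B q q = 2 * (measure lebesgue (convex hull V) / ((real CARD('n) + 1) * (real CARD('n) + 2)))"
    by simp
  moreover have "B q r = B q q / 2" if "q \<noteq> r" using B_relation[OF qr that] by simp
  ultimately show ?thesis by (auto simp: B_def)
qed

text \<open>The matrix of moments is a multiple of the identity plus the all-ones matrix; the two
  summands are the quadratic forms of these two.\<close>

lemma has_integral_affine_fun_square:
  assumes f: "affine_fun f"
  shows "((\<lambda>x. (f x)\<^sup>2) has_integral measure lebesgue (convex hull V) / ((real CARD('n) + 1) * (real CARD('n) + 2))
    * ((\<Sum>q\<in>V. (f q)\<^sup>2) + (\<Sum>q\<in>V. f q)\<^sup>2)) (convex hull V)"
proof -
  define k where "k = measure lebesgue (convex hull V) / ((real CARD('n) + 1) * (real CARD('n) + 2))"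
  note fin = nsimplexD(1)[OF V]
  have "((\<lambda>x. \<Sum>q\<in>V. \<Sum>r\<in>V. (bary V q x * bary V r x) * (f q * f r)) has_integral
     (\<Sum>q\<in>V. \<Sum>r\<in>V. (k * (if q = r then 2 else 1)) * (f q * f r))) (convex hull V)"
  proof (intro has_integral_sum fin has_integral_mult_left)
    fix q r assume qr: "q \<in> V" "r \<in> V"
    have "(\<lambda>x. bary V q x * bary V r x) integrable_on convex hull V"
      by (intro int_on continuous_intros bary_cont)
    then show "((\<lambda>x. bary V q x * bary V r x) has_integral k * (if q = r then 2 else 1)) (convex hull V)"
      using integral_bary_bary[OF qr] unfolding k_def by (metis integrable_integral)
  qed
  moreover have "(\<lambda>x. \<Sum>q\<in>V. \<Sum>r\<in>V. (bary V q x * bary V r x) * (f q * f r)) = (\<lambda>x. (f x)\<^sup>2)"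
  proof
    fix x
    have "(f x)\<^sup>2 = (\<Sum>q\<in>V. bary V q x * f q) * (\<Sum>q\<in>V. bary V q x * f q)"
      using nsimplex_bary_expand[OF V f, of x] by (simp add: power2_eq_square)
    then show "(\<Sum>q\<in>V. \<Sum>r\<in>V. (bary V q x * bary V r x) * (f q * f r)) = (f x)\<^sup>2"
      by (simp add: sum_product mult_ac)
  qed
  moreover have "(\<Sum>q\<in>V. \<Sum>r\<in>V. (k * (if q = r then 2 else 1)) * (f q * f r)) = k * ((\<Sum>q\<in>V. (f q)\<^sup>2) + (\<Sum>q\<in>V. f q)\<^sup>2)"
  proof -
    have "(\<Sum>r\<in>V. (k * (if q = r then 2 else 1)) * (f q * f r)) = k * ((f q)\<^sup>2 + f q * (\<Sum>r\<in>V. f r))" if "q \<in> V" for q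
    proof -
      have "(\<Sum>r\<in>V. (k * (if q = r then 2 else 1)) * (f q * f r)) = (\<Sum>r\<in>V. (if q = r then k * (f q)\<^sup>2 else 0) + k * f q * f r)"
        by (intro sum.cong) (auto simp: power2_eq_square)
      also have "\<dots> = k * (f q)\<^sup>2 + k * f q * (\<Sum>r\<in>V. f r)"
        using fin that by (simp add: sum.distrib sum_distrib_left)
      finally show ?thesis by (simp add: algebra_simps)
    qed
    then have "(\<Sum>q\<in>V. \<Sum>r\<in>V. (k * (if q = r then 2 else 1)) * (f q * f r)) = (\<Sum>q\<in>V. k * ((f q)\<^sup>2 + f q * (\<Sum>r\<in>V. f r)))"
      by simp
    also have "\<dots> = k * ((\<Sum>q\<in>V. (f q)\<^sup>2) + (\<Sum>q\<in>V. f q)\<^sup>2)"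
      by (simp add: sum_distrib_left[symmetric] sum_distrib_right[symmetric] sum.distrib power2_eq_square)
    finally show ?thesis .
  qed
  ultimately show ?thesis unfolding k_def by simp
qed

lemma has_integral_norm_square:
  "((\<lambda>x. (norm (x - p))\<^sup>2) has_integral measure lebesgue (convex hull V) / ((real CARD('n) + 1) * (real CARD('n) + 2))
    * ((\<Sum>q\<in>V. (norm (q - p))\<^sup>2) + (norm (\<Sum>q\<in>V. q - p))\<^sup>2)) (convex hull V)"
proof -
  define k where "k = measure lebesgue (convex hull V) / ((real CARD('n) + 1) * (real CARD('n) + 2))"
  have n: "(norm y)\<^sup>2 = (\<Sum>i\<in>UNIV. (y $ i)\<^sup>2)" for y :: "real^'n"
    by (simp add: norm_eq_sqrt_inner inner_vec_def power2_eq_square sum_nonneg)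
  have "((\<lambda>x. \<Sum>i\<in>UNIV. ((x - p) $ i)\<^sup>2) has_integral
    (\<Sum>i\<in>UNIV. k * ((\<Sum>q\<in>V. ((q - p) $ i)\<^sup>2) + (\<Sum>q\<in>V. (q - p) $ i)\<^sup>2))) (convex hull V)"
  proof (intro has_integral_sum finite)
    fix i :: 'n
    have "affine_fun (\<lambda>x::real^'n. (x - p) $ i)"
      unfolding affine_fun_def
      by (rule exI[of _ "axis i 1"], rule exI[of _ "- p $ i"]) (simp add: inner_axis')
    from has_integral_affine_fun_square[OF this]
    show "((\<lambda>x. ((x - p) $ i)\<^sup>2) has_integral k * ((\<Sum>q\<in>V. ((q - p) $ i)\<^sup>2) + (\<Sum>q\<in>V. (q - p) $ i)\<^sup>2)) (convex hull V)"
      unfolding k_def .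
  qed
  moreover have "(\<Sum>i\<in>UNIV. k * ((\<Sum>q\<in>V. ((q - p) $ i)\<^sup>2) + (\<Sum>q\<in>V. (q - p) $ i)\<^sup>2))
     = k * ((\<Sum>q\<in>V. (norm (q - p))\<^sup>2) + (norm (\<Sum>q\<in>V. q - p))\<^sup>2)"
  proof -
    have "(\<Sum>i\<in>UNIV. \<Sum>q\<in>V. ((q - p) $ i)\<^sup>2) = (\<Sum>q\<in>V. (norm (q - p))\<^sup>2)"
      unfolding n by (rule sum.swap)
    moreover have "(\<Sum>i\<in>UNIV. (\<Sum>q\<in>V. (q - p) $ i)\<^sup>2) = (norm (\<Sum>q\<in>V. q - p))\<^sup>2"
      unfolding n by simp
    ultimately show ?thesis by (simp add: sum_distrib_left[symmetric] sum.distrib)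
  qed
  ultimately show ?thesis unfolding k_def n by simp
qed

end

section \<open>Means over sides\<close>

text \<open>\<open>cyl\<close> takes the normal chosen by \<open>snormal\<close> from the side
  itself, so a side and its halves could receive opposite normals. With the normal as a parameter
  they share one, and their cylinders are nested.\<close>

definition cylinder :: "real^'n \<Rightarrow> (real^'n) set \<Rightarrow> (real^'n) set" where
  "cylinder \<nu> E = (\<lambda>(y, t). y + t *\<^sub>R \<nu>) ` ((convex hull E) \<times> {0..1})"

definition plane_proj :: "real^'n \<Rightarrow> real^'n \<Rightarrow> real^'n \<Rightarrow> real^'n" where
  "plane_proj \<nu> p x = x - ((x - p) \<bullet> \<nu>) *\<^sub>R \<nu>"

definition unit_normal :: "real^'n \<Rightarrow> real^'n \<Rightarrow> (real^'n) set \<Rightarrow> bool" where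
  "unit_normal \<nu> p E \<longleftrightarrow> norm \<nu> = 1 \<and> (\<forall>q\<in>E. (q - p) \<bullet> \<nu> = 0)"

definition face :: "(real^'n) set \<Rightarrow> bool" where
  "face E \<longleftrightarrow> finite E \<and> card E = CARD('n) \<and> \<not> affine_dependent E"

lemma faceD:
  fixes E :: "(real^'n) set"
  assumes "face E" shows "finite E" "card E = CARD('n)" "\<not> affine_dependent E" "E \<noteq> {}"
  using assms by (auto simp: face_def)

lemma nsimplex_face: "nsimplex V \<Longrightarrow> q \<in> V \<Longrightarrow> face (V - {q})"
  unfolding nsimplex_def face_def using affine_independent_Diff by auto

lemma affine_fun_plane_proj: "affine_fun f \<Longrightarrow> affine_fun (\<lambda>x. f (plane_proj \<nu> p x))"
proof -
  assume f: "affine_fun f"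
  have "affine_fun (\<lambda>x. f (x + ((x \<bullet> \<nu>) - p \<bullet> \<nu>) *\<^sub>R (- \<nu>)))"
    by (rule affine_fun_compose_scaleR[OF f]) (rule affine_fun_diff[OF affine_fun_inner(2) affine_fun_const])
  then show ?thesis by (simp add: plane_proj_def inner_diff_left)
qed

lemma unit_normal_plane: "unit_normal \<nu> p E \<Longrightarrow> y \<in> convex hull E \<Longrightarrow> (y - p) \<bullet> \<nu> = 0"
  by (rule affine_fun_zero_hull[of "\<lambda>x. (x - p) \<bullet> \<nu>" E])
    (auto simp: unit_normal_def inner_diff_left intro!: affine_fun_diff)

lemma unit_normal_subset: "unit_normal \<nu> p E \<Longrightarrow> A \<subseteq> convex hull E \<Longrightarrow> unit_normal \<nu> p A"
  using unit_normal_plane[of \<nu> p E] by (auto simp: unit_normal_def)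

lemma plane_proj_cylinder: "unit_normal \<nu> p E \<Longrightarrow> y \<in> convex hull E \<Longrightarrow> plane_proj \<nu> p (y + t *\<^sub>R \<nu>) = y"
  using unit_normal_plane[of \<nu> p E y] by (simp add: plane_proj_def unit_normal_def algebra_simps inner_diff_left inner_add_left norm_eq_1)

lemma plane_proj_in_hull: "unit_normal \<nu> p E \<Longrightarrow> x \<in> cylinder \<nu> E \<Longrightarrow> plane_proj \<nu> p x \<in> convex hull E"
  using plane_proj_cylinder[of \<nu> p E] by (auto simp: cylinder_def)

lemma cylinder_compact: "finite E \<Longrightarrow> compact (cylinder \<nu> E)"
  unfolding cylinder_def case_prod_unfold
  by (intro compact_continuous_image compact_Times finite_imp_compact_convex_hull continuous_intros) auto

text \<open>The cylinder contains the full-dimensional simplex spanned by \<open>E\<close> and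
  \<open>q + \<nu>\<close>, whose last vertex is off the hyperplane of \<open>E\<close>.\<close>

lemma cylinder_measure_pos:
  assumes E: "face E" and n: "unit_normal \<nu> p E"
  shows "0 < measure lebesgue (cylinder \<nu> E)"
proof -
  note F = faceD[OF E]
  obtain q where q: "q \<in> E" using F(4) by auto
  have Eq: "\<nu> \<bullet> x = \<nu> \<bullet> p" if "x \<in> E" for x
  proof -
    have "(x - p) \<bullet> \<nu> = 0" using n that by (simp add: unit_normal_def)
    then have "x \<bullet> \<nu> = p \<bullet> \<nu>" by (simp add: inner_diff_left)
    then show ?thesis by (simp only: inner_commute[of \<nu>])
  qed
  have sub: "affine hull E \<subseteq> {x. \<nu> \<bullet> x = \<nu> \<bullet> p}"
    by (rule hull_minimal) (use Eq in auto, rule affine_hyperplane)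
  have "\<nu> \<bullet> (q + \<nu>) = \<nu> \<bullet> p + 1"
    using n Eq[OF q] by (simp add: unit_normal_def inner_add_right norm_eq_1)
  then have nin: "q + \<nu> \<notin> affine hull E" using sub by auto
  then have "nsimplex (insert (q + \<nu>) E)"
    unfolding nsimplex_def using F affine_independent_insert[of E "q + \<nu>"] hull_subset[of E affine]
    by (auto simp: card_insert_if)
  then have pos: "0 < measure lebesgue (convex hull (insert (q + \<nu>) E))" and
     lm: "convex hull (insert (q + \<nu>) E) \<in> lmeasurable"
    using nsimplex_measure_pos nsimplex_lmeasurable by blast+
  have "convex (cylinder \<nu> E)"
    unfolding cylinder_def
  proof (rule convex_linear_image)
    show "linear (\<lambda>(y, t). y + t *\<^sub>R \<nu>)" by (rule linearI) (auto simp: algebra_simps)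
    show "convex ((convex hull E) \<times> {0..1::real})" by (intro convex_Times) auto
  qed
  moreover have "E \<subseteq> cylinder \<nu> E"
  proof
    fix x assume "x \<in> E"
    then show "x \<in> cylinder \<nu> E" unfolding cylinder_def by (intro image_eqI[of _ _ "(x, 0)"]) (auto intro: hull_inc)
  qed
  moreover have "q + \<nu> \<in> cylinder \<nu> E"
    unfolding cylinder_def using q by (intro image_eqI[of _ _ "(q, 1)"]) (auto intro: hull_inc)
  ultimately have "convex hull (insert (q + \<nu>) E) \<subseteq> cylinder \<nu> E" by (intro hull_minimal) auto
  then have "measure lebesgue (convex hull (insert (q + \<nu>) E)) \<le> measure lebesgue (cylinder \<nu> E)"
    by (intro measure_mono_fmeasurable fmeasurableD[OF lm] lmeasurable_compact cylinder_compact F)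
  then show ?thesis using pos by simp
qed

text \<open>Composing \<open>l\<close> with \<open>plane_proj\<close> makes it constant along the
  normal. The reflection of a side thereby becomes a reflection of the whole space, and the volume
  lemmas apply to surface integrals.\<close>

lemma shear_plane_proj_cylinder:
  assumes n: "unit_normal \<nu> p E" and y: "y \<in> convex hull E"
  shows "shear (\<lambda>x. l (plane_proj \<nu> p x)) w (y + t *\<^sub>R \<nu>) = shear l w y + t *\<^sub>R \<nu>"
  using plane_proj_cylinder[OF n y] by (simp add: shear_def)

lemma shear_image_cylinder:
  assumes n: "unit_normal \<nu> p E" and A: "A \<subseteq> convex hull E" and l: "affine_fun l"
  shows "shear (\<lambda>x. l (plane_proj \<nu> p x)) w ` cylinder \<nu> A = cylinder \<nu> (shear l w ` A)"
proof -
  have sub: "convex hull A \<subseteq> convex hull E" using A by (simp add: hull_minimal)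
  have "shear (\<lambda>x. l (plane_proj \<nu> p x)) w ` cylinder \<nu> A = (\<lambda>(y, t). shear l w y + t *\<^sub>R \<nu>) ` ((convex hull A) \<times> {0..1})"
    unfolding cylinder_def image_image
    by (rule image_cong) (use sub shear_plane_proj_cylinder[OF n] in auto)
  also have "\<dots> = (\<lambda>(y, t). y + t *\<^sub>R \<nu>) ` ((shear l w ` (convex hull A)) \<times> {0..1})"
    by (force simp: image_iff)
  finally show ?thesis unfolding cylinder_def shear_convex_hull[OF l] .
qed

lemma cylinder_halves:
  assumes E: "face E" and n: "unit_normal \<nu> p E" and ab: "a \<in> E" "b \<in> E" "a \<noteq> b"
  defines "E1 \<equiv> insert (midpt a b) (E - {b})" and "E2 \<equiv> insert (midpt a b) (E - {a})"
  shows "cylinder \<nu> E = cylinder \<nu> E1 \<union> cylinder \<nu> E2"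
    "negligible (cylinder \<nu> E1 \<inter> cylinder \<nu> E2)"
    "measure lebesgue (cylinder \<nu> E1) = measure lebesgue (cylinder \<nu> E) / 2"
    "measure lebesgue (cylinder \<nu> E2) = measure lebesgue (cylinder \<nu> E) / 2"
proof -
  note F = faceD[OF E]
  let ?l = "\<lambda>x. bary E a x - bary E b x"
  let ?L = "\<lambda>x. ?l (plane_proj \<nu> p x)"
  note l = bary_diff_values[OF F(3) ab]
  have sub: "E1 \<subseteq> convex hull E" "E2 \<subseteq> convex hull E"
    unfolding E1_def E2_def using midpt_in_hull[OF ab(1,2)] by (auto intro: hull_inc)
  have h: "convex hull E = convex hull E1 \<union> convex hull E2"
    unfolding E1_def E2_def by (rule convex_hull_bisect[OF F(1) ab midpt_notin[OF F(3) ab]])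
  show un: "cylinder \<nu> E = cylinder \<nu> E1 \<union> cylinder \<nu> E2"
    unfolding cylinder_def h by (simp add: Sigma_Un_distrib1 image_Un)
  have L: "affine_fun ?L" by (rule affine_fun_plane_proj[OF l(1)])
  have pq: "plane_proj \<nu> p q = q" if "q \<in> E" for q using plane_proj_cylinder[OF n hull_inc[OF that], of 0] by simp
  have La: "?L a = 1" "?L b = -1" using l(2)[of a] l(2)[of b] ab pq by auto
  have im: "shear ?L (b - a) ` cylinder \<nu> E1 = cylinder \<nu> E2"
    unfolding shear_image_cylinder[OF n sub(1) l(1)]
    unfolding E1_def E2_def using shear_bisect_vertices[of ?l E a b, OF l ab] by simp
  have s: "0 \<le> ?L x" if "x \<in> cylinder \<nu> E1" for x
    using bisect_sign(1)[of ?l E a b, OF l ab] plane_proj_in_hull[OF unit_normal_subset[OF n sub(1)] that]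
    unfolding E1_def by auto
  have t: "?L x \<le> 0" if "x \<in> cylinder \<nu> E2" for x
    using bisect_sign(2)[of ?l E a b, OF l ab] plane_proj_in_hull[OF unit_normal_subset[OF n sub(2)] that]
    unfolding E2_def by auto
  have c: "compact (cylinder \<nu> E1)" unfolding E1_def by (intro cylinder_compact) (use F in auto)
  show "negligible (cylinder \<nu> E1 \<inter> cylinder \<nu> E2)"
    "measure lebesgue (cylinder \<nu> E1) = measure lebesgue (cylinder \<nu> E) / 2"
    "measure lebesgue (cylinder \<nu> E2) = measure lebesgue (cylinder \<nu> E) / 2"
    unfolding un using shear_halves[OF L La c im s t] by auto
qed

lemma affine_fun_mid:
  assumes "affine_fun f" "finite E" "E \<noteq> {}"
  shows "f (mid E) = (\<Sum>q\<in>E. f q) / real (card E)"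
proof -
  have "f (\<Sum>q\<in>E. (1 / real (card E)) *\<^sub>R q) = (\<Sum>q\<in>E. (1 / real (card E)) * f q)"
    by (rule affine_fun_sum[OF assms(1)]) (use assms in auto)
  then show ?thesis by (simp add: mid_def scaleR_sum_right sum_divide_distrib)
qed

text \<open>Again vertex swaps, now lifted to the cylinder, equalise the integrals of the
  coordinates. The mean over a side is thus the value at its barycenter, which is why agreement at
  midpoints means that jumps have mean zero.\<close>

lemma has_integral_cylinder_affine:
  fixes E :: "(real^'n) set"
  assumes E: "face E" and n: "unit_normal \<nu> p E" and f: "affine_fun f"
  shows "((\<lambda>x. f (plane_proj \<nu> p x)) has_integral measure lebesgue (cylinder \<nu> E) * f (mid E)) (cylinder \<nu> E)"
proof -
  note F = faceD[OF E]
  let ?C = "cylinder \<nu> E"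
  note C = cylinder_compact[OF F(1), of \<nu>]
  define \<beta> where "\<beta> q x = bary E q (plane_proj \<nu> p x)" for q x
  have \<beta>: "affine_fun (\<beta> q)" for q unfolding \<beta>_def by (intro affine_fun_plane_proj bary_affine F)
  have prE: "plane_proj \<nu> p x \<in> affine hull E" if "x \<in> ?C" for x
    using plane_proj_in_hull[OF n that] convex_hull_subset_affine_hull by blast
  have int: "\<beta> q integrable_on ?C" for q
    by (intro compact_continuous_integrable C affine_fun_continuous \<beta>)
  have eq: "integral ?C (\<beta> r) = integral ?C (\<beta> q)" if rq: "r \<in> E" "q \<in> E" for r q
  proof (cases "r = q")
    case False
    let ?l = "\<lambda>x. bary E r x - bary E q x"
    let ?L = "\<lambda>x. ?l (plane_proj \<nu> p x)"
    note l = bary_diff_values[OF F(3) rq False]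
    have L: "affine_fun ?L" by (rule affine_fun_plane_proj[OF l(1)])
    have pq: "plane_proj \<nu> p q = q" if "q \<in> E" for q using plane_proj_cylinder[OF n hull_inc[OF that], of 0] by simp
    have La: "?L r = 1" "?L q = -1" using l(2)[of r] l(2)[of q] rq pq False by auto
    have im: "shear ?L (q - r) ` ?C = ?C"
      unfolding shear_image_cylinder[OF n hull_subset l(1)]
      using shear_vertices[of ?l E r q, OF l rq False] by simp
    have "integral ?C (\<beta> r) = integral ?C (\<lambda>x. \<beta> r (shear ?L (q - r) x))"
      using shear_integral[OF L La C affine_fun_continuous[OF \<beta>]] im by simp
    also have "\<dots> = integral ?C (\<beta> q)"
    proof (rule integral_cong)
      fix x assume "x \<in> ?C"
      then obtain y t where x: "x = y + t *\<^sub>R \<nu>" "y \<in> convex hull E" by (auto simp: cylinder_def)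
      have "shear ?l (q - r) y \<in> convex hull E"
        using shear_convex_hull[OF l(1), of "q - r" E] x(2) unfolding shear_vertices[of ?l E r q, OF l rq False, simplified]
        by blast
      then show "\<beta> r (shear ?L (q - r) x) = \<beta> q x"
        unfolding \<beta>_def x(1) shear_plane_proj_cylinder[OF n x(2), of ?l] using plane_proj_cylinder[OF n] x(2) bary_swap[OF F(3) rq False] by simp
    qed
    finally show ?thesis .
  qed simp
  have ib: "integral ?C (\<beta> q) = measure lebesgue ?C / real CARD('n)" if q: "q \<in> E" for q
  proof -
    have "measure lebesgue ?C = integral ?C (\<lambda>x. 1)"
      by (rule lmeasure_integral[OF lmeasurable_compact[OF C]])
    also have "\<dots> = integral ?C (\<lambda>x. \<Sum>r\<in>E. \<beta> r x)"
      by (rule integral_cong) (simp add: \<beta>_def bary_affine_hull(1)[OF F(3,1) prE])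
    also have "\<dots> = (\<Sum>r\<in>E. integral ?C (\<beta> r))" by (rule integral_sum) (use F int in auto)
    also have "\<dots> = (\<Sum>r\<in>E. integral ?C (\<beta> q))" by (intro sum.cong refl) (rule eq[OF _ q])
    also have "\<dots> = real CARD('n) * integral ?C (\<beta> q)" using F by simp
    finally show ?thesis by simp
  qed
  have "((\<lambda>x. \<Sum>q\<in>E. \<beta> q x * f q) has_integral (\<Sum>q\<in>E. measure lebesgue ?C / real CARD('n) * f q)) ?C"
  proof (intro has_integral_sum F has_integral_mult_left)
    fix q assume "q \<in> E"
    then show "(\<beta> q has_integral measure lebesgue ?C / real CARD('n)) ?C"
      using integrable_integral[OF int[of q]] ib[of q] by simp
  qed
  moreover have "(\<Sum>q\<in>E. measure lebesgue ?C / real CARD('n) * f q) = measure lebesgue ?C * f (mid E)"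
    unfolding affine_fun_mid[OF f F(1,4)] F(2) by (simp add: sum_distrib_left sum_divide_distrib)
  moreover have "(\<Sum>q\<in>E. \<beta> q x * f q) = f (plane_proj \<nu> p x)" if "x \<in> ?C" for x
    unfolding \<beta>_def by (rule bary_affine_hull(3)[OF F(3,1) prE[OF that] f, symmetric])
  ultimately show ?thesis using has_integral_cong[of ?C "\<lambda>x. \<Sum>q\<in>E. \<beta> q x * f q" "\<lambda>x. f (plane_proj \<nu> p x)"] by simp
qed

text \<open>On the relative boundary of \<open>E\<close> some coordinate vanishes, and its lift
  vanishes on a hyperplane only.\<close>

lemma cylinder_negligible_boundary:
  assumes E: "face E" and n: "unit_normal \<nu> p E"
  shows "negligible {x \<in> cylinder \<nu> E. plane_proj \<nu> p x \<notin> rel_interior (convex hull E)}"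
proof -
  note F = faceD[OF E]
  have "{x \<in> cylinder \<nu> E. plane_proj \<nu> p x \<notin> rel_interior (convex hull E)} \<subseteq> (\<Union>q\<in>E. {x. bary E q (plane_proj \<nu> p x) = 0})"
  proof
    fix x assume x: "x \<in> {x \<in> cylinder \<nu> E. plane_proj \<nu> p x \<notin> rel_interior (convex hull E)}"
    then have y: "plane_proj \<nu> p x \<in> convex hull E" using plane_proj_in_hull[OF n] by auto
    then have z: "plane_proj \<nu> p x \<in> affine hull E" using convex_hull_subset_affine_hull by blast
    obtain q where "q \<in> E" "\<not> 0 < bary E q (plane_proj \<nu> p x)"
      using x z rel_interior_hull_bary[OF F(3,1)] by auto
    then show "x \<in> (\<Union>q\<in>E. {x. bary E q (plane_proj \<nu> p x) = 0})"
      using y convex_hull_bary[OF F(3,1) z] by force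
  qed
  moreover have "negligible (\<Union>q\<in>E. {x. bary E q (plane_proj \<nu> p x) = 0})"
  proof (intro negligible_Union finite_imageI F(1))
    fix t assume "t \<in> (\<lambda>q. {x. bary E q (plane_proj \<nu> p x) = 0}) ` E"
    then obtain q where q: "q \<in> E" "t = {x. bary E q (plane_proj \<nu> p x) = 0}" by auto
    have "plane_proj \<nu> p q = q" using plane_proj_cylinder[OF n hull_inc[OF q(1)], of 0] by simp
    then show "negligible t"
      unfolding q(2) using q(1)
      by (intro negligible_affine_fun_zero[of _ q] affine_fun_plane_proj bary_affine F) (simp add: bary_vertex[OF F(3)])
  qed
  ultimately show ?thesis using negligible_subset by blast
qed

lemma face_normal_exists:
  fixes E :: "(real^'n) set"
  assumes E: "face E"
  obtains \<nu> where "norm \<nu> = 1" "\<And>p q. p \<in> E \<Longrightarrow> q \<in> E \<Longrightarrow> (p - q) \<bullet> \<nu> = 0"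
proof -
  note F = faceD[OF E]
  obtain c where c: "c \<in> E" using F by auto
  let ?S = "(\<lambda>q. q - c) ` (E - {c})"
  have "dim ?S \<le> card ?S" by (rule dim_le_card') (use F in auto)
  also have "card ?S \<le> card (E - {c})" by (rule card_image_le) (use F in auto)
  also have "\<dots> < DIM(real^'n)" using F c by (simp add: card_gt_0_iff)
  finally obtain x where x: "x \<noteq> 0" "\<And>y. y \<in> span ?S \<Longrightarrow> orthogonal x y"
    using orthogonal_to_subspace_exists by metis
  have z: "(q - c) \<bullet> x = 0" if "q \<in> E" for q
    using x(2)[of "q - c"] that by (cases "q = c") (auto simp: orthogonal_def inner_commute intro: span_base)
  show ?thesis
  proof (rule that[of "x /\<^sub>R norm x"])
    show "norm (x /\<^sub>R norm x) = 1" using x by simp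
    fix p q assume "p \<in> E" "q \<in> E"
    then have "(p - q) \<bullet> x = 0" using z[of p] z[of q] by (simp add: inner_diff_left)
    then show "(p - q) \<bullet> (x /\<^sub>R norm x) = 0" by simp
  qed
qed

lemma snormal_unit_normal:
  assumes E: "face E" shows "unit_normal (snormal E) (SOME p. p \<in> E) E"
proof -
  obtain \<nu> where \<nu>: "norm \<nu> = 1" "\<And>p q. p \<in> E \<Longrightarrow> q \<in> E \<Longrightarrow> (p - q) \<bullet> \<nu> = 0"
    using face_normal_exists[OF E] by blast
  have "norm (snormal E) = 1 \<and> (\<forall>p\<in>E. \<forall>q\<in>E. (p - q) \<bullet> snormal E = 0)"
    unfolding snormal_def by (rule someI[of _ \<nu>]) (use \<nu> in auto)
  moreover have "(SOME p. p \<in> E) \<in> E" using faceD(4)[OF E] by (simp add: some_in_eq)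
  ultimately show ?thesis by (auto simp: unit_normal_def)
qed

lemma side_mean_cylinder:
  "side_mean E g = integral (cylinder (snormal E) E) (\<lambda>x. g (plane_proj (snormal E) (SOME p. p \<in> E) x)) / measure lebesgue (cylinder (snormal E) E)"
proof -
  \<comment> \<open>In \<open>cyl\<close> the product binds tighter than \<open>hull\<close>, so the
    hull there is that of the product; it factors because the interval is already convex.\<close>
  have "convex hull {0..1::real} = {0..1}" by (simp add: hull_same)
  then show ?thesis unfolding side_mean_def cyl_def cylinder_def sproj_def plane_proj_def convex_hull_Times by simp
qed

text \<open>Quantifying over all unit normals makes the notion independent of the sign chosen by \<open>snormal\<close>.\<close>

definition has_side_mean :: "(real^'n \<Rightarrow> real) \<Rightarrow> real \<Rightarrow> (real^'n) set \<Rightarrow> bool" where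
  "has_side_mean g c E \<longleftrightarrow> (\<forall>\<nu> p. unit_normal \<nu> p E \<longrightarrow>
     ((\<lambda>x. g (plane_proj \<nu> p x)) has_integral measure lebesgue (cylinder \<nu> E) * c) (cylinder \<nu> E))"

lemma has_side_mean_side_mean:
  assumes E: "face E" and h: "has_side_mean g c E"
  shows "side_mean E g = c"
proof -
  note n = snormal_unit_normal[OF E]
  have "integral (cylinder (snormal E) E) (\<lambda>x. g (plane_proj (snormal E) (SOME p. p \<in> E) x)) = measure lebesgue (cylinder (snormal E) E) * c"
    using h n unfolding has_side_mean_def by (intro integral_unique) blast
  then show ?thesis unfolding side_mean_cylinder using cylinder_measure_pos[OF E n] by simp
qed

text \<open>Both halves have half the area and overlap in a null set, so the means average with
  equal weights. Integrability is inherited from the halves, which lets means on coarse sides be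
  built from fine ones.\<close>

lemma has_side_mean_bisect:
  assumes E: "face E" and ab: "a \<in> E" "b \<in> E" "a \<noteq> b"
    and h: "has_side_mean g c1 (insert (midpt a b) (E - {b}))" "has_side_mean g c2 (insert (midpt a b) (E - {a}))"
  shows "has_side_mean g ((c1 + c2) / 2) E"
  unfolding has_side_mean_def
proof (intro allI impI)
  fix \<nu> p assume n: "unit_normal \<nu> p E"
  let ?E1 = "insert (midpt a b) (E - {b})" and ?E2 = "insert (midpt a b) (E - {a})"
  have sub: "?E1 \<subseteq> convex hull E" "?E2 \<subseteq> convex hull E"
    using midpt_in_hull[OF ab(1,2)] by (auto intro: hull_inc)
  note H = cylinder_halves[OF E n ab]
  have "((\<lambda>x. g (plane_proj \<nu> p x)) has_integral measure lebesgue (cylinder \<nu> ?E1) * c1 + measure lebesgue (cylinder \<nu> ?E2) * c2) (cylinder \<nu> ?E1 \<union> cylinder \<nu> ?E2)"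
    by (intro has_integral_Un H(2)) (use h unit_normal_subset[OF n sub(1)] unit_normal_subset[OF n sub(2)] in \<open>auto simp: has_side_mean_def\<close>)
  then show "((\<lambda>x. g (plane_proj \<nu> p x)) has_integral measure lebesgue (cylinder \<nu> E) * ((c1 + c2) / 2)) (cylinder \<nu> E)"
    unfolding H(3,4) H(1)[symmetric] by (simp add: field_simps)
qed

text \<open>Agreement is asked for only in the relative interior, because the functions concerned
  are ambiguous where several sides meet.\<close>

lemma has_side_mean_affine:
  assumes E: "face E" and f: "affine_fun f"
    and g: "\<And>y. y \<in> rel_interior (convex hull E) \<Longrightarrow> g y = f y"
  shows "has_side_mean g (f (mid E)) E"
  unfolding has_side_mean_def
proof (intro allI impI)
  fix \<nu> p assume n: "unit_normal \<nu> p E"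
  show "((\<lambda>x. g (plane_proj \<nu> p x)) has_integral measure lebesgue (cylinder \<nu> E) * f (mid E)) (cylinder \<nu> E)"
    by (rule has_integral_spike[OF cylinder_negligible_boundary[OF E n] _ has_integral_cylinder_affine[OF E n f]])
      (use g in auto)
qed

lemma has_side_mean_diff:
  "has_side_mean g c E \<Longrightarrow> has_side_mean h d E \<Longrightarrow> has_side_mean (\<lambda>x. g x - h x) (c - d) E"
  unfolding has_side_mean_def by (auto simp: right_diff_distrib intro: has_integral_diff)

section \<open>Bisection trees and the discrete Green identity\<close>

lemma nondeg_nsimplex: "nondeg_simplex S \<Longrightarrow> nsimplex (verts S)"
  unfolding nondeg_simplex_def nsimplex_def verts_def by (auto simp: distinct_card)

text \<open>What the estimates use of the rule: the edge cut joins the first and the last vertex,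
  while cutting the list at the type and reversing its tail merely permute the other
  vertices.\<close>

lemma bisect_nondeg:
  fixes S :: "'n::finite tsimplex"
  assumes S: "nondeg_simplex S"
  obtains a b where "a \<in> verts S" "b \<in> verts S" "a \<noteq> b"
    "verts (fst (bisect S)) = insert (midpt a b) (verts S - {b})"
    "verts (snd (bisect S)) = insert (midpt a b) (verts S - {a})"
    "nondeg_simplex (fst (bisect S))" "nondeg_simplex (snd (bisect S))"
proof -
  obtain xs \<gamma> where Sx: "S = (xs, \<gamma>)" by (cases S)
  have len: "length xs = CARD('n) + 1" and dist: "distinct xs" and \<gamma>: "\<gamma> < CARD('n)"
    and ind: "\<not> affine_dependent (set xs)"
    using S by (auto simp: nondeg_simplex_def Sx verts_def)
  have n: "0 < CARD('n)" by simp
  obtain a ys where ay: "xs = a # ys" using len by (cases xs) auto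
  have "ys \<noteq> []" using len ay n by auto
  then obtain zs b where yz: "ys = zs @ [b]" by (metis rev_exhaust)
  have xs: "xs = a # zs @ [b]" and lz: "length zs = CARD('n) - 1"
    using ay yz len by auto
  let ?m = "midpt a b"
  have b0: "xs ! 0 = a" "xs ! (length xs - 1) = b" "take (length xs - 1 - 1) (drop 1 xs) = zs"
    by (simp_all add: xs nth_append)
  have bis: "bisect S = ((a # ?m # take \<gamma> zs @ drop \<gamma> zs, (\<gamma> + 1) mod (length xs - 1)),
      (b # ?m # take \<gamma> zs @ rev (drop \<gamma> zs), (\<gamma> + 1) mod (length xs - 1)))"
    unfolding bisect_def Let_def Sx fst_conv snd_conv b0 ..
  have ab: "a \<in> set xs" "b \<in> set xs" "a \<noteq> b" using dist by (auto simp: xs)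
  have vS: "verts S = set xs" by (simp add: verts_def Sx)
  have td: "set (take \<gamma> zs) \<union> set (drop \<gamma> zs) = set zs" by (metis append_take_drop_id set_append)
  have v1: "verts (fst (bisect S)) = insert ?m (verts S - {b})"
  proof -
    have "verts (fst (bisect S)) = insert a (insert ?m (set zs))" by (simp add: verts_def bis)
    moreover have "set xs - {b} = insert a (set zs)" using dist by (auto simp: xs)
    ultimately show ?thesis unfolding vS by auto
  qed
  have v2: "verts (snd (bisect S)) = insert ?m (verts S - {a})"
  proof -
    have "verts (snd (bisect S)) = insert b (insert ?m (set zs))" using td by (simp add: verts_def bis)
    moreover have "set xs - {a} = insert b (set zs)" using dist by (auto simp: xs)
    ultimately show ?thesis unfolding vS by auto
  qed
  have V: "nsimplex (verts S)" by (rule nondeg_nsimplex[OF S])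
  note V12 = nsimplex_bisect[OF V ab[folded vS]]
  have len1: "length (fst (fst (bisect S))) = CARD('n) + 1" "length (fst (snd (bisect S))) = CARD('n) + 1"
    unfolding bis using lz n by (auto simp del: zero_less_card_finite)
  have tp: "snd (fst (bisect S)) < CARD('n)" "snd (snd (bisect S)) < CARD('n)"
    unfolding bis using len n by auto
  \<comment> \<open>The list has n+1 entries and its set of entries has n+1 elements.\<close>
  have d1: "distinct (fst (fst (bisect S)))"
  proof (rule card_distinct)
    show "card (set (fst (fst (bisect S)))) = length (fst (fst (bisect S)))"
      using nsimplexD(2)[OF V12(1), folded v1] len1(1) by (simp add: verts_def)
  qed
  have d2: "distinct (fst (snd (bisect S)))"
  proof (rule card_distinct)
    show "card (set (fst (snd (bisect S)))) = length (fst (snd (bisect S)))"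
      using nsimplexD(2)[OF V12(2), folded v2] len1(2) by (simp add: verts_def)
  qed
  show ?thesis
  proof (rule that[OF ab[folded vS] v1 v2])
    show "nondeg_simplex (fst (bisect S))"
      unfolding nondeg_simplex_def using len1 tp d1 V12(1) v1 by (simp add: nsimplex_def)
    show "nondeg_simplex (snd (bisect S))"
      unfolding nondeg_simplex_def using len1 tp d2 V12(2) v2 by (simp add: nsimplex_def)
  qed
qed

lemma sconv_bisect:
  assumes "nondeg_simplex S"
  shows "sconv S = sconv (fst (bisect S)) \<union> sconv (snd (bisect S))"
    "negligible (sconv (fst (bisect S)) \<inter> sconv (snd (bisect S)))"
    "measure lebesgue (sconv (fst (bisect S))) = measure lebesgue (sconv S) / 2"
    "measure lebesgue (sconv (snd (bisect S))) = measure lebesgue (sconv S) / 2"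
proof -
  obtain a b where ab: "a \<in> verts S" "b \<in> verts S" "a \<noteq> b"
    and v: "verts (fst (bisect S)) = insert (midpt a b) (verts S - {b})"
    "verts (snd (bisect S)) = insert (midpt a b) (verts S - {a})"
    using bisect_nondeg[OF assms] by metis
  note H = nsimplex_halves[OF nondeg_nsimplex[OF assms] ab]
  show "sconv S = sconv (fst (bisect S)) \<union> sconv (snd (bisect S))"
    "negligible (sconv (fst (bisect S)) \<inter> sconv (snd (bisect S)))"
    "measure lebesgue (sconv (fst (bisect S))) = measure lebesgue (sconv S) / 2"
    "measure lebesgue (sconv (snd (bisect S))) = measure lebesgue (sconv S) / 2"
    unfolding sconv_def v using H by auto
qed

lemma nondeg_bisect:
  "nondeg_simplex S \<Longrightarrow> nondeg_simplex (fst (bisect S))"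
  "nondeg_simplex S \<Longrightarrow> nondeg_simplex (snd (bisect S))"
  by (metis bisect_nondeg)+

text \<open>A sequence of bisections of the whole triangulation becomes a derivation rooted at a
  single simplex with leaves in \<open>Th\<close>. Estimates can then be proved by induction from
  the fine elements up to \<open>K\<close>.\<close>

inductive bisection_tree :: "'n::finite tsimplex set \<Rightarrow> 'n tsimplex \<Rightarrow> bool" for Th where
  leaf: "S \<in> Th \<Longrightarrow> bisection_tree Th S"
| node: "bisection_tree Th (fst (bisect S)) \<Longrightarrow> bisection_tree Th (snd (bisect S)) \<Longrightarrow> bisection_tree Th S"

text \<open>The leaf that is bisected is replaced by a node with two leaves; the rest of the
  derivation stays.\<close>

lemma bisection_tree_step:
  assumes "bisection_tree T K" "bisect_step T T'"
  shows "bisection_tree T' K"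
  using assms
proof (induction rule: bisection_tree.induct)
  case (leaf X)
  then obtain S where S: "T' = (T - {S}) \<union> children S" by (auto simp: bisect_step_def)
  show ?case
  proof (cases "X = S")
    case True
    have "bisection_tree T' (fst (bisect S))" "bisection_tree T' (snd (bisect S))"
      by (rule bisection_tree.leaf, simp add: S children_def)+
    then show ?thesis unfolding True by (rule bisection_tree.node)
  next
    case False
    then show ?thesis using leaf S by (intro bisection_tree.leaf) auto
  qed
qed (auto intro: bisection_tree.node)

lemma refinement_bisection_tree:
  assumes "bisect_step\<^sup>*\<^sup>* T Th" "K \<in> T" shows "bisection_tree Th K"
  using assms by (induction rule: rtranclp_induct) (auto intro: bisection_tree.leaf bisection_tree_step)

lemma sides_face: "nondeg_simplex S \<Longrightarrow> E \<in> sides S \<Longrightarrow> face E"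
  unfolding sides_def using nsimplex_face[OF nondeg_nsimplex[of S]] by blast

text \<open>Cauchy-Schwarz reduced to the sign of a quadratic in t. In this form the estimates on
  two children, with different base points, can be added before the discriminant is taken.\<close>

lemma quadratic_nonneg_discriminant:
  fixes A B D :: real
  assumes "\<And>t. 0 \<le> A + 2 * t * B + t\<^sup>2 * D"
  shows "B\<^sup>2 \<le> A * D"
proof (cases "D = 0")
  case True
  have "B = 0"
  proof (rule ccontr)
    assume "B \<noteq> 0"
    \<comment> \<open>This t makes the linear expression equal to -1.\<close>
    then show False using assms[of "- (A + 1) / (2 * B)"] True by (simp add: field_simps)
  qed
  then show ?thesis using True by simp
next
  case False
  have "0 \<le> D"
  proof (rule ccontr)
    assume D: "\<not> 0 \<le> D"
    have A: "0 \<le> A" using assms[of 0] by simp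
    \<comment> \<open>Adding the values at t and -t removes \<open>B\<close>; the t chosen next
      yields -2.\<close>
    have "0 \<le> 2 * A + 2 * t\<^sup>2 * D" for t
      using assms[of t] assms[of "- t"] by simp
    from this[of "sqrt ((A + 1) / (- D))"] D A show False
      by (simp add: field_simps zero_le_divide_iff)
  qed
  then have D: "0 < D" using False by simp
  have "A + 2 * (- B / D) * B + (- B / D)\<^sup>2 * D = A - B\<^sup>2 / D"
    using D by (simp add: field_simps power2_eq_square)
  then have "0 \<le> A - B\<^sup>2 / D" using assms[of "- B / D"] by simp
  then show ?thesis using D by (simp add: field_simps)
qed

text \<open>Since \<open>b\<close> equals \<open>2 m - a\<close>, the point with weights
  \<open>l\<close> on \<open>V\<close> has weight \<open>l a - l b\<close> at \<open>a\<close> and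
  \<open>2 * l b\<close> at \<open>m\<close> in the child without \<open>b\<close>; negative weights
  are allowed. A general \<open>F\<close> covers the sum of the weights, the point itself and
  combinations of side means.\<close>

lemma bisect_weights:
  fixes l :: "'a \<Rightarrow> real" and F :: "'a \<Rightarrow> 'b::real_vector"
  assumes "finite V" "a \<in> V" "b \<in> V" "a \<noteq> b" "m \<notin> V"
  shows "(\<Sum>q\<in>insert m (V - {b}). (l(a := l a - l b, m := 2 * l b)) q *\<^sub>R F q)
    = (2 * l b) *\<^sub>R F m + (l a - l b) *\<^sub>R F a + (\<Sum>q\<in>V - {a, b}. l q *\<^sub>R F q)"
    "(\<Sum>q\<in>V. l q *\<^sub>R F q) = l a *\<^sub>R F a + l b *\<^sub>R F b + (\<Sum>q\<in>V - {a, b}. l q *\<^sub>R F q)"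
proof -
  define R where "R = V - {a, b}"
  have V: "V = insert a (insert b R)" "V - {b} = insert a R" using assms by (auto simp: R_def)
  have R: "finite R" "a \<notin> R" "b \<notin> R" "m \<notin> R" "m \<noteq> a" using assms by (auto simp: R_def)
  have "(\<Sum>q\<in>R. (l(a := l a - l b, m := 2 * l b)) q *\<^sub>R F q) = (\<Sum>q\<in>R. l q *\<^sub>R F q)"
    by (rule sum.cong) (use R in auto)
  then show "(\<Sum>q\<in>insert m (V - {b}). (l(a := l a - l b, m := 2 * l b)) q *\<^sub>R F q)
    = (2 * l b) *\<^sub>R F m + (l a - l b) *\<^sub>R F a + (\<Sum>q\<in>V - {a, b}. l q *\<^sub>R F q)"
    unfolding V(2) R_def[symmetric] using R by simp
  show "(\<Sum>q\<in>V. l q *\<^sub>R F q) = l a *\<^sub>R F a + l b *\<^sub>R F b + (\<Sum>q\<in>V - {a, b}. l q *\<^sub>R F q)"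
    unfolding R_def[symmetric] by (subst V(1)) (use R assms in simp)
qed

text \<open>\<open>u\<close> stands for the fine function minus the affine function
  \<open>w K\<close>. Subtracting the same affine function on all elements, also outside
  \<open>K\<close>, preserves agreement at midpoints.\<close>

locale cr_refinement =
  fixes Th :: "'n::finite tsimplex set" and K :: "'n tsimplex"
    and g :: "'n tsimplex \<Rightarrow> real^'n" and k :: "'n tsimplex \<Rightarrow> real" and u :: "'n tsimplex \<Rightarrow> real^'n \<Rightarrow> real"
  assumes regular: "regular_triangulation Th"
    and nondeg_K: "nondeg_simplex K"
    and u_eq: "\<And>S x. S \<in> Th \<Longrightarrow> u S x = g S \<bullet> x + k S"
    and u_mid: "\<And>S S' E. S \<in> Th \<Longrightarrow> S' \<in> Th \<Longrightarrow> E \<in> sides S \<Longrightarrow> E \<in> sides S' \<Longrightarrow> u S (mid E) = u S' (mid E)"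
begin

lemma Th_nondeg: "S \<in> Th \<Longrightarrow> nondeg_simplex S"
  using regular by (simp add: regular_triangulation_def)

lemma Th_inter: "S \<in> Th \<Longrightarrow> S' \<in> Th \<Longrightarrow> S \<noteq> S' \<Longrightarrow> sconv S \<inter> sconv S' = convex hull (verts S \<inter> verts S')"
  and Th_verts_neq: "S \<in> Th \<Longrightarrow> S' \<in> Th \<Longrightarrow> S \<noteq> S' \<Longrightarrow> verts S \<noteq> verts S'"
  using regular by (simp_all add: regular_triangulation_def)

lemma u_affine: "S \<in> Th \<Longrightarrow> affine_fun (u S)"
  unfolding affine_fun_def using u_eq by blast

text \<open>Regularity puts \<open>x\<close> into the hull of the common vertices, and a face with
  \<open>x\<close> in its relative interior must then consist of common vertices.\<close>

lemma common_face:
  assumes S: "S \<in> Th" "S' \<in> Th" and E: "E \<subseteq> verts S" and x: "x \<in> rel_interior (convex hull E)" "x \<in> sconv S'"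
  shows "E \<subseteq> verts S'"
proof (cases "S = S'")
  case False
  note V = nsimplexD[OF nondeg_nsimplex[OF Th_nondeg[OF S(1)]]]
  have "x \<in> sconv S"
    using x(1) E rel_interior_subset hull_mono[OF E, of convex] by (auto simp: sconv_def)
  then have "x \<in> convex hull (verts S \<inter> verts S')" using Th_inter[OF S False] x(2) by auto
  then have "E \<subseteq> verts S \<inter> verts S'"
    using rel_interior_face_subset[OF V(3,1) E _ x(1)] by blast
  then show ?thesis by auto
qed (use E in simp)

definition "elem_at = fine_elem Th K"

lemma elem_at_props:
  assumes "S \<in> Th" "sconv S \<subseteq> sconv K" "x \<in> sconv S"
  shows "elem_at x \<in> Th" "sconv (elem_at x) \<subseteq> sconv K" "x \<in> sconv (elem_at x)"
proof -
  have "elem_at x \<in> Th \<and> sconv (elem_at x) \<subseteq> sconv K \<and> x \<in> sconv (elem_at x)"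
    unfolding elem_at_def fine_elem_def by (rule someI[of _ S]) (use assms in auto)
  then show "elem_at x \<in> Th" "sconv (elem_at x) \<subseteq> sconv K" "x \<in> sconv (elem_at x)" by auto
qed

text \<open>An element containing an interior point of \<open>S\<close> has all vertices of
  \<open>S\<close>, and regularity forbids two elements with the same vertices.\<close>

lemma elem_at_interior:
  assumes S: "S \<in> Th" "sconv S \<subseteq> sconv K" and x: "x \<in> interior (sconv S)"
  shows "elem_at x = S"
proof (rule ccontr)
  assume ne: "elem_at x \<noteq> S"
  note V = nondeg_nsimplex[OF Th_nondeg[OF S(1)]]
  have xS: "x \<in> sconv S" using x interior_subset by blast
  note f = elem_at_props[OF S xS]
  have "x \<in> rel_interior (convex hull (verts S))"
    using x nsimplex_interior[OF V] by (simp add: sconv_def)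
  then have "verts S \<subseteq> verts (elem_at x)" by (intro common_face[OF S(1) f(1) subset_refl _ f(3)])
  moreover note W = nondeg_nsimplex[OF Th_nondeg[OF f(1)]]
  ultimately have "verts S = verts (elem_at x)"
    using nsimplexD(1,2)[OF V] nsimplexD(1,2)[OF W] by (metis card_subset_eq)
  then show False using Th_verts_neq[OF f(1) S(1) ne] by simp
qed

text \<open>A family indexed by elements becomes one function. On the skeleton its value depends on
  the choice in \<open>elem_at\<close>; this is invisible to volume integrals but not to side
  means.\<close>

definition pw :: "('n tsimplex \<Rightarrow> real^'n \<Rightarrow> real) \<Rightarrow> real^'n \<Rightarrow> real" where
  "pw \<psi> x = \<psi> (elem_at x) x"

lemma pw_leaf:
  assumes S: "S \<in> Th" "sconv S \<subseteq> sconv K" and \<psi>: "(\<psi> S has_integral I) (sconv S)"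
  shows "(pw \<psi> has_integral I) (sconv S)"
proof (rule has_integral_spike[OF _ _ \<psi>])
  show "negligible (sconv S - interior (sconv S))"
    unfolding sconv_def by (rule nsimplex_negligible_boundary[OF nondeg_nsimplex[OF Th_nondeg[OF S(1)]]])
qed (use elem_at_interior[OF S] in \<open>auto simp: pw_def\<close>)

lemma pw_integrable:
  assumes "bisection_tree Th S" "nondeg_simplex S" "sconv S \<subseteq> sconv K"
    and \<psi>: "\<And>S. S \<in> Th \<Longrightarrow> continuous_on UNIV (\<psi> S)"
  shows "pw \<psi> integrable_on sconv S"
  using assms(1-3)
proof (induction rule: bisection_tree.induct)
  case (leaf S)
  have "\<psi> S integrable_on sconv S"
    unfolding sconv_def
    by (intro compact_continuous_integrable \<psi> leaf nsimplex_compact nondeg_nsimplex)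
  then show ?case using pw_leaf[OF leaf(1,3)] by (auto simp: integrable_on_def)
next
  case (node S)
  note H = sconv_bisect[OF node.prems(1)]
  have 1: "pw \<psi> integrable_on sconv (fst (bisect S))" "pw \<psi> integrable_on sconv (snd (bisect S))"
    using node.IH node.prems nondeg_bisect[OF node.prems(1)] H(1) by auto
  show ?case unfolding H(1)
    using has_integral_Un[OF integrable_integral[OF 1(1)] integrable_integral[OF 1(2)] H(2)] by blast
qed

lemma pw_split:
  assumes "bisection_tree Th (fst (bisect S))" "bisection_tree Th (snd (bisect S))" "nondeg_simplex S" "sconv S \<subseteq> sconv K"
    and \<psi>: "\<And>S. S \<in> Th \<Longrightarrow> continuous_on UNIV (\<psi> S)"
  shows "integral (sconv S) (pw \<psi>) = integral (sconv (fst (bisect S))) (pw \<psi>) + integral (sconv (snd (bisect S))) (pw \<psi>)"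
proof -
  note H = sconv_bisect[OF assms(3)]
  have "pw \<psi> integrable_on sconv (fst (bisect S))" "pw \<psi> integrable_on sconv (snd (bisect S))"
    by (intro pw_integrable assms nondeg_bisect \<psi>; use assms(4) H(1) in auto)+
  then show ?thesis unfolding H(1) by (intro integral_Un H(2))
qed

text \<open>The two values of \<open>u\<close> on a common fine side differ, but their means agree; replacing \<open>u\<close> by that mean
  gives one function on the skeleton for both adjacent simplices.\<close>

definition trace :: "real^'n \<Rightarrow> real" where
  "trace x = (SOME c. \<exists>S\<in>Th. \<exists>E\<in>sides S. x \<in> rel_interior (convex hull E) \<and> c = u S (mid E))"

text \<open>By conformity a point determines the fine side that has it in its relative interior, and
  on that side the midpoint values from all adjacent elements agree.\<close>

lemma trace_eq:
  assumes S: "S \<in> Th" "E \<in> sides S" and x: "x \<in> rel_interior (convex hull E)"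
  shows "trace x = u S (mid E)"
proof -
  have "\<exists>S\<in>Th. \<exists>E\<in>sides S. x \<in> rel_interior (convex hull E) \<and> trace x = u S (mid E)"
    unfolding trace_def by (rule someI_ex) (use assms in blast)
  then obtain S' E' where S': "S' \<in> Th" "E' \<in> sides S'" "x \<in> rel_interior (convex hull E')" "trace x = u S' (mid E')"
    by auto
  have sub: "E \<subseteq> verts S" "E' \<subseteq> verts S'" using S S' by (auto simp: sides_def)
  have xin: "x \<in> convex hull E" "x \<in> convex hull E'" using x S'(3) rel_interior_subset by blast+
  then have "x \<in> sconv S'" using hull_mono[OF sub(2), of convex] by (auto simp: sconv_def)
  then have E: "E \<subseteq> verts S'" using common_face[OF S(1) S'(1) sub(1) x] by blast
  note V = nsimplexD[OF nondeg_nsimplex[OF Th_nondeg[OF S'(1)]]]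
  have "E = E'"
    using rel_interior_face_subset[OF V(3,1) E sub(2) x xin(2)]
      rel_interior_face_subset[OF V(3,1) sub(2) E S'(3) xin(1)] by auto
  then show ?thesis using u_mid[OF S(1) S'(1) S(2)] S' by auto
qed

definition trace_mean :: "(real^'n) set \<Rightarrow> real" where "trace_mean E = side_mean E trace"

lemma trace_leaf:
  assumes S: "S \<in> Th" "E \<in> sides S"
  shows "has_side_mean trace (u S (mid E)) E"
proof -
  have "face E" by (rule sides_face[OF Th_nondeg[OF S(1)] S(2)])
  from has_side_mean_affine[OF this affine_fun_const, of trace "u S (mid E)"] trace_eq[OF S]
  show ?thesis by simp
qed

lemma trace_mean_leaf: "S \<in> Th \<Longrightarrow> E \<in> sides S \<Longrightarrow> trace_mean E = u S (mid E)"
  unfolding trace_mean_def by (intro has_side_mean_side_mean trace_leaf sides_face[OF Th_nondeg])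

lemma trace_bisect:
  assumes "face E" "a \<in> E" "b \<in> E" "a \<noteq> b"
    and "has_side_mean trace (trace_mean (insert (midpt a b) (E - {b}))) (insert (midpt a b) (E - {b}))"
      "has_side_mean trace (trace_mean (insert (midpt a b) (E - {a}))) (insert (midpt a b) (E - {a}))"
  shows "has_side_mean trace (trace_mean E) E"
    "trace_mean E = (trace_mean (insert (midpt a b) (E - {b})) + trace_mean (insert (midpt a b) (E - {a}))) / 2"
  using has_side_mean_bisect[OF assms] has_side_mean_side_mean[OF assms(1)] by (auto simp: trace_mean_def)

text \<open>Of the sides of a bisected simplex, those opposite \<open>a\<close> and \<open>b\<close>
  are whole sides of one child, opposite the midpoint; all others contain the edge and are bisected
  along with it.\<close>

lemma trace_tree:
  assumes "bisection_tree Th S" "nondeg_simplex S" "q \<in> verts S"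
  shows "has_side_mean trace (trace_mean (verts S - {q})) (verts S - {q})"
  using assms
proof (induction arbitrary: q rule: bisection_tree.induct)
  case (leaf S)
  then have "verts S - {q} \<in> sides S" by (auto simp: sides_def)
  then show ?case using trace_leaf trace_mean_leaf leaf by metis
next
  case (node S)
  obtain a b where ab: "a \<in> verts S" "b \<in> verts S" "a \<noteq> b"
    and v: "verts (fst (bisect S)) = insert (midpt a b) (verts S - {b})"
    "verts (snd (bisect S)) = insert (midpt a b) (verts S - {a})"
    and nd: "nondeg_simplex (fst (bisect S))" "nondeg_simplex (snd (bisect S))"
    using bisect_nondeg[OF node.prems(1)] by metis
  let ?m = "midpt a b"
  have V: "nsimplex (verts S)" by (rule nondeg_nsimplex[OF node.prems(1)])
  have m: "?m \<notin> verts S" by (rule midpt_notin[OF nsimplexD(3)[OF V] ab])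
  note IH = node.IH(1)[OF nd(1), unfolded v] node.IH(2)[OF nd(2), unfolded v]
  consider "q = a" | "q = b" | "q \<noteq> a" "q \<noteq> b" by auto
  then show ?case
  proof cases
    case 1
    have "insert ?m (verts S - {a}) - {?m} = verts S - {a}" using m by auto
    then show ?thesis using IH(2)[of ?m] 1 by simp
  next
    case 2
    have "insert ?m (verts S - {b}) - {?m} = verts S - {b}" using m by auto
    then show ?thesis using IH(1)[of ?m] 2 by simp
  next
    case 3
    have e: "insert ?m (verts S - {b}) - {q} = insert ?m (verts S - {q} - {b})"
       "insert ?m (verts S - {a}) - {q} = insert ?m (verts S - {q} - {a})"
      using m node.prems by auto
    show ?thesis
      by (rule trace_bisect(1)[of _ a b])
        (use nsimplex_face[OF V node.prems(2)] ab 3 IH(1)[of q] IH(2)[of q] node.prems e in auto)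
  qed
qed

text \<open>The discrete form of integrating \<open>div ((x - p) u)\<close>: only the side means on the boundary survive.\<close>

lemma green_identity:
  assumes "bisection_tree Th S" "nondeg_simplex S" "sconv S \<subseteq> sconv K"
    and "sum l (verts S) = 1" "p = (\<Sum>q\<in>verts S. l q *\<^sub>R q)"
  shows "integral (sconv S) (pw (\<lambda>S x. (x - p) \<bullet> g S)) + real CARD('n) * integral (sconv S) (pw u)
    = real CARD('n) * measure lebesgue (sconv S) * (\<Sum>q\<in>verts S. l q * trace_mean (verts S - {q}))"
  using assms
proof (induction arbitrary: l rule: bisection_tree.induct)
  case (leaf S)
  note V = nondeg_nsimplex[OF leaf(2)]
  note F = nsimplexD[OF V]
  \<comment> \<open>On one element \<open>(x - p) \<bullet> g S\<close> is
    \<open>u S x - u S p\<close>. With \<open>T\<close> the sum of the vertex values, both sides of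
    the identity become the volume times \<open>T - u S p\<close>.\<close>
  let ?N = "real CARD('n)" and ?v = "measure lebesgue (sconv S)"
  define T where "T = (\<Sum>q\<in>verts S. u S q)"
  have up: "u S p = (\<Sum>q\<in>verts S. l q * u S q)"
    unfolding leaf(5) by (rule affine_fun_sum[OF u_affine[OF leaf(1)] leaf(4)])
  have i1: "integral (sconv S) (pw u) = ?v / (?N + 1) * T"
    unfolding T_def sconv_def
    by (intro integral_unique pw_leaf[OF leaf(1,3), unfolded sconv_def] has_integral_affine_fun[OF V] u_affine leaf)
  have d: "(x - p) \<bullet> g S = u S x - u S p" for x
    by (simp add: u_eq[OF leaf(1)] inner_diff_right inner_commute[of _ "g S"])
  have "integral (sconv S) (pw (\<lambda>S x. (x - p) \<bullet> g S)) = ?v / (?N + 1) * (\<Sum>q\<in>verts S. (q - p) \<bullet> g S)"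
    unfolding sconv_def
    by (intro integral_unique pw_leaf[OF leaf(1,3), unfolded sconv_def] has_integral_affine_fun[OF V])
      (simp add: d affine_fun_diff[OF u_affine[OF leaf(1)]])
  also have "(\<Sum>q\<in>verts S. (q - p) \<bullet> g S) = T - (?N + 1) * u S p"
    unfolding d T_def using F by (simp add: sum_subtractf add.commute)
  finally have i2: "integral (sconv S) (pw (\<lambda>S x. (x - p) \<bullet> g S)) = ?v / (?N + 1) * (T - (?N + 1) * u S p)" .
  have smq: "trace_mean (verts S - {q}) = (T - u S q) / ?N" if q: "q \<in> verts S" for q
  proof -
    have fc: "face (verts S - {q})" by (rule nsimplex_face[OF V q])
    have "trace_mean (verts S - {q}) = u S (mid (verts S - {q}))"
      by (rule trace_mean_leaf[OF leaf(1)]) (use q in \<open>auto simp: sides_def\<close>)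
    also have "\<dots> = (\<Sum>r\<in>verts S - {q}. u S r) / ?N"
      using affine_fun_mid[OF u_affine[OF leaf(1)] faceD(1,4)[OF fc]] faceD(2)[OF fc] by simp
    also have "(\<Sum>r\<in>verts S - {q}. u S r) = T - u S q"
      unfolding T_def using F q by (simp add: sum_diff1)
    finally show ?thesis .
  qed
  have "(\<Sum>q\<in>verts S. l q * trace_mean (verts S - {q})) = (\<Sum>q\<in>verts S. l q * T / ?N - l q * u S q / ?N)"
    by (rule sum.cong) (auto simp: smq diff_divide_distrib right_diff_distrib)
  also have "\<dots> = (T - u S p) / ?N"
    using leaf(4) by (simp add: up sum_subtractf sum_divide_distrib[symmetric] sum_distrib_right[symmetric] diff_divide_distrib)
  finally have r: "(\<Sum>q\<in>verts S. l q * trace_mean (verts S - {q})) = (T - u S p) / ?N" .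
  have N: "?N + 1 > 0" "?N > 0" by auto
  have "?v / (?N + 1) * (T - (?N + 1) * u S p) + ?N * (?v / (?N + 1) * T) = ?v * (T - u S p)"
  proof -
    define z where "z = ?v / (?N + 1)"
    have "?v = z * (?N + 1)" using N by (simp add: z_def)
    then show ?thesis unfolding z_def[symmetric] by (simp add: algebra_simps)
  qed
  then show ?case unfolding i1 i2 r using N by simp
next
  case (node S)
  obtain a b where ab: "a \<in> verts S" "b \<in> verts S" "a \<noteq> b"
    and v: "verts (fst (bisect S)) = insert (midpt a b) (verts S - {b})"
    "verts (snd (bisect S)) = insert (midpt a b) (verts S - {a})"
    and nd: "nondeg_simplex (fst (bisect S))" "nondeg_simplex (snd (bisect S))"
    using bisect_nondeg[OF node.prems(1)] by metis
  define m where "m = midpt a b"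
  define V where "V = verts S"
  define R where "R = V - {a, b}"
  note v = v[folded m_def V_def] note ab = ab[folded V_def]
  have Vs: "nsimplex V" unfolding V_def by (rule nondeg_nsimplex[OF node.prems(1)])
  note F = nsimplexD[OF Vs]
  have m: "m \<notin> V" unfolding m_def by (rule midpt_notin[OF F(3) ab])
  note H = sconv_bisect[OF node.prems(1)]
  let ?N = "real CARD('n)" and ?v = "measure lebesgue (sconv S)"
  let ?S1 = "fst (bisect S)" and ?S2 = "snd (bisect S)"
  \<comment> \<open>\<open>l1\<close> and \<open>l2\<close> are the weights of the same point
    \<open>p\<close> in the two children.\<close>
  define l1 where "l1 = l(a := l a - l b, m := 2 * l b)"
  define l2 where "l2 = l(b := l b - l a, m := 2 * l a)"
  note w1 = bisect_weights(1)[OF F(1) ab m, of l, folded l1_def R_def]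
  note w2 = bisect_weights(1)[OF F(1) ab(2,1) ab(3)[symmetric] m, of l, folded l2_def, unfolded insert_commute[of b a], folded R_def]
  note w0 = bisect_weights(2)[OF F(1) ab m, of l, folded R_def]
  note prems = node.prems(3,4)[folded V_def]
  have s1: "sum l1 (verts ?S1) = 1" "sum l2 (verts ?S2) = 1"
    using w1[of "\<lambda>_. 1::real"] w2[of "\<lambda>_. 1::real"] w0[of "\<lambda>_. 1::real"] prems(1) unfolding v by auto
  have p1: "p = (\<Sum>q\<in>verts ?S1. l1 q *\<^sub>R q)" "p = (\<Sum>q\<in>verts ?S2. l2 q *\<^sub>R q)"
    unfolding v w1 w2 prems(2) w0 by (simp_all add: m_def algebra_simps)
  have sub: "sconv ?S1 \<subseteq> sconv K" "sconv ?S2 \<subseteq> sconv K" using node.prems(2) H(1) by auto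
  note I1 = node.IH(1)[OF nd(1) sub(1) s1(1) p1(1), unfolded H(3,4) v]
  note I2 = node.IH(2)[OF nd(2) sub(2) s1(2) p1(2), unfolded H(3,4) v]
  have c: "continuous_on UNIV (\<lambda>x. (x - p) \<bullet> g S)" for S by (intro continuous_intros)
  have cu: "S \<in> Th \<Longrightarrow> continuous_on UNIV (u S)" for S by (rule affine_fun_continuous[OF u_affine])
  note sp = pw_split[OF node.hyps node.prems(1,2)]
  have e1: "insert m (V - {b}) - {m} = V - {b}" "insert m (V - {a}) - {m} = V - {a}"
    "insert m (V - {b}) - {a} = insert m R" "insert m (V - {a}) - {b} = insert m R"
    using m ab by (auto simp: R_def)
  \<comment> \<open>A side opposite a vertex of \<open>R\<close> contains both \<open>a\<close> and
    \<open>b\<close>.\<close>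
  have sR: "trace_mean (V - {q}) = (trace_mean (insert m (V - {b}) - {q}) + trace_mean (insert m (V - {a}) - {q})) / 2" if q: "q \<in> R" for q
  proof -
    have e: "insert m (V - {b}) - {q} = insert m (V - {q} - {b})"
       "insert m (V - {a}) - {q} = insert m (V - {q} - {a})"
      using m q by (auto simp: R_def)
    have "has_side_mean trace (trace_mean (insert m (V - {b}) - {q})) (insert m (V - {b}) - {q})"
      using trace_tree[OF node.hyps(1) nd(1), unfolded v, of q] q by (auto simp: R_def)
    moreover have "has_side_mean trace (trace_mean (insert m (V - {a}) - {q})) (insert m (V - {a}) - {q})"
      using trace_tree[OF node.hyps(2) nd(2), unfolded v, of q] q by (auto simp: R_def)
    moreover have "face (V - {q})" using q by (intro nsimplex_face[OF Vs]) (auto simp: R_def)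
    moreover have "a \<in> V - {q}" "b \<in> V - {q}" using ab q by (auto simp: R_def)
    ultimately show ?thesis using trace_bisect(2)[of "V - {q}" a b, folded m_def, folded e] ab(3) by blast
  qed
  have RR: "(\<Sum>q\<in>R. l q * trace_mean (V - {q})) =
     ((\<Sum>q\<in>R. l q * trace_mean (insert m (V - {b}) - {q})) + (\<Sum>q\<in>R. l q * trace_mean (insert m (V - {a}) - {q}))) / 2"
    unfolding sum.distrib[symmetric] sum_divide_distrib by (rule sum.cong) (auto simp: sR algebra_simps add_divide_distrib)
  have W1: "(\<Sum>q\<in>insert m (V - {b}). l1 q * trace_mean (insert m (V - {b}) - {q}))
     = 2 * l b * trace_mean (V - {b}) + (l a - l b) * trace_mean (insert m R) + (\<Sum>q\<in>R. l q * trace_mean (insert m (V - {b}) - {q}))"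
    using w1[of "\<lambda>q. trace_mean (insert m (V - {b}) - {q})"] e1 by simp
  have W2: "(\<Sum>q\<in>insert m (V - {a}). l2 q * trace_mean (insert m (V - {a}) - {q}))
     = 2 * l a * trace_mean (V - {a}) + (l b - l a) * trace_mean (insert m R) + (\<Sum>q\<in>R. l q * trace_mean (insert m (V - {a}) - {q}))"
    using w2[of "\<lambda>q. trace_mean (insert m (V - {a}) - {q})"] e1 by simp
  have W0: "(\<Sum>q\<in>V. l q * trace_mean (V - {q})) = l a * trace_mean (V - {a}) + l b * trace_mean (V - {b}) + (\<Sum>q\<in>R. l q * trace_mean (V - {q}))"
    using w0[of "\<lambda>q. trace_mean (V - {q})"] by simp
  have spu: "integral (sconv S) (pw u) = integral (sconv ?S1) (pw u) + integral (sconv ?S2) (pw u)"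
    by (rule sp[OF cu])
  \<comment> \<open>\<open>f\<close> is the mean over the side common to the children. It enters
    with weights \<open>la - lb\<close> and \<open>lb - la\<close> and equal volumes, hence cancels;
    this is where the vanishing mean of the jump is used.\<close>
  have ar: "(i1 + i2) + N * (j1 + j2) = N * w * (la * sa + lb * sb + (r1 + r2) / 2)"
    if "i1 + N * j1 = N * (w / 2) * (2 * lb * sb + (la - lb) * f + r1)"
      "i2 + N * j2 = N * (w / 2) * (2 * la * sa + (lb - la) * f + r2)"
    for i1 i2 j1 j2 N w la lb sa sb f r1 r2 :: real
  proof -
    have "(i1 + i2) + N * (j1 + j2) = (i1 + N * j1) + (i2 + N * j2)" by (simp add: algebra_simps)
    also have "\<dots> = N * w * (la * sa + lb * sb + (r1 + r2) / 2)" unfolding that by (simp add: field_simps)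
    finally show ?thesis .
  qed
  show ?case
    unfolding sp[OF c] spu V_def[symmetric] W0 RR
    by (rule ar[OF I1[unfolded W1] I2[unfolded W2]])
qed

end

section \<open>Variance estimates\<close>

lemma sconv_bounded: "bounded (sconv S)"
  by (simp add: sconv_def verts_def compact_imp_bounded finite_imp_compact_convex_hull)

lemma verts_dist_le_diameter:
  assumes "q \<in> verts S" "r \<in> verts S" shows "norm (q - r) \<le> diameter (sconv S)"
proof -
  have "bounded (sconv S)" by (rule sconv_bounded)
  then show ?thesis
    using diameter_bounded_bound[of "sconv S" q r] assms by (auto simp: sconv_def dist_norm hull_inc)
qed

text \<open>Relative to \<open>a\<close>, the vertex \<open>a\<close> contributes nothing, the
  midpoint at most h/2 and the other n-1 vertices at most h each. This gives 1/4 + (n-1) + (n -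
  1/2)^2 = n^2 - 1/2.\<close>

lemma half_simplex_moment_bound:
  fixes V :: "(real^'n) set"
  assumes V: "nsimplex V" and ab: "a \<in> V" "b \<in> V" "a \<noteq> b"
    and h: "\<And>q. q \<in> V \<Longrightarrow> norm (q - a) \<le> h"
  shows "(\<Sum>q\<in>insert (midpt a b) (V - {b}). (norm (q - a))\<^sup>2) + (norm (\<Sum>q\<in>insert (midpt a b) (V - {b}). q - a))\<^sup>2
    \<le> ((real CARD('n))\<^sup>2 - 1/2) * h\<^sup>2"
proof -
  note F = nsimplexD[OF V]
  define m where "m = midpt a b"
  define R where "R = V - {a, b}"
  let ?N = "real CARD('n)"
  have m: "m \<notin> V" unfolding m_def by (rule midpt_notin[OF F(3) ab])
  have VR: "V - {b} = insert a R" using ab by (auto simp: R_def)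
  have R: "finite R" "a \<notin> R" "m \<notin> R" "m \<noteq> a" using F ab m by (auto simp: R_def)
  have cR: "real (card R) = ?N - 1" using F ab by (simp add: R_def card_Diff_subset)
  have "m - a = (1/2) *\<^sub>R (b - a)" by (simp add: m_def vec_eq_iff field_simps)
  then have "norm (m - a) = norm (b - a) / 2" by simp
  then have ma: "norm (m - a) \<le> h / 2" using h[OF ab(2)] by simp
  have hR: "norm (q - a) \<le> h" if "q \<in> R" for q using that by (intro h) (auto simp: R_def)
  have "(\<Sum>q\<in>R. (norm (q - a))\<^sup>2) \<le> (\<Sum>q\<in>R. h\<^sup>2)"
    by (intro sum_mono power_mono hR) auto
  then have s1: "(\<Sum>q\<in>R. (norm (q - a))\<^sup>2) \<le> (?N - 1) * h\<^sup>2" by (simp add: cR)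
  have m2: "(norm (m - a))\<^sup>2 \<le> (h / 2)\<^sup>2" by (intro power_mono ma) simp
  have "norm (\<Sum>q\<in>R. q - a) \<le> (\<Sum>q\<in>R. h)" by (rule sum_norm_le) (rule hR)
  then have "norm (m - a + (\<Sum>q\<in>R. q - a)) \<le> h / 2 + (?N - 1) * h"
    using ma norm_triangle_ineq[of "m - a" "\<Sum>q\<in>R. q - a"] by (simp add: cR)
  then have "(norm (m - a + (\<Sum>q\<in>R. q - a)))\<^sup>2 \<le> (h / 2 + (?N - 1) * h)\<^sup>2"
    by (intro power_mono) auto
  then have "(\<Sum>q\<in>insert m (V - {b}). (norm (q - a))\<^sup>2) + (norm (\<Sum>q\<in>insert m (V - {b}). q - a))\<^sup>2
    \<le> (h / 2)\<^sup>2 + (?N - 1) * h\<^sup>2 + (h / 2 + (?N - 1) * h)\<^sup>2"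
    unfolding VR using R m2 s1 by simp
  also have "\<dots> = (?N\<^sup>2 - 1/2) * h\<^sup>2" by (simp add: field_simps power2_eq_square)
  finally show ?thesis unfolding m_def .
qed

text \<open>No value is farther than d/2 from the midrange \<open>c\<close>, and the sum of squared
  deviations is smallest about the mean.\<close>

lemma popoviciu:
  assumes V: "finite V" "V \<noteq> {}" and d: "\<And>q r. q \<in> V \<Longrightarrow> r \<in> V \<Longrightarrow> \<bar>f q - f r\<bar> \<le> (d::real)"
  shows "(\<Sum>q\<in>V. (f q)\<^sup>2) - (\<Sum>q\<in>V. f q)\<^sup>2 / real (card V) \<le> real (card V) * (d / 2)\<^sup>2"
proof -
  define c where "c = (Max (f ` V) + Min (f ` V)) / 2"
  let ?T = "\<Sum>q\<in>V. f q" and ?n = "real (card V)"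
  have n: "?n > 0" using V by (simp add: card_gt_0_iff)
  obtain q1 q2 where q: "q1 \<in> V" "q2 \<in> V" "Max (f ` V) = f q1" "Min (f ` V) = f q2"
    using Max_in[of "f ` V"] Min_in[of "f ` V"] V by fastforce
  have "(f q - c)\<^sup>2 \<le> (d / 2)\<^sup>2" if "q \<in> V" for q
  proof -
    have "f q \<le> f q1" "f q2 \<le> f q" using q V that by (metis Max_ge finite_imageI imageI, metis Min_le finite_imageI imageI)
    moreover have "f q1 - f q2 \<le> d" using d[OF q(1,2)] by linarith
    ultimately have "\<bar>f q - c\<bar> \<le> d / 2" unfolding c_def q by (auto simp: abs_le_iff field_simps)
    then have "\<bar>f q - c\<bar>\<^sup>2 \<le> (d / 2)\<^sup>2" by (intro power_mono) auto
    then show ?thesis by simp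
  qed
  then have "(\<Sum>q\<in>V. (f q - c)\<^sup>2) \<le> ?n * (d / 2)\<^sup>2" by (intro sum_bounded_above)
  moreover have "(\<Sum>q\<in>V. (f q - c)\<^sup>2) = (\<Sum>q\<in>V. (f q)\<^sup>2) - ?T\<^sup>2 / ?n + ?n * (c - ?T / ?n)\<^sup>2"
  proof -
    have "(\<Sum>q\<in>V. (f q - c)\<^sup>2) = (\<Sum>q\<in>V. (f q)\<^sup>2 - 2 * c * f q + c\<^sup>2)"
      by (rule sum.cong) (auto simp: power2_diff)
    also have "\<dots> = (\<Sum>q\<in>V. (f q)\<^sup>2) - 2 * c * ?T + ?n * c\<^sup>2"
      by (simp add: sum.distrib sum_subtractf sum_distrib_left)
    also have "\<dots> = (\<Sum>q\<in>V. (f q)\<^sup>2) - ?T\<^sup>2 / ?n + ?n * (c - ?T / ?n)\<^sup>2"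
      using n by (simp add: power2_diff field_simps power2_eq_square)
    finally show ?thesis .
  qed
  moreover have "0 \<le> ?n * (c - ?T / ?n)\<^sup>2" by simp
  ultimately show ?thesis by linarith
qed

section \<open>Volumes and diameters along the generations\<close>

lemma descendants_nondeg:
  assumes "nondeg_simplex K" "S \<in> descendants K l"
  shows "nondeg_simplex S" "sconv S \<subseteq> sconv K" "measure lebesgue (sconv S) = measure lebesgue (sconv K) / 2 ^ l"
proof -
  have "nondeg_simplex S \<and> sconv S \<subseteq> sconv K \<and> measure lebesgue (sconv S) = measure lebesgue (sconv K) / 2 ^ l"
    using assms(2)
  proof (induction l arbitrary: S)
    case (Suc l)
    then obtain X where X: "X \<in> descendants K l" "S = fst (bisect X) \<or> S = snd (bisect X)"
      by (auto simp: children_def)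
    have IH: "nondeg_simplex X" "sconv X \<subseteq> sconv K" "measure lebesgue (sconv X) = measure lebesgue (sconv K) / 2 ^ l"
      using Suc.IH[OF X(1)] by auto
    show ?case using X(2) nondeg_bisect[OF IH(1)] sconv_bisect[OF IH(1)] IH by auto
  qed (use assms(1) in auto)
  then show "nondeg_simplex S" "sconv S \<subseteq> sconv K" "measure lebesgue (sconv S) = measure lebesgue (sconv K) / 2 ^ l"
    by auto
qed

lemma descendants_add:
  "S \<in> descendants K (i + j) \<Longrightarrow> \<exists>X\<in>descendants K i. S \<in> descendants X j"
proof (induction j arbitrary: S)
  case (Suc j)
  then obtain Y where "Y \<in> descendants K (i + j)" "S \<in> children Y" by auto
  then show ?case using Suc.IH by fastforce
qed auto

lemma descendants_nonempty: "descendants K l \<noteq> {}"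
  by (induction l) (auto simp: children_def)

text \<open>Blocks of \<open>M\<close> generations are split off at the fine end, each halving the
  diameter; an incomplete block merely does not increase it.\<close>

lemma descendants_diameter:
  assumes K: "nondeg_simplex K" and M: "M > 0"
    and half: "\<And>k S S'. S \<in> descendants K k \<Longrightarrow> S' \<in> descendants S M \<Longrightarrow> diameter (sconv S') \<le> diameter (sconv S) / 2"
    and S: "S \<in> descendants K l"
  shows "diameter (sconv S) \<le> diameter (sconv K) * (1/2) ^ (l div M)"
  using S
proof (induction l arbitrary: S rule: less_induct)
  case (less l)
  show ?case
  proof (cases "l < M")
    case True
    have "bounded (sconv K)" by (rule sconv_bounded)
    then have "diameter (sconv S) \<le> diameter (sconv K)"
      by (rule diameter_subset[OF descendants_nondeg(2)[OF K less.prems]])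
    then show ?thesis using True by simp
  next
    case False
    then have l: "l = (l - M) + M" by simp
    obtain X where X: "X \<in> descendants K (l - M)" "S \<in> descendants X M"
      using descendants_add[of S K "l - M" M] less.prems l by auto
    have "diameter (sconv S) \<le> diameter (sconv X) / 2" by (rule half[OF X])
    also have "\<dots> \<le> diameter (sconv K) * (1/2) ^ ((l - M) div M) / 2"
      using less.IH[OF _ X(1)] M False by simp
    also have "\<dots> = diameter (sconv K) * (1/2) ^ (l div M)"
      using M False by (simp add: le_div_geq)
    finally show ?thesis .
  qed
qed

text \<open>A crude bound by a cube: only the exponent matters, since it is applied to ever finer
  generations.\<close>

lemma measure_le_diameter_power:
  fixes A :: "(real^'n) set"
  assumes "A \<in> lmeasurable" "bounded A" "x \<in> A"
  shows "measure lebesgue A \<le> (2 * diameter A) ^ CARD('n)"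
proof -
  let ?d = "diameter A" and ?b = "\<chi> i. diameter A"
  have d: "0 \<le> ?d" using assms by (simp add: diameter_ge_0)
  have "A \<subseteq> cbox (x - ?b) (x + ?b)"
  proof
    fix y assume "y \<in> A"
    then have "norm (y - x) \<le> ?d" using diameter_bounded_bound[OF assms(2) _ assms(3), of y] by (simp add: dist_norm)
    then have "\<bar>(y - x) $ i\<bar> \<le> ?d" for i using component_le_norm_cart[of "y - x" i] by linarith
    then show "y \<in> cbox (x - ?b) (x + ?b)"
      by (auto simp: mem_box_cart abs_le_iff field_simps)
  qed
  then have "measure lebesgue A \<le> measure lebesgue (cbox (x - ?b) (x + ?b))"
    by (intro measure_mono_fmeasurable fmeasurableD assms) auto
  also have "\<dots> = (\<Prod>i\<in>(UNIV::'n set). 2 * ?d)"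
  proof -
    have "cbox (x - ?b) (x + ?b) \<noteq> {}" using d by (auto simp: interval_ne_empty_cart)
    then have "measure lborel (cbox (x - ?b) (x + ?b)) = (\<Prod>i\<in>(UNIV::'n set). 2 * ?d)"
      by (subst content_cbox_cart) auto
    then show ?thesis by simp
  qed
  finally show ?thesis by simp
qed

text \<open>After M j generations the volume has shrunk exactly by 2^(M j), while the diameter,
  divided by 2^j, forces a shrinking by at least 2^(n j) up to a constant. For n > M this fails for
  large j.\<close>

lemma halving_number_ge_dimension:
  fixes K :: "'n::finite tsimplex"
  assumes K: "nondeg_simplex K" and M: "M > 0"
    and half: "\<And>k S S'. S \<in> descendants K k \<Longrightarrow> S' \<in> descendants S M \<Longrightarrow> diameter (sconv S') \<le> diameter (sconv S) / 2"
  shows "CARD('n) \<le> M"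
proof (rule ccontr)
  assume "\<not> CARD('n) \<le> M"
  then have lt: "Suc M \<le> CARD('n)" by simp
  let ?v = "measure lebesgue (sconv K)" and ?C = "(2 * diameter (sconv K)) ^ CARD('n)"
  have v: "0 < ?v" unfolding sconv_def by (rule nsimplex_measure_pos[OF nondeg_nsimplex[OF K]])
  have "?v * 2 ^ j \<le> ?C" for j
  proof -
    obtain S where S: "S \<in> descendants K (M * j)" using descendants_nonempty by blast
    note D = descendants_nondeg[OF K S]
    note VS = nondeg_nsimplex[OF D(1)]
    obtain x where x: "x \<in> verts S" using nsimplexD[OF VS] by fastforce
    have b: "bounded (sconv S)" by (rule sconv_bounded)
    have d0: "0 \<le> diameter (sconv S)" using b by (rule diameter_ge_0)
    have "?v / 2 ^ (M * j) \<le> (2 * diameter (sconv S)) ^ CARD('n)"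
      unfolding D(3)[symmetric]
      by (rule measure_le_diameter_power[OF _ b, of x])
        (use x nsimplex_lmeasurable[OF VS] in \<open>auto simp: sconv_def hull_inc\<close>)
    also have "\<dots> \<le> (2 * (diameter (sconv K) * (1/2) ^ j)) ^ CARD('n)"
      using descendants_diameter[OF K M half S] M d0 by (intro power_mono) auto
    also have "\<dots> = ?C / 2 ^ (CARD('n) * j)"
      by (simp add: power_mult_distrib power_divide power_mult[symmetric] mult.commute mult.assoc)
    finally have 1: "?v * 2 ^ (CARD('n) * j) \<le> ?C * 2 ^ (M * j)" by (simp add: field_simps)
    have "j + M * j \<le> CARD('n) * j" using mult_le_mono1[OF lt, of j] by simp
    then have "?v * 2 ^ (j + M * j) \<le> ?v * 2 ^ (CARD('n) * j)" using v by (intro mult_left_mono power_increasing) auto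
    then have "?v * 2 ^ (j + M * j) \<le> ?C * 2 ^ (M * j)" using 1 by (rule order_trans)
    then have "(?v * 2 ^ j) * 2 ^ (M * j) \<le> ?C * 2 ^ (M * j)" by (simp only: power_add mult.assoc)
    then show ?thesis by (rule mult_right_le_imp_le) simp
  qed
  moreover obtain j where "?C / ?v < 2 ^ j" using real_arch_pow[of 2 "?C / ?v"] by auto
  ultimately show False using v by (metis divide_less_eq mult.commute not_le)
qed

context cr_refinement
begin

abbreviation "energy S \<equiv> integral (sconv S) (pw (\<lambda>S x. (norm (g S))\<^sup>2))"

text \<open>The squared L2 norm over \<open>S\<close> of \<open>u\<close> minus its mean, without
  division by the volume.\<close>

definition "variance S = integral (sconv S) (pw (\<lambda>S x. (u S x)\<^sup>2)) - (integral (sconv S) (pw u))\<^sup>2 / measure lebesgue (sconv S)"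

lemma energy_nonneg: "0 \<le> energy S"
proof (cases "pw (\<lambda>S x. (norm (g S))\<^sup>2) integrable_on sconv S")
  case True
  then show ?thesis by (rule integral_nonneg) (simp add: pw_def)
qed (simp add: not_integrable_integral)

lemma u_cont: "S \<in> Th \<Longrightarrow> continuous_on UNIV (u S)"
  by (rule affine_fun_continuous[OF u_affine])

text \<open>This is the expanded integral of the squared norm of
  \<open>x - p + t *\<^sub>R g\<close>, with \<open>g\<close> taken on the element at x.\<close>

lemma cauchy_schwarz_quadratic:
  assumes S: "bisection_tree Th S" "nondeg_simplex S" "sconv S \<subseteq> sconv K"
  shows "0 \<le> integral (sconv S) (\<lambda>x. (norm (x - p))\<^sup>2) + 2 * t * integral (sconv S) (pw (\<lambda>S x. (x - p) \<bullet> g S)) + t\<^sup>2 * energy S"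
proof -
  have i1: "(\<lambda>x. (norm (x - p))\<^sup>2) integrable_on sconv S"
    using has_integral_norm_square[OF nondeg_nsimplex[OF S(2)], of p] by (auto simp: sconv_def integrable_on_def)
  have i2: "pw (\<lambda>S x. (x - p) \<bullet> g S) integrable_on sconv S"
    by (rule pw_integrable[OF S]) (intro continuous_intros)
  have i3: "pw (\<lambda>S x. (norm (g S))\<^sup>2) integrable_on sconv S"
    by (rule pw_integrable[OF S]) (intro continuous_intros)
  note i = integrable_add[OF i1 integrable_on_mult_right[OF i2, of "2 * t"]] integrable_on_mult_right[OF i3, of "t\<^sup>2"]
  have "integral (sconv S) (\<lambda>x. (norm (x - p))\<^sup>2) + 2 * t * integral (sconv S) (pw (\<lambda>S x. (x - p) \<bullet> g S)) + t\<^sup>2 * energy S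
    = integral (sconv S) (\<lambda>x. (norm (x - p))\<^sup>2 + 2 * t * pw (\<lambda>S x. (x - p) \<bullet> g S) x + t\<^sup>2 * pw (\<lambda>S x. (norm (g S))\<^sup>2) x)"
    unfolding integral_add[OF i] integral_add[OF i1 integrable_on_mult_right[OF i2, of "2 * t"]] by simp
  also have "\<dots> = integral (sconv S) (\<lambda>x. (norm (x - p + t *\<^sub>R g (elem_at x)))\<^sup>2)"
  proof (rule arg_cong[of _ _ "integral _"], rule ext)
    fix x
    have *: "(norm (y + t *\<^sub>R z))\<^sup>2 = (norm y)\<^sup>2 + 2 * t * (y \<bullet> z) + t\<^sup>2 * (norm z)\<^sup>2" for y z :: "real^'n"
      unfolding power2_norm_eq_inner
      by (simp add: inner_add_left inner_add_right inner_commute[of z y] power2_eq_square algebra_simps)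
    show "(norm (x - p))\<^sup>2 + 2 * t * pw (\<lambda>S x. (x - p) \<bullet> g S) x + t\<^sup>2 * pw (\<lambda>S x. (norm (g S))\<^sup>2) x
      = (norm (x - p + t *\<^sub>R g (elem_at x)))\<^sup>2" by (simp only: pw_def *)
  qed
  also have "0 \<le> \<dots>"
  proof (rule integral_nonneg)
    show "(\<lambda>x. (norm (x - p + t *\<^sub>R g (elem_at x)))\<^sup>2) integrable_on sconv S"
    proof -
      have "pw (\<lambda>S x. (norm (x - p + t *\<^sub>R g S))\<^sup>2) integrable_on sconv S"
        by (rule pw_integrable[OF S]) (intro continuous_intros)
      then show ?thesis by (simp add: pw_def[abs_def])
    qed
  qed simp
  finally show ?thesis by simp
qed

text \<open>For an affine function the moment formulas turn the variance into the variance of its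
  vertex values. These differ by at most gradient times diameter, so Popoviciu's inequality supplies
  the factor 1/4.\<close>

lemma variance_leaf:
  assumes S: "S \<in> Th" "sconv S \<subseteq> sconv K"
  shows "variance S \<le> (diameter (sconv S))\<^sup>2 / (4 * (real CARD('n) + 2)) * energy S"
proof -
  note nd = Th_nondeg[OF S(1)]
  note V = nondeg_nsimplex[OF nd]
  note F = nsimplexD[OF V]
  let ?N = "real CARD('n)" and ?v = "measure lebesgue (sconv S)" and ?h = "diameter (sconv S)"
  let ?T = "\<Sum>q\<in>verts S. u S q" and ?Q = "\<Sum>q\<in>verts S. (u S q)\<^sup>2"
  have v: "0 < ?v" unfolding sconv_def by (rule nsimplex_measure_pos[OF V])
  have i1: "integral (sconv S) (pw u) = ?v / (?N + 1) * ?T"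
    unfolding sconv_def
    by (intro integral_unique pw_leaf[OF S, unfolded sconv_def] has_integral_affine_fun[OF V] u_affine S)
  have i2: "integral (sconv S) (pw (\<lambda>S x. (u S x)\<^sup>2)) = ?v / ((?N + 1) * (?N + 2)) * (?Q + ?T\<^sup>2)"
    unfolding sconv_def
    by (intro integral_unique pw_leaf[OF S, unfolded sconv_def] has_integral_affine_fun_square[OF V] u_affine S)
  have "((\<lambda>x. (norm (g S))\<^sup>2) has_integral ?v / (?N + 1) * (\<Sum>q\<in>verts S. (norm (g S))\<^sup>2)) (sconv S)"
    unfolding sconv_def by (rule has_integral_affine_fun[OF V affine_fun_const])
  from integral_unique[OF pw_leaf[where \<psi> = "\<lambda>S x. (norm (g S))\<^sup>2", OF S this]]
  have "energy S = ?v / (?N + 1) * ((?N + 1) * (norm (g S))\<^sup>2)" using F by (simp add: add.commute)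
  moreover have "?N + 1 \<noteq> 0" using of_nat_0_le_iff[of "CARD('n)"] by linarith
  ultimately have i3: "energy S = ?v * (norm (g S))\<^sup>2" by simp
  have "\<bar>u S q - u S r\<bar> \<le> norm (g S) * ?h" if "q \<in> verts S" "r \<in> verts S" for q r
  proof -
    have "u S q - u S r = g S \<bullet> (q - r)" by (simp add: u_eq[OF S(1)] inner_diff_right)
    then have "\<bar>u S q - u S r\<bar> \<le> norm (g S) * norm (q - r)" by (simp add: Cauchy_Schwarz_ineq2)
    also have "\<dots> \<le> norm (g S) * ?h" by (intro mult_left_mono verts_dist_le_diameter that) simp
    finally show ?thesis .
  qed
  moreover have "verts S \<noteq> {}" "real (card (verts S)) = ?N + 1" using F by auto
  ultimately have pop: "?Q - ?T\<^sup>2 / (?N + 1) \<le> (?N + 1) * (norm (g S) * ?h / 2)\<^sup>2"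
    using popoviciu[OF F(1), of "u S" "norm (g S) * ?h"] by simp
  define N where "N = ?N"
  have N: "N + 1 > 0" "N + 2 > 0" by (simp_all add: N_def add_nonneg_pos)
  have "variance S = ?v / ((N + 1) * (N + 2)) * (?Q - ?T\<^sup>2 / (N + 1))"
  proof -
    have "v1 / ((N + 1) * (N + 2)) * (Q + T\<^sup>2) - (v1 / (N + 1) * T)\<^sup>2 / v1 = v1 / ((N + 1) * (N + 2)) * (Q - T\<^sup>2 / (N + 1))"
      if "v1 > 0" for v1 Q T :: real
    proof -
      have k: "1 / ((N + 1) * (N + 2)) - 1 / (N + 1)\<^sup>2 = - 1 / ((N + 1) * (N + 2) * (N + 1))"
        using N by (simp add: divide_simps) (simp add: algebra_simps power2_eq_square)
      have "(v1 / (N + 1) * T)\<^sup>2 / v1 = v1 * T\<^sup>2 * (1 / (N + 1)\<^sup>2)"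
        using that by (simp add: power_mult_distrib power_divide power2_eq_square)
      then have "v1 / ((N + 1) * (N + 2)) * (Q + T\<^sup>2) - (v1 / (N + 1) * T)\<^sup>2 / v1
        = v1 / ((N + 1) * (N + 2)) * Q + v1 * T\<^sup>2 * (1 / ((N + 1) * (N + 2)) - 1 / (N + 1)\<^sup>2)"
        by (simp only: right_diff_distrib distrib_left) simp
      also have "\<dots> = v1 / ((N + 1) * (N + 2)) * (Q - T\<^sup>2 / (N + 1))"
        unfolding k by (simp only: right_diff_distrib) simp
      finally show ?thesis .
    qed
    from this[OF v] show ?thesis unfolding variance_def i1 i2 N_def .
  qed
  also have "\<dots> \<le> ?v / ((N + 1) * (N + 2)) * ((N + 1) * (norm (g S) * ?h / 2)\<^sup>2)"
    using pop v N by (intro mult_left_mono) (auto simp: N_def)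
  also have "\<dots> = ?h\<^sup>2 / (4 * (N + 2)) * (?v * (norm (g S))\<^sup>2)"
    using N by (simp add: divide_simps power2_eq_square)
  finally show ?thesis unfolding i3 N_def .
qed

text \<open>Joining two halves of equal volume v/2 with integrals \<open>I1\<close> and
  \<open>I2\<close> raises the variance by exactly \<open>(I1 - I2)\<^sup>2\<close> / v; the Green
  identity expresses this difference through the gradient alone.\<close>

lemma variance_node:
  assumes t: "bisection_tree Th (fst (bisect S))" "bisection_tree Th (snd (bisect S))"
    and nd: "nondeg_simplex S" and sub: "sconv S \<subseteq> sconv K"
  shows "variance S \<le> variance (fst (bisect S)) + variance (snd (bisect S)) +
     ((real CARD('n))\<^sup>2 - 1/2) / ((real CARD('n))\<^sup>2 * (real CARD('n) + 1) * (real CARD('n) + 2)) * (diameter (sconv S))\<^sup>2 * energy S"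
proof -
  obtain a b where ab: "a \<in> verts S" "b \<in> verts S" "a \<noteq> b"
    and v: "verts (fst (bisect S)) = insert (midpt a b) (verts S - {b})"
    "verts (snd (bisect S)) = insert (midpt a b) (verts S - {a})"
    and nd12: "nondeg_simplex (fst (bisect S))" "nondeg_simplex (snd (bisect S))"
    using bisect_nondeg[OF nd] by metis
  define S1 where "S1 = fst (bisect S)"
  define S2 where "S2 = snd (bisect S)"
  note sp = pw_split[OF t nd sub, folded S1_def S2_def]
  note t = t[folded S1_def S2_def] note v = v[folded S1_def S2_def] note nd12 = nd12[folded S1_def S2_def]
  have V: "nsimplex (verts S)" by (rule nondeg_nsimplex[OF nd])
  note F = nsimplexD[OF V]
  have m: "midpt a b \<notin> verts S" by (rule midpt_notin[OF F(3) ab])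
  note H = sconv_bisect[OF nd, folded S1_def S2_def]
  have sub12: "sconv S1 \<subseteq> sconv K" "sconv S2 \<subseteq> sconv K" using sub H(1) by auto
  let ?v = "measure lebesgue (sconv S)" and ?h = "diameter (sconv S)"
  define N where "N = real CARD('n)"
  have N: "N > 0" by (simp add: N_def)
  have vpos: "0 < ?v" unfolding sconv_def by (rule nsimplex_measure_pos[OF V])
  define I1 I2 where "I1 = integral (sconv S1) (pw u)" and "I2 = integral (sconv S2) (pw u)"
  define B1 B2 where "B1 = integral (sconv S1) (pw (\<lambda>S x. (x - a) \<bullet> g S))" and "B2 = integral (sconv S2) (pw (\<lambda>S x. (x - b) \<bullet> g S))"
  define A1 A2 where "A1 = integral (sconv S1) (\<lambda>x. (norm (x - a))\<^sup>2)" and "A2 = integral (sconv S2) (\<lambda>x. (norm (x - b))\<^sup>2)"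
  \<comment> \<open>This is the common side of the children; the weights concentrated at
    \<open>a\<close> and at \<open>b\<close> leave only its mean.\<close>
  have e: "verts S1 - {a} = verts S2 - {b}" unfolding v using ab m by auto
  have dl: "sum (\<lambda>q. if q = c then 1 else 0) (verts X) = (1::real)"
    "(\<Sum>q\<in>verts X. (if q = c then 1 else 0) *\<^sub>R q) = c"
    "(\<Sum>q\<in>verts X. (if q = c then 1 else 0) * trace_mean (verts X - {q})) = trace_mean (verts X - {c})"
    if "nondeg_simplex X" "c \<in> verts X" for X c
    using nsimplexD(1)[OF nondeg_nsimplex[OF that(1)]] that(2)
    by (simp_all add: if_distrib[of "\<lambda>x. x *\<^sub>R _"] if_distrib[of "\<lambda>x. x * _"] cong: if_cong)
  have aS: "a \<in> verts S1" "b \<in> verts S2" using ab by (auto simp: v)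
  have G1: "B1 + N * I1 = N * (?v / 2) * trace_mean (verts S1 - {a})"
    using green_identity[OF t(1) nd12(1) sub12(1) dl(1)[OF nd12(1) aS(1)] dl(2)[OF nd12(1) aS(1), symmetric]]
    unfolding dl(3)[OF nd12(1) aS(1)] B1_def I1_def N_def H(3) .
  have G2: "B2 + N * I2 = N * (?v / 2) * trace_mean (verts S2 - {b})"
    using green_identity[OF t(2) nd12(2) sub12(2) dl(1)[OF nd12(2) aS(2)] dl(2)[OF nd12(2) aS(2), symmetric]]
    unfolding dl(3)[OF nd12(2) aS(2)] B2_def I2_def N_def H(4) .
  have "N * (I1 - I2) = B2 - B1" using G1 G2 e by (simp add: algebra_simps)
  then have dI: "I1 - I2 = (B2 - B1) / N" using N by (simp add: field_simps)
  have en: "energy S = energy S1 + energy S2" by (rule sp) (intro continuous_intros)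
  have cs: "(B2 - B1)\<^sup>2 \<le> (A1 + A2) * energy S"
  proof (rule quadratic_nonneg_discriminant)
    fix s
    \<comment> \<open>The opposite sign of the parameter on the first child produces the difference
      \<open>B2 - B1\<close> in the sum.\<close>
    have "0 \<le> A1 + 2 * (- s) * B1 + (- s)\<^sup>2 * energy S1"
      unfolding A1_def B1_def by (rule cauchy_schwarz_quadratic[OF t(1) nd12(1) sub12(1)])
    moreover have "0 \<le> A2 + 2 * s * B2 + s\<^sup>2 * energy S2"
      unfolding A2_def B2_def by (rule cauchy_schwarz_quadratic[OF t(2) nd12(2) sub12(2)])
    ultimately show "0 \<le> A1 + A2 + 2 * s * (B2 - B1) + s\<^sup>2 * energy S"
      unfolding en by (simp add: algebra_simps)
  qed
  define k0 where "k0 = (N\<^sup>2 - 1/2) * ?h\<^sup>2"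
  have A: "A1 \<le> ?v / 2 / ((N + 1) * (N + 2)) * k0" "A2 \<le> ?v / 2 / ((N + 1) * (N + 2)) * k0"
  proof -
    have "A1 = ?v / 2 / ((N + 1) * (N + 2)) * ((\<Sum>q\<in>verts S1. (norm (q - a))\<^sup>2) + (norm (\<Sum>q\<in>verts S1. q - a))\<^sup>2)"
      using integral_unique[OF has_integral_norm_square[OF nondeg_nsimplex[OF nd12(1)], of a]]
      unfolding A1_def N_def sconv_def[symmetric] H(3) .
    also have "\<dots> \<le> ?v / 2 / ((N + 1) * (N + 2)) * k0"
      unfolding v k0_def N_def
      by (intro mult_left_mono half_simplex_moment_bound[OF V ab] verts_dist_le_diameter ab) auto
    finally show "A1 \<le> ?v / 2 / ((N + 1) * (N + 2)) * k0" .
    have "A2 = ?v / 2 / ((N + 1) * (N + 2)) * ((\<Sum>q\<in>verts S2. (norm (q - b))\<^sup>2) + (norm (\<Sum>q\<in>verts S2. q - b))\<^sup>2)"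
      using integral_unique[OF has_integral_norm_square[OF nondeg_nsimplex[OF nd12(2)], of b]]
      unfolding A2_def N_def sconv_def[symmetric] H(4) .
    also have "\<dots> \<le> ?v / 2 / ((N + 1) * (N + 2)) * k0"
      unfolding v k0_def N_def add.commute[of a b]
      by (intro mult_left_mono half_simplex_moment_bound[OF V ab(2,1) ab(3)[symmetric]] verts_dist_le_diameter ab) auto
    finally show "A2 \<le> ?v / 2 / ((N + 1) * (N + 2)) * k0" .
  qed
  have "variance S - variance S1 - variance S2 = (I1 - I2)\<^sup>2 / ?v"
  proof -
    have q: "integral (sconv S) (pw (\<lambda>S x. (u S x)\<^sup>2)) = integral (sconv S1) (pw (\<lambda>S x. (u S x)\<^sup>2)) + integral (sconv S2) (pw (\<lambda>S x. (u S x)\<^sup>2))"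
      by (rule sp) (intro continuous_intros u_cont)
    have i: "integral (sconv S) (pw u) = I1 + I2" unfolding I1_def I2_def by (rule sp) (rule u_cont)
    show ?thesis unfolding variance_def q i H(3,4) I1_def[symmetric] I2_def[symmetric]
      using vpos by (simp add: divide_simps power2_eq_square) (simp add: algebra_simps)
  qed
  also have "\<dots> = (B2 - B1)\<^sup>2 / (N\<^sup>2 * ?v)" unfolding dI by (simp add: power_divide)
  also have "\<dots> \<le> ((A1 + A2) * energy S) / (N\<^sup>2 * ?v)" using cs vpos by (intro divide_right_mono) auto
  also have "\<dots> \<le> ((?v / ((N + 1) * (N + 2)) * k0) * energy S) / (N\<^sup>2 * ?v)"
  proof -
    have "A1 + A2 \<le> 2 * (?v / 2 / ((N + 1) * (N + 2)) * k0)" using A by linarith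
    also have "\<dots> = ?v / ((N + 1) * (N + 2)) * k0" by simp
    finally show ?thesis using vpos energy_nonneg[of S] by (intro divide_right_mono mult_right_mono) auto
  qed
  also have "\<dots> = (N\<^sup>2 - 1/2) / (N\<^sup>2 * (N + 1) * (N + 2)) * ?h\<^sup>2 * energy S"
    unfolding k0_def using N vpos by (simp add: divide_simps)
  finally show ?thesis unfolding N_def S1_def S2_def by linarith
qed

end

section \<open>Summation over the generations and side means on the boundary of
  \<open>K\<close>\<close>

context cr_refinement
begin

text \<open>With \<open>l = q M + r\<close>, the factor is \<open>c\<^sub>0 H\<^sup>2\<close> times the tail \<open>\<Sum>j\<ge>l. 4 powr -(j div M)\<close> of the geometric
  bound on the squared diameters in generation \<open>j\<close>.\<close>

lemma variance_tree:
  assumes "bisection_tree Th S" "nondeg_simplex S" "sconv S \<subseteq> sconv K" "S \<in> descendants K l"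
    and diam: "\<And>S l. S \<in> descendants K l \<Longrightarrow> diameter (sconv S) \<le> H * (1/2) ^ (l div M)"
    and MN: "2 \<le> CARD('n)" "CARD('n) \<le> M"
    and c0: "c0 = ((real CARD('n))\<^sup>2 - 1/2) / ((real CARD('n))\<^sup>2 * (real CARD('n) + 1) * (real CARD('n) + 2))"
  shows "variance S \<le> c0 * H\<^sup>2 * (1/4) ^ (l div M) * (real M - real (l mod M) + real M / 3) * energy S"
  using assms(1-4)
proof (induction arbitrary: l rule: bisection_tree.induct)
  case (leaf S)
  define N where "N = real CARD('n)"
  have N: "2 \<le> N" "N \<le> real M" using MN by (simp_all add: N_def)
  let ?q = "l div M" and ?r = "l mod M"
  have M: "M > 0" using MN by simp
  have "Suc ?r \<le> M" using M by (simp add: Suc_leI)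
  then have r: "1 \<le> real M - real ?r" by linarith
  have sq: "(diameter (sconv S))\<^sup>2 \<le> H\<^sup>2 * (1/4) ^ ?q"
  proof -
    have "(diameter (sconv S))\<^sup>2 \<le> (H * (1/2) ^ ?q)\<^sup>2"
      by (intro power_mono diam leaf diameter_ge_0 sconv_bounded)
    also have "\<dots> = H\<^sup>2 * (1/4) ^ ?q"
      by (simp add: power_mult_distrib power2_eq_square flip: power_mult_distrib)
    finally show ?thesis .
  qed
  \<comment> \<open>A leaf may occur in any generation, so its own constant must fit into what
    remains of the geometric sum. The remainder is least at the end of a block, where it is 1 + M/3
    and hence at least 1 + n/3.\<close>
  have key: "1 / (4 * (N + 2)) \<le> c0 * (real M - real ?r + real M / 3)"
  proof -
    have c0pos: "0 \<le> c0"
    proof -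
      have "2\<^sup>2 \<le> N\<^sup>2" using N by (intro power_mono) auto
      then show ?thesis unfolding c0 N_def[symmetric] using N by (intro divide_nonneg_nonneg) auto
    qed
    have "1 / (4 * (N + 2)) \<le> c0 * (1 + N / 3)"
    proof -
      have "N\<^sup>2 * (N + 1) \<le> 4 * ((N\<^sup>2 - 1/2) * (1 + N / 3))"
      proof -
        have "4 * ((N\<^sup>2 - 1/2) * (1 + N / 3)) - N\<^sup>2 * (N + 1) = N * (N * N - 2) / 3 + (3 * (N * N) - 2)"
          by (simp add: field_simps power2_eq_square)
        moreover have "2 * 2 \<le> N * N" using N by (intro mult_mono) auto
        then have "0 \<le> N * (N * N - 2) / 3 + (3 * (N * N) - 2)" using N by (intro add_nonneg_nonneg divide_nonneg_nonneg mult_nonneg_nonneg) auto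
        ultimately show ?thesis by linarith
      qed
      then have le: "N\<^sup>2 * (N + 1) \<le> 4 * ((N\<^sup>2 - 1/2) * (1 + N / 3))" .
      have gen: "1 / (4 * c) \<le> Y / (X * c)" if "X \<le> 4 * Y" "0 < X" "0 < c" for X Y c :: real
        using that by (simp add: field_simps)
      have "1 / (4 * (N + 2)) \<le> ((N\<^sup>2 - 1/2) * (1 + N / 3)) / (N\<^sup>2 * (N + 1) * (N + 2))"
        by (rule gen[OF le]) (use N in auto)
      then show ?thesis unfolding c0 N_def[symmetric] by (simp only: times_divide_eq_left)
    qed
    also have "\<dots> \<le> c0 * (real M - real ?r + real M / 3)"
      using N r c0pos by (intro mult_left_mono) auto
    finally show ?thesis .
  qed
  have "variance S \<le> (diameter (sconv S))\<^sup>2 / (4 * (N + 2)) * energy S"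
    unfolding N_def by (rule variance_leaf[OF leaf(1,3)])
  also have "\<dots> \<le> (H\<^sup>2 * (1/4) ^ ?q) / (4 * (N + 2)) * energy S"
    using sq N energy_nonneg by (intro mult_right_mono divide_right_mono) auto
  also have "\<dots> = (H\<^sup>2 * (1/4) ^ ?q) * (1 / (4 * (N + 2))) * energy S" by simp
  also have "\<dots> \<le> (H\<^sup>2 * (1/4) ^ ?q) * (c0 * (real M - real ?r + real M / 3)) * energy S"
    using key energy_nonneg by (intro mult_right_mono mult_left_mono) auto
  finally show ?case by (simp add: mult_ac)
next
  case (node S)
  define N where "N = real CARD('n)"
  have N: "2 \<le> N" "N \<le> real M" using MN by (simp_all add: N_def)
  have sub: "sconv (fst (bisect S)) \<subseteq> sconv K" "sconv (snd (bisect S)) \<subseteq> sconv K"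
    using node.prems(2) sconv_bisect(1)[OF node.prems(1)] by auto
  let ?R = "\<lambda>l. c0 * H\<^sup>2 * (1/4) ^ (l div M) * (real M - real (l mod M) + real M / 3)"
  have c0pos: "0 \<le> c0"
  proof -
    have "2\<^sup>2 \<le> N\<^sup>2" using N by (intro power_mono) auto
    then show ?thesis unfolding c0 N_def[symmetric] using N by (intro divide_nonneg_nonneg) auto
  qed
  have ch: "fst (bisect S) \<in> descendants K (Suc l)" "snd (bisect S) \<in> descendants K (Suc l)"
    using node.prems(3) by (auto simp: children_def)
  have i1: "variance (fst (bisect S)) \<le> ?R (Suc l) * energy (fst (bisect S))"
    by (rule node.IH(1)[OF nondeg_bisect(1)[OF node.prems(1)] sub(1) ch(1)])
  have i2: "variance (snd (bisect S)) \<le> ?R (Suc l) * energy (snd (bisect S))"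
    by (rule node.IH(2)[OF nondeg_bisect(2)[OF node.prems(1)] sub(2) ch(2)])
  have en: "energy S = energy (fst (bisect S)) + energy (snd (bisect S))"
    by (rule pw_split[OF node.hyps node.prems(1,2)]) (intro continuous_intros)
  have sq: "(diameter (sconv S))\<^sup>2 \<le> H\<^sup>2 * (1/4) ^ (l div M)"
  proof -
    have "(diameter (sconv S))\<^sup>2 \<le> (H * (1/2) ^ (l div M))\<^sup>2"
      by (intro power_mono diam node.prems diameter_ge_0 sconv_bounded)
    also have "\<dots> = H\<^sup>2 * (1/4) ^ (l div M)"
      by (simp add: power_mult_distrib power2_eq_square flip: power_mult_distrib)
    finally show ?thesis .
  qed
  \<comment> \<open>One generation removes one summand. At the end of a block the new remainder 4M/3
    carries an extra factor 1/4, leaving the M/3 of the old one.\<close>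
  have step: "?R l = c0 * H\<^sup>2 * (1/4) ^ (l div M) + ?R (Suc l)"
  proof (cases "Suc (l mod M) = M")
    case True
    then have "Suc l mod M = 0" "Suc l div M = Suc (l div M)" by (simp_all add: mod_Suc div_Suc)
    moreover have "real M = real (l mod M) + 1" using True by linarith
    ultimately show ?thesis by (simp add: algebra_simps)
  next
    case False
    then have "Suc l mod M = Suc (l mod M)" "Suc l div M = l div M" by (simp_all add: mod_Suc div_Suc)
    then show ?thesis by (simp add: algebra_simps)
  qed
  have "variance S \<le> variance (fst (bisect S)) + variance (snd (bisect S)) + c0 * (diameter (sconv S))\<^sup>2 * energy S"
    unfolding c0 by (rule variance_node[OF node.hyps node.prems(1,2)])
  also have "c0 * (diameter (sconv S))\<^sup>2 * energy S \<le> c0 * (H\<^sup>2 * (1/4) ^ (l div M)) * energy S"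
    using sq c0pos energy_nonneg by (intro mult_right_mono mult_left_mono) auto
  finally have "variance S \<le> ?R (Suc l) * energy S + c0 * (H\<^sup>2 * (1/4) ^ (l div M)) * energy S"
    using i1 i2 unfolding en by (simp add: distrib_left)
  also have "\<dots> = ?R l * energy S" unfolding step by (simp add: algebra_simps)
  finally show ?case .
qed

text \<open>Two distinct elements inside \<open>K\<close> cannot share a side lying on the boundary of \<open>K\<close>: moving slightly
  from the common side towards the opposite vertex of one of them stays inside the other.\<close>

lemma elem_at_boundary:
  assumes S: "S \<in> Th" "sconv S \<subseteq> sconv K" and r: "r \<in> verts S" and q: "q \<in> verts K"
    and F: "verts S - {r} \<subseteq> convex hull (verts K - {q})"
    and y: "y \<in> rel_interior (convex hull (verts S - {r}))"
  shows "elem_at y = S"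
proof (rule ccontr)
  assume ne: "elem_at y \<noteq> S"
  define F0 where "F0 = verts S - {r}"
  define S' where "S' = elem_at y"
  note VS = nondeg_nsimplex[OF Th_nondeg[OF S(1)]]
  have KK: "nsimplex (verts K)" by (rule nondeg_nsimplex[OF nondeg_K])
  have yF: "y \<in> convex hull F0" using y rel_interior_subset by (auto simp: F0_def)
  have yS: "y \<in> sconv S" using yF hull_mono[of F0 "verts S" convex] by (auto simp: sconv_def F0_def)
  note S' = elem_at_props[OF S yS, folded S'_def]
  note VS' = nondeg_nsimplex[OF Th_nondeg[OF S'(1)]]
  have ne': "S \<noteq> S'" using ne by (simp add: S'_def)
  have F0S': "F0 \<subseteq> verts S'"
    by (rule common_face[OF S(1) S'(1) _ _ S'(3), of F0]) (use y in \<open>auto simp: F0_def\<close>)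
  have cF: "card F0 = CARD('n)" "finite F0" using nsimplexD[OF VS] r by (auto simp: F0_def)
  have "card (verts S' - F0) = 1" using nsimplexD(1,2)[OF VS'] cF F0S' by (simp add: card_Diff_subset)
  then obtain b where b: "verts S' - F0 = {b}" by (auto simp: card_1_singleton_iff)
  have VS'b: "verts S' = insert b F0" "b \<notin> F0" using b F0S' by auto
  have VSr: "verts S = insert r F0" and rF: "r \<notin> F0" using r by (auto simp: F0_def)
  have "r \<noteq> b" using Th_verts_neq[OF S(1) S'(1) ne'] VS'b VSr by auto
  then have int: "verts S \<inter> verts S' = F0" using VS'b VSr rF by auto
  \<comment> \<open>\<open>L\<close> measures the height over the side of \<open>K\<close> opposite
    \<open>q\<close>: zero on the common side, nonnegative on \<open>K\<close>.\<close>
  define L where "L = bary (verts K) q"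
  have L: "affine_fun L" unfolding L_def by (rule nsimplex_bary_affine[OF KK])
  have Lq: "L q = 1" unfolding L_def using q by (simp add: nsimplex_bary_vertex[OF KK])
  have L0: "L x = 0" if "x \<in> convex hull (verts K - {q})" for x
    by (rule affine_fun_zero_hull[OF L _ that]) (auto simp: L_def nsimplex_bary_vertex[OF KK])
  have Lnn: "0 \<le> L x" if "x \<in> sconv K" for x
    using nsimplex_hull_bary[OF KK] that q by (auto simp: sconv_def L_def)
  have LF: "L x = 0" if "x \<in> F0" for x using F that by (intro L0) (auto simp: F0_def)
  \<comment> \<open>Otherwise \<open>L\<close> would vanish at all vertices of a full-dimensional
    simplex, hence everywhere, contrary to its value 1 at \<open>q\<close>.\<close>
  have pos: "0 < L c" if X: "nsimplex (insert c F0)" "c \<in> sconv K" for c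
  proof (rule ccontr)
    assume "\<not> 0 < L c"
    then have "L c = 0" using Lnn[OF X(2)] by simp
    then have "(\<Sum>v\<in>insert c F0. bary (insert c F0) v q * L v) = 0" by (intro sum.neutral) (use LF in auto)
    then have "L q = 0" using nsimplex_bary_expand[OF X(1) L, of q] by (simp only:)
    then show False using Lq by simp
  qed
  have Lr: "0 < L r"
  proof (rule pos)
    show "nsimplex (insert r F0)" using VS unfolding VSr .
    show "r \<in> sconv K" using S(2) hull_inc[OF r, of convex] by (auto simp: sconv_def)
  qed
  have Lb: "0 < L b"
  proof (rule pos)
    show "nsimplex (insert b F0)" using VS' unfolding VS'b(1) .
    show "b \<in> sconv K" using S'(2) hull_inc[of b "verts S'" convex] VS'b(1) by (auto simp: sconv_def)
  qed
  let ?\<beta> = "bary (verts S)"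
  \<comment> \<open>Both heights are positive, so \<open>b\<close> lies on the same side of the
    common face as \<open>r\<close>.\<close>
  have "L b = ?\<beta> r b * L r"
  proof -
    have "L b = (\<Sum>v\<in>verts S. ?\<beta> v b * L v)" by (rule nsimplex_bary_expand[OF VS L])
    also have "\<dots> = ?\<beta> r b * L r + (\<Sum>v\<in>F0. ?\<beta> v b * L v)"
      unfolding F0_def by (rule sum.remove[OF nsimplexD(1)[OF VS] r])
    also have "(\<Sum>v\<in>F0. ?\<beta> v b * L v) = 0" by (intro sum.neutral ballI) (simp add: LF)
    finally have "L b = ?\<beta> r b * L r + 0" .
    then show ?thesis by simp
  qed
  then have br: "0 < ?\<beta> r b" using Lr Lb by (simp add: zero_less_mult_iff)
  have bF: "0 < ?\<beta> v y" if "v \<in> F0" for v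
    by (rule rel_interior_weights[OF nsimplexD(3,1)[OF VS] _ y]) (use that in \<open>auto simp: F0_def\<close>)
  \<comment> \<open>The coordinates of \<open>y\<close> at the vertices of the face are positive and
    stay so for small t; the one at \<open>r\<close> grows from zero. Thus the moved point lies in
    \<open>S\<close>.\<close>
  have "\<forall>\<^sub>F t in at_right 0. \<forall>v\<in>F0. 0 < (1 - t) * ?\<beta> v y + t * ?\<beta> v b"
  proof (intro eventually_ball_finite cF ballI)
    fix v assume v: "v \<in> F0"
    have "((\<lambda>t. (1 - t) * ?\<beta> v y + t * ?\<beta> v b) \<longlongrightarrow> (1 - 0) * ?\<beta> v y + 0 * ?\<beta> v b) (at_right 0)"
      by (intro tendsto_intros)
    then show "\<forall>\<^sub>F t in at_right 0. 0 < (1 - t) * ?\<beta> v y + t * ?\<beta> v b"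
      by (rule order_tendstoD) (use bF[OF v] in simp)
  qed
  moreover have "\<forall>\<^sub>F t::real in at_right 0. t \<in> {0<..<1}"
    using eventually_at_right_real[of 0 1] by simp
  ultimately have "\<forall>\<^sub>F t in at_right 0. (\<forall>v\<in>F0. 0 < (1 - t) * ?\<beta> v y + t * ?\<beta> v b) \<and> t \<in> {0<..<1}"
    by (rule eventually_conj)
  then obtain t where t: "\<forall>v\<in>F0. 0 < (1 - t) * ?\<beta> v y + t * ?\<beta> v b" "0 < t" "t < 1"
    using eventually_happens[of _ "at_right (0::real)"] by auto
  define z where "z = (1 - t) *\<^sub>R y + t *\<^sub>R b"
  have comb: "f z = (1 - t) * f y + t * f b" if "affine_fun f" for f
  proof -
    obtain c d where "\<And>x. f x = c \<bullet> x + d" using \<open>affine_fun f\<close> by (auto simp: affine_fun_def)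
    then show ?thesis by (simp add: z_def inner_add_right algebra_simps)
  qed
  have ry: "?\<beta> r y = 0"
    by (rule affine_fun_zero_hull[OF nsimplex_bary_affine[OF VS] _ yF]) (auto simp: nsimplex_bary_vertex[OF VS] F0_def)
  have "0 \<le> ?\<beta> v z" if v: "v \<in> verts S" for v
  proof (cases "v = r")
    case True
    then show ?thesis using comb[OF nsimplex_bary_affine[OF VS], of r] ry br t by simp
  next
    case False
    then have "v \<in> F0" using v by (simp add: F0_def)
    then show ?thesis using comb[OF nsimplex_bary_affine[OF VS], of v] t(1) by (auto simp: less_imp_le)
  qed
  then have zS: "z \<in> sconv S" unfolding sconv_def by (simp add: nsimplex_hull_bary[OF VS])
  have "z \<in> sconv S'"
    unfolding z_def sconv_def
    by (rule convexD[OF convex_convex_hull]) (use S'(3) t VS'b in \<open>auto simp: sconv_def hull_inc\<close>)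
  \<comment> \<open>The moved point is in both elements, hence in the common face, where
    \<open>L\<close> vanishes; but its height is t times that of \<open>b\<close>.\<close>
  then have zF: "z \<in> convex hull F0" using zS Th_inter[OF S(1) S'(1) ne'] int by auto
  have "L z = 0" by (rule affine_fun_zero_hull[OF L LF zF])
  moreover have "L y = 0" by (rule affine_fun_zero_hull[OF L LF yF])
  ultimately show False using comb[OF L] Lb t by simp
qed

text \<open>On the boundary of \<open>K\<close> the mean of the fine function seen from inside
  equals the mean of \<open>trace\<close>: at a leaf the element is forced by
  \<open>elem_at_boundary\<close>, and both means obey the same averaging under bisection.
  Descendant sides within the side of \<open>K\<close> opposite \<open>q\<close> are included for
  the induction.\<close>

lemma boundary_mean:
  assumes "bisection_tree Th S" "nondeg_simplex S" "sconv S \<subseteq> sconv K" "r \<in> verts S"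
    and q: "q \<in> verts K" and "verts S - {r} \<subseteq> convex hull (verts K - {q})"
  shows "has_side_mean (pw u) (trace_mean (verts S - {r})) (verts S - {r})"
  using assms(1-4,6)
proof (induction arbitrary: r rule: bisection_tree.induct)
  case (leaf S)
  have E: "verts S - {r} \<in> sides S" using leaf by (auto simp: sides_def)
  have fc: "face (verts S - {r})" by (rule nsimplex_face[OF nondeg_nsimplex[OF leaf(2)] leaf(4)])
  show ?case unfolding trace_mean_leaf[OF leaf(1) E]
    by (rule has_side_mean_affine[OF fc u_affine[OF leaf(1)]])
      (simp add: pw_def elem_at_boundary[OF leaf(1,3,4) q leaf(5)])
next
  case (node S)
  obtain a b where ab: "a \<in> verts S" "b \<in> verts S" "a \<noteq> b"
    and v: "verts (fst (bisect S)) = insert (midpt a b) (verts S - {b})"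
    "verts (snd (bisect S)) = insert (midpt a b) (verts S - {a})"
    and nd: "nondeg_simplex (fst (bisect S))" "nondeg_simplex (snd (bisect S))"
    using bisect_nondeg[OF node.prems(1)] by metis
  let ?m = "midpt a b"
  have V: "nsimplex (verts S)" by (rule nondeg_nsimplex[OF node.prems(1)])
  have m: "?m \<notin> verts S" by (rule midpt_notin[OF nsimplexD(3)[OF V] ab])
  have sub: "sconv (fst (bisect S)) \<subseteq> sconv K" "sconv (snd (bisect S)) \<subseteq> sconv K"
    using node.prems(2) sconv_bisect(1)[OF node.prems(1)] by auto
  note IH = node.IH(1)[OF nd(1) sub(1), unfolded v] node.IH(2)[OF nd(2) sub(2), unfolded v]
  note tr = trace_tree[OF node.hyps(1) nd(1), unfolded v] trace_tree[OF node.hyps(2) nd(2), unfolded v]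
  consider "r = a" | "r = b" | "r \<noteq> a" "r \<noteq> b" by auto
  then show ?case
  proof cases
    case 1
    have "insert ?m (verts S - {a}) - {?m} = verts S - {a}" using m by auto
    then show ?thesis using IH(2)[of ?m] 1 node.prems(4) by simp
  next
    case 2
    have "insert ?m (verts S - {b}) - {?m} = verts S - {b}" using m by auto
    then show ?thesis using IH(1)[of ?m] 2 node.prems(4) by simp
  next
    case 3
    have e: "insert ?m (verts S - {b}) - {r} = insert ?m (verts S - {r} - {b})"
       "insert ?m (verts S - {a}) - {r} = insert ?m (verts S - {r} - {a})"
      using m node.prems by auto
    have ab': "a \<in> verts S - {r}" "b \<in> verts S - {r}" using ab 3 by auto
    have fc: "face (verts S - {r})" by (rule nsimplex_face[OF V node.prems(3)])
    have "?m \<in> convex hull (verts K - {q})"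
      using midpt_in_hull[OF ab'] hull_minimal[of "verts S - {r}" "convex hull (verts K - {q})" convex, OF node.prems(4) convex_convex_hull] by blast
    then have s: "insert ?m (verts S - {b}) - {r} \<subseteq> convex hull (verts K - {q})"
      "insert ?m (verts S - {a}) - {r} \<subseteq> convex hull (verts K - {q})"
      using node.prems(4) by auto
    have r12: "r \<in> insert ?m (verts S - {b})" "r \<in> insert ?m (verts S - {a})" using 3 node.prems(3) by auto
    have "trace_mean (verts S - {r}) = (trace_mean (insert ?m (verts S - {r} - {b})) + trace_mean (insert ?m (verts S - {r} - {a}))) / 2"
      by (rule trace_bisect(2)[OF fc ab' ab(3) tr(1)[OF r12(1), unfolded e] tr(2)[OF r12(2), unfolded e]])
    then show ?thesis
      using has_side_mean_bisect[OF fc ab' ab(3) IH(1)[OF r12(1) s(1), unfolded e] IH(2)[OF r12(2) s(2), unfolded e]] by (simp only:)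
  qed
qed

lemma poincare_zero_side_means:
  assumes t: "bisection_tree Th K"
    and sm0: "\<And>q. q \<in> verts K \<Longrightarrow> trace_mean (verts K - {q}) = 0"
    and diam: "\<And>S l. S \<in> descendants K l \<Longrightarrow> diameter (sconv S) \<le> diameter (sconv K) * (1/2) ^ (l div M)"
    and MN: "2 \<le> CARD('n)" "CARD('n) \<le> M"
  shows "integral (sconv K) (pw (\<lambda>S x. (u S x)\<^sup>2))
    \<le> (Cn_sq CARD('n) M + 1 / ((real CARD('n) + 1) * (real CARD('n) + 2) * (real CARD('n))\<^sup>2)) * (diameter (sconv K))\<^sup>2 * energy K"
proof -
  define N where "N = real CARD('n)"
  have N: "2 \<le> N" "N \<le> real M" using MN by (simp_all add: N_def)
  have VK: "nsimplex (verts K)" by (rule nondeg_nsimplex[OF nondeg_K])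
  note F = nsimplexD[OF VK]
  let ?v = "measure lebesgue (sconv K)" and ?h = "diameter (sconv K)"
  have v: "0 < ?v" unfolding sconv_def by (rule nsimplex_measure_pos[OF VK])
  define c0 where "c0 = (N\<^sup>2 - 1/2) / (N\<^sup>2 * (N + 1) * (N + 2))"
  \<comment> \<open>In generation 0 quotient and remainder are 0, so the factor is M + M/3.\<close>
  have 1: "variance K \<le> c0 * ?h\<^sup>2 * (4 * real M / 3) * energy K"
    using variance_tree[OF t nondeg_K subset_refl _ diam MN, of 0 c0] by (simp add: c0_def N_def)
  define p where "p = mid (verts K)"
  define I where "I = integral (sconv K) (pw u)"
  define B where "B = integral (sconv K) (pw (\<lambda>S x. (x - p) \<bullet> g S))"
  define A where "A = integral (sconv K) (\<lambda>x. (norm (x - p))\<^sup>2)"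
  have cK: "real (card (verts K)) = N + 1" using F by (simp add: N_def)
  have pm: "p = (\<Sum>q\<in>verts K. (1 / (N + 1)) *\<^sub>R q)"
    unfolding p_def mid_def cK by (simp add: scaleR_sum_right)
  have s1: "sum (\<lambda>q. 1 / (N + 1)) (verts K) = 1" using N by (simp add: cK)
  have "B + N * I = 0"
    using green_identity[OF t nondeg_K subset_refl s1 pm] unfolding B_def I_def N_def by (simp add: sm0)
  then have I: "I = - B / N" using N by (simp add: field_simps)
  have cs: "B\<^sup>2 \<le> A * energy K"
    unfolding A_def B_def
    by (rule quadratic_nonneg_discriminant) (rule cauchy_schwarz_quadratic[OF t nondeg_K subset_refl])
  \<comment> \<open>For the barycenter the second summand of the moment formula vanishes.\<close>
  have pq: "(\<Sum>q\<in>verts K. q - p) = 0"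
  proof -
    have "(\<Sum>q\<in>verts K. q - p) = (\<Sum>q\<in>verts K. q) - (N + 1) *\<^sub>R p"
      using cK by (simp add: sum_subtractf sum_constant_scaleR del: sum_constant)
    also have "(N + 1) *\<^sub>R p = (\<Sum>q\<in>verts K. q)" unfolding p_def mid_def cK using N by simp
    finally show ?thesis by simp
  qed
  \<comment> \<open>\<open>q - p\<close> is the average of \<open>q - r\<close> over n+1 vertices,
    one of which contributes zero.\<close>
  have dist: "norm (q - p) \<le> N / (N + 1) * ?h" if q: "q \<in> verts K" for q
  proof -
    have "(\<Sum>r\<in>verts K. q - r) = (N + 1) *\<^sub>R (q - p)"
    proof -
      have "(\<Sum>r\<in>verts K. q - r) = (\<Sum>r\<in>verts K. (q - p) - (r - p))" by simp
      also have "\<dots> = (\<Sum>r\<in>verts K. q - p) - (\<Sum>r\<in>verts K. r - p)" by (rule sum_subtractf)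
      also have "\<dots> = (\<Sum>r\<in>verts K. q - p)" unfolding pq by simp
      finally show ?thesis using cK by (simp add: sum_constant_scaleR del: sum_constant)
    qed
    then have "(N + 1) * norm (q - p) = norm (\<Sum>r\<in>verts K. q - r)" using N by simp
    also have "(\<Sum>r\<in>verts K. q - r) = (\<Sum>r\<in>verts K - {q}. q - r)"
      using sum.remove[OF F(1) q, of "\<lambda>r. q - r"] by simp
    also have "norm \<dots> \<le> (\<Sum>r\<in>verts K - {q}. ?h)"
      by (rule sum_norm_le) (use q in \<open>auto intro: verts_dist_le_diameter\<close>)
    also have "\<dots> = N * ?h" using F q by (simp add: N_def)
    finally show ?thesis using N by (simp add: field_simps)
  qed
  have "A = ?v / ((N + 1) * (N + 2)) * (\<Sum>q\<in>verts K. (norm (q - p))\<^sup>2)"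
    using integral_unique[OF has_integral_norm_square[OF VK, of p]] pq
    unfolding A_def N_def sconv_def by simp
  also have "\<dots> \<le> ?v / ((N + 1) * (N + 2)) * (\<Sum>q\<in>verts K. (N / (N + 1) * ?h)\<^sup>2)"
    using N by (intro mult_left_mono sum_mono power_mono dist) auto
  also have "\<dots> = ?v / ((N + 1) * (N + 2)) * ((N + 1) * (N / (N + 1) * ?h)\<^sup>2)" using cK by simp
  also have "\<dots> = ?v * (N\<^sup>2 / ((N + 1)\<^sup>2 * (N + 2))) * ?h\<^sup>2"
    using N by (simp add: power_mult_distrib power_divide mult_ac)
  finally have A: "A \<le> ?v * (N\<^sup>2 / ((N + 1)\<^sup>2 * (N + 2))) * ?h\<^sup>2" .
  have "I\<^sup>2 = B\<^sup>2 / N\<^sup>2" unfolding I by (simp add: power_divide)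
  then have "I\<^sup>2 / ?v = B\<^sup>2 / (N\<^sup>2 * ?v)" by (simp only: divide_divide_eq_left)
  also have "\<dots> \<le> (A * energy K) / (N\<^sup>2 * ?v)" using cs v by (intro divide_right_mono) auto
  also have "\<dots> \<le> (?v * (N\<^sup>2 / ((N + 1)\<^sup>2 * (N + 2))) * ?h\<^sup>2 * energy K) / (N\<^sup>2 * ?v)"
    using A v energy_nonneg[of K] by (intro divide_right_mono mult_right_mono) auto
  also have "\<dots> = 1 / ((N + 1)\<^sup>2 * (N + 2)) * ?h\<^sup>2 * energy K" using v N by simp
  finally have 2: "I\<^sup>2 / ?v \<le> 1 / ((N + 1)\<^sup>2 * (N + 2)) * ?h\<^sup>2 * energy K" .
  define k2 where "k2 = (4 * real M - 3) / (3 * N * (N + 2)) + 1 / ((N + 1) * (N + 2) * N\<^sup>2)"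
  \<comment> \<open>After clearing denominators the difference is 4(M-n)(n+1)(n+1/2) + n(n-1)(n-2) +
    3; the first summand is where n <= M is used.\<close>
  have key: "c0 * (4 * real M / 3) + 1 / ((N + 1)\<^sup>2 * (N + 2)) \<le> k2"
  proof -
    define D where "D = 3 * N\<^sup>2 * (N + 1)\<^sup>2 * (N + 2)"
    have D: "0 < D" unfolding D_def using N by simp
    have ne: "N \<noteq> 0" "N + 1 \<noteq> 0" "N + 2 \<noteq> 0" using N by auto
    have a1: "c0 * (4 * real M / 3) * D = (N\<^sup>2 - 1/2) * (4 * real M) * (N + 1)"
      unfolding c0_def D_def using ne by (simp add: divide_simps power2_eq_square)
    have a2: "1 / ((N + 1)\<^sup>2 * (N + 2)) * D = 3 * N\<^sup>2"
      unfolding D_def using ne by (simp add: divide_simps)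
    have a3: "(4 * real M - 3) / (3 * N * (N + 2)) * D = (4 * real M - 3) * N * (N + 1)\<^sup>2"
      unfolding D_def using ne by (simp add: divide_simps power2_eq_square)
    have a4: "1 / ((N + 1) * (N + 2) * N\<^sup>2) * D = 3 * (N + 1)"
      unfolding D_def using ne by (simp add: divide_simps power2_eq_square)
    have "(k2 - (c0 * (4 * real M / 3) + 1 / ((N + 1)\<^sup>2 * (N + 2)))) * D
      = (4 * real M - 3) * N * (N + 1)\<^sup>2 + 3 * (N + 1) - ((N\<^sup>2 - 1/2) * (4 * real M) * (N + 1) + 3 * N\<^sup>2)"
    proof -
      have "(a + b - (c + d)) * D = a * D + b * D - (c * D + d * D)" for a b c d by (simp add: algebra_simps)
      then show ?thesis unfolding k2_def by (simp only: a1 a2 a3 a4)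
    qed
    also have "\<dots> = 4 * (real M - N) * ((N + 1) * (N + 1/2)) + (N * ((N - 1) * (N - 2)) + 3)"
      by (simp add: field_simps power2_eq_square)
    also have "\<dots> \<ge> 0" using N by (intro add_nonneg_nonneg mult_nonneg_nonneg) auto
    finally show ?thesis using D by (simp add: zero_le_mult_iff)
  qed
  have "integral (sconv K) (pw (\<lambda>S x. (u S x)\<^sup>2)) = variance K + I\<^sup>2 / ?v"
    by (simp add: variance_def I_def)
  also have "\<dots> \<le> c0 * ?h\<^sup>2 * (4 * real M / 3) * energy K + 1 / ((N + 1)\<^sup>2 * (N + 2)) * ?h\<^sup>2 * energy K"
    using 1 2 by (rule add_mono)
  also have "\<dots> = (c0 * (4 * real M / 3) + 1 / ((N + 1)\<^sup>2 * (N + 2))) * (?h\<^sup>2 * energy K)"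
  proof -
    have "c * h * m * e + d * h * e = (c * m + d) * (h * e)" for c h m e d :: real by (simp add: algebra_simps)
    then show ?thesis .
  qed
  also have "\<dots> \<le> k2 * (?h\<^sup>2 * energy K)"
    using key energy_nonneg[of K] by (intro mult_right_mono) auto
  finally show ?thesis unfolding k2_def N_def Cn_sq_def by (simp only: mult.assoc)
qed

end

section \<open>The interpolation error estimate\<close>

lemma agrad_affine:
  assumes "affine_fun f" shows "\<exists>b. \<forall>x. f x = agrad f \<bullet> x + b"
  using assms unfolding affine_fun_def agrad_def by (rule someI_ex)

theorem theorem3p5:
  fixes \<Omega> :: "(real^'n) set" and T Th :: "'n tsimplex set"
    and vh w :: "'n tsimplex \<Rightarrow> real^'n \<Rightarrow> real" and M :: nat and K :: "'n tsimplex"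
  assumes "CARD('n) \<ge> 2"
    and "bounded \<Omega>" and "lipschitz_domain \<Omega>"
    and "triangulates T \<Omega>"
    and "Th \<in> refinements T"
    and "halving_number M T"
    and "CR0 Th \<Omega> vh"
    and "CR0 T \<Omega> w"
    and "\<forall>K'\<in>T. \<forall>E\<in>sides K'. w K' (mid E) = side_mean E (restr Th vh K')"
    and "K \<in> T"
  shows "L2norm_on (sconv K) (\<lambda>x. restr Th vh K x - w K x) / diameter (sconv K)
     \<le> kappa_NC CARD('n) M * L2norm_on (sconv K) (\<lambda>x. norm (grad_diff Th vh w K x))"
proof -
  have nK: "nondeg_simplex K"
    using assms(4,10) by (auto simp: triangulates_def regular_triangulation_def)
  have wK: "affine_fun (w K)" using assms(8,10) by (simp add: CR0_def)
  have vS: "affine_fun (vh S)" if "S \<in> Th" for S using assms(7) that by (simp add: CR0_def)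
  define u where "u S x = vh S x - w K x" for S x
  define g where "g S = agrad (vh S) - agrad (w K)" for S
  have "\<exists>k. \<forall>S\<in>Th. \<forall>x. u S x = g S \<bullet> x + k S"
  proof (rule bchoice, intro ballI)
    fix S assume "S \<in> Th"
    then obtain b c where "\<And>x. vh S x = agrad (vh S) \<bullet> x + b" "\<And>x. w K x = agrad (w K) \<bullet> x + c"
      using agrad_affine[OF vS] agrad_affine[OF wK] by metis
    then show "\<exists>k. \<forall>x. u S x = g S \<bullet> x + k"
      by (intro exI[of _ "b - c"]) (simp add: u_def g_def inner_diff_left)
  qed
  then obtain k where k: "\<And>S x. S \<in> Th \<Longrightarrow> u S x = g S \<bullet> x + k S" by auto
  interpret cr_refinement Th K g k u
  proof
    show "regular_triangulation Th" using assms(5) by (simp add: refinements_def)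
    show "u S (mid E) = u S' (mid E)" if "S \<in> Th" "S' \<in> Th" "E \<in> sides S" "E \<in> sides S'" for S S' E
    proof -
      have "vh S (mid E) = vh S' (mid E)" using assms(7) that unfolding CR0_def by blast
      then show ?thesis by (simp add: u_def)
    qed
  qed (use nK k in auto)
  have t: "bisection_tree Th K"
    using assms(5,10) by (intro refinement_bisection_tree) (auto simp: refinements_def)
  have half: "diameter (sconv S') \<le> diameter (sconv S) / 2" if "S \<in> descendants K j" "S' \<in> descendants S M" for j S S'
    using assms(6,10) that by (auto simp: halving_number_def)
  have VK: "nsimplex (verts K)" by (rule nondeg_nsimplex[OF nK])
  have hpos: "0 < diameter (sconv K)"
  proof -
    obtain a b where "a \<in> verts K" "b \<in> verts K" "a \<noteq> b" using bisect_nondeg[OF nK] by metis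
    then show ?thesis using verts_dist_le_diameter[of a K b] by (metis less_le_trans zero_less_norm_iff right_minus_eq)
  qed
  \<comment> \<open>With \<open>M = 0\<close> the simplex \<open>K\<close> would be its own
    descendant and have at most half its own diameter.\<close>
  have M: "0 < M"
  proof (rule ccontr)
    assume "\<not> 0 < M"
    then have "diameter (sconv K) \<le> diameter (sconv K) / 2" using half[of K 0 K] by simp
    then show False using hpos by simp
  qed
  have MN: "CARD('n) \<le> M" by (rule halving_number_ge_dimension[OF nK M half])
  have restr: "restr Th vh K x - w K x = pw u x" for x
    by (simp add: restr_def pw_def elem_at_def u_def)
  \<comment> \<open>The side mean of the fine function is the trace mean plus \<open>w K\<close> at
    the midpoint, and the interpolation condition makes it equal to that midpoint value.\<close>
  have sm0: "trace_mean (verts K - {q}) = 0" if q: "q \<in> verts K" for q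
  proof -
    let ?E = "verts K - {q}"
    have fc: "face ?E" by (rule nsimplex_face[OF VK q])
    have "has_side_mean (pw u) (trace_mean ?E) ?E"
      by (rule boundary_mean[OF t nK subset_refl q q hull_subset])
    \<comment> \<open>Adding \<open>w K\<close> back to \<open>u\<close> is done by subtracting its
      negative, to fit \<open>has_side_mean_diff\<close>.\<close>
    moreover have "has_side_mean (\<lambda>x. - 1 * w K x) (- 1 * w K (mid ?E)) ?E"
      by (rule has_side_mean_affine[OF fc affine_fun_cmult[OF wK]]) simp
    ultimately have "has_side_mean (\<lambda>x. pw u x - - 1 * w K x) (trace_mean ?E - - 1 * w K (mid ?E)) ?E"
      by (rule has_side_mean_diff)
    moreover have "(\<lambda>x. pw u x - - 1 * w K x) = restr Th vh K" by (auto simp: restr[symmetric])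
    ultimately have "side_mean ?E (restr Th vh K) = trace_mean ?E + w K (mid ?E)"
      using has_side_mean_side_mean[OF fc] by simp
    moreover have "?E \<in> sides K" using q by (auto simp: sides_def)
    ultimately show ?thesis using assms(9,10) by simp
  qed
  let ?X = "integral (sconv K) (pw (\<lambda>S x. (u S x)\<^sup>2))" and ?h = "diameter (sconv K)"
  have main: "?X \<le> (Cn_sq CARD('n) M + 1 / ((real CARD('n) + 1) * (real CARD('n) + 2) * (real CARD('n))\<^sup>2)) * ?h\<^sup>2 * energy K"
    by (rule poincare_zero_side_means[OF t sm0 descendants_diameter[OF nK M half] assms(1) MN])
  have L1: "L2norm_on (sconv K) (\<lambda>x. restr Th vh K x - w K x) = sqrt ?X"
    unfolding L2norm_on_def restr by (simp add: pw_def[abs_def])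
  have L2: "L2norm_on (sconv K) (\<lambda>x. norm (grad_diff Th vh w K x)) = sqrt (energy K)"
    unfolding L2norm_on_def by (simp add: pw_def[abs_def] grad_diff_def g_def elem_at_def)
  have "sqrt ?X \<le> kappa_NC CARD('n) M * ?h * sqrt (energy K)"
    using real_sqrt_le_mono[OF main] hpos by (simp add: real_sqrt_mult kappa_NC_def)
  then show ?thesis unfolding L1 L2 using hpos by (simp add: field_simps)
qed

end
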